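(* Let $e$ be an integer with $e>1$, let $\mathbf{s}=(s_0,s_1)\in\mathbb{Z}^2$ with $s_0\le s_1$, let $n\geq 0$ and let $\boldsymbol{\lambda}\in\Phi_{e,n}^{\mathbf{s}}$. Let $$b(\boldsymbol{\lambda})=\sum_{\boldsymbol{\nu}\in\Pi_{2,n}}c_{\boldsymbol{\lambda},\boldsymbol{\nu}}(v)\,\boldsymbol{\nu}$$ be the element labelled by $\boldsymbol{\lambda}$ of the canonical basis of the irreducible $\mathcal{U}_v(\mathfrak{sl}_\infty)$-module $L_{\mathbf{s}}$ of highest weight $\Lambda_{s_0}+\Lambda_{s_1}$. Then for $\boldsymbol{\mu}\in\Pi_{2,n}$ we have $\Psi_{(s_0,s_1)}^{(s_0,s_1+e)}(\boldsymbol{\lambda})=\boldsymbol{\mu}$ if and only if the degree of $c_{\boldsymbol{\lambda},\boldsymbol{\mu}}(v)$ is maximal in $b(\boldsymbol{\lambda})$, i.e. maximal among the degrees of the polynomials $c_{\boldsymbol{\lambda},\boldsymbol{\nu}}(v)$, $\boldsymbol{\nu}\in\Pi_{2,n}$ (the zero polynomial having degree $-\infty$).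
   Context: **Bipartitions and nodes.** $\Pi_{2,n}$ is the set of bipartitions $\boldsymbol{\lambda}=(\lambda^{(0)},\lambda^{(1)})$ of rank $n$ (pairs of partitions of total size $n$). The diagram of $\boldsymbol{\lambda}$ is $[\boldsymbol{\lambda}]=\{(a,b,c) : c\in\{0,1\},\ a\ge1,\ 1\le b\le\lambda^{(c)}_a\}$. Let $e\ge 2$ and $\mathbf{s}=(s_0,s_1)\in\mathbb{Z}^2$. The residue of $\gamma=(a,b,c)$ is $b-a+s_c \bmod e$; if it equals $i$, $\gamma$ is called an $i$-node. If $[\boldsymbol{\mu}]=[\boldsymbol{\lambda}]\cup\{\gamma\}$ with $\gamma\notin[\boldsymbol{\lambda}]$, then $\gamma$ is an addable node of $\boldsymbol{\lambda}$ and a removable node of $\boldsymbol{\mu}$. **Order and good nodes.** For $i$-nodes $\gamma=(a,b,c)$, $\gamma'=(a',b',c')$ write $\gamma<_{(s_0,s_1)}\gamma'$ if $b-a+s_c<b'-a'+s_{c'}$, or if $b-a+s_c=b'-a'+s_{c'}$ and $c'<c$. Given $\boldsymbol{\lambda}$ and $i\in\{0,\dots,e-1\}$, write all addable ($A$) and removable ($R$) $i$-nodes of $\boldsymbol{\lambda}$ in increasing order for $<_{(s_0,s_1)}$ and repeatedly delete adjacent pairs $RA$ until none remains. The remaining removable $i$-nodes are the normal $i$-nodes of $\boldsymbol{\lambda}$, and the smallest (leftmost) one, if any, is the good $i$-node of $\boldsymbol{\lambda}$. **Uglov bipartitions.** $\Phi_{e,0}^{\mathbf{s}}=\{(\emptyset,\emptyset)\}$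 and, for $n\ge1$, $\boldsymbol{\lambda}\in\Pi_{2,n}$ lies in $\Phi_{e,n}^{\mathbf{s}}$ iff there are $i$ and a good $i$-node $\gamma$ of $\boldsymbol{\lambda}$ (for $e,\mathbf{s}$) such that removing $\gamma$ from $\boldsymbol{\lambda}$ gives an element of $\Phi_{e,n-1}^{\mathbf{s}}$. These are the vertices of the crystal graph of the irreducible $\mathcal{U}_v(\widehat{\mathfrak{sl}}_e)$-module of highest weight $\Lambda_{s_0 \bmod e}+\Lambda_{s_1\bmod e}$, with edges $\boldsymbol{\lambda}\xrightarrow{i}\boldsymbol{\mu}$ iff $[\boldsymbol{\mu}]\setminus[\boldsymbol{\lambda}]$ is a good $i$-node of $\boldsymbol{\mu}$. **The bijection $\Psi$.** If $\{s_0,s_1\}$ and $\{s_0',s_1'\}$ agree modulo $e$ (either $s_0'\equiv s_0,\ s_1'\equiv s_1$, or $s_0'\equiv s_1,\ s_1'\equiv s_0$), the corresponding crystal graphs are isomorphic, and $\Psi_{(s_0,s_1)}^{(s_0',s_1')}:\Phi_{e,n}^{(s_0,s_1)}\to\Phi_{e,n}^{(s_0',s_1')}$ ($n\ge0$) denotes the resulting bijection: it sends $(\emptyset,\emptyset)$ to $(\emptyset,\emptyset)$, and if $\boldsymbol{\lambda}\in\Phi_{e,n}^{(s_0,s_1)}$, $\gamma$ is a good $i$-node of $\boldsymbol{\lambda}$ for $<_{(s_0,s_1)}$ whose removal gives $\boldsymbol{\lambda}'\in\Phi_{e,n-1}^{(s_0,s_1)}$, and $\boldsymbol{\mu}'=\Psi_{(s_0,s_1)}^{(s_0',s_1')}(\boldsymbol{\lambda}')$,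 then $\Psi_{(s_0,s_1)}^{(s_0',s_1')}(\boldsymbol{\lambda})$ is the unique bipartition $\boldsymbol{\mu}$ obtained by adding to $\boldsymbol{\mu}'$ an $i$-node which is a good $i$-node of $\boldsymbol{\mu}$ for $<_{(s_0',s_1')}$. (It is a known fact that this is well defined, independent of choices.) **The $\mathcal{U}_v(\mathfrak{sl}_\infty)$-module $L_{\mathbf{s}}$ and its canonical basis.** $\mathcal{U}_v(\mathfrak{sl}_\infty)$ is the quantum algebra of the doubly infinite diagram $A_\infty$, with Chevalley generators $e_i,f_i$ and fundamental weights $\Lambda_i$, $i\in\mathbb{Z}$. It acts on the Fock space with $\mathbb{C}(v)$-basis all bipartitions; the generators $f_i$ act by $$f_i\,\boldsymbol{\lambda}=\sum_{\boldsymbol{\mu}}v^{N_i(\boldsymbol{\lambda},\boldsymbol{\mu})}\boldsymbol{\mu},$$ where the sum is over bipartitions $\boldsymbol{\mu}$ obtained from $\boldsymbol{\lambda}$ by adding a node $\gamma=(a,b,c)$ with $b-a+s_c=i$ (equality in $\mathbb{Z}$), and $N_i(\boldsymbol{\lambda},\boldsymbol{\mu})=0$ if $c=0$, while if $c=1$, $N_i(\boldsymbol{\lambda},\boldsymbol{\mu})$ is the number of addable nodes minus the number of removable nodes $(a',b',0)$ of $\boldsymbol{\lambda}$ in component $0$ with $b'-a'+s_0=i$. The submodule $L_{\mathbf{s}}$ generated by $(\emptyset,\emptyset)$ is spanned by the vectors obtained from $(\emptyset,\emptyset)$ by applying products of $f_i$'s, and is the irreducible module of highest weight $\Lambda_{s_0}+\Lambda_{s_1}$.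 The bar involution of $L_{\mathbf{s}}$ is the unique additive map with $\overline{(\emptyset,\emptyset)}=(\emptyset,\emptyset)$, $\overline{f_i x}=f_i\overline{x}$ and $\overline{p(v)x}=p(v^{-1})\overline{x}$ for $p(v)\in\mathbb{C}(v)$. Assume $s_0\le s_1$ and let $$\Phi_{\infty,n}^{\mathbf{s}}=\{\boldsymbol{\lambda}\in\Pi_{2,n} : \lambda^{(0)}_i\ge\lambda^{(1)}_{i+s_1-s_0}\text{ for all } i\ge1\}.$$ For each $\boldsymbol{\lambda}\in\Phi_{\infty,n}^{\mathbf{s}}$ there is a unique bar-invariant element $b(\boldsymbol{\lambda})=\sum_{\boldsymbol{\nu}\in\Pi_{2,n}}c_{\boldsymbol{\lambda},\boldsymbol{\nu}}(v)\boldsymbol{\nu}\in L_{\mathbf{s}}$ with $c_{\boldsymbol{\lambda},\boldsymbol{\lambda}}(v)=1$ and $c_{\boldsymbol{\lambda},\boldsymbol{\nu}}(v)\in v\mathbb{Z}[v]$ for $\boldsymbol{\nu}\ne\boldsymbol{\lambda}$; these elements ($n\ge0$) form the (Kashiwara–Lusztig) canonical basis of $L_{\mathbf{s}}$. It is known that $\Phi_{e,n}^{\mathbf{s}}\subseteq\Phi_{\infty,n}^{\mathbf{s}}$ when $s_0\le s_1$, so $b(\boldsymbol{\lambda})$ is defined for $\boldsymbol{\lambda}\in\Phi_{e,n}^{\mathbf{s}}$. *)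

theory Defs
  imports
    Complex_Main
    "HOL-Library.Poly_Mapping"
    "HOL-Library.Extended_Real"
    "HOL-Computational_Algebra.Polynomial_Factorial"
begin

section \<open>Bipartitions and their nodes\<close>

typedef partition = "{xs :: nat list. sorted_wrt (\<ge>) xs \<and> 0 \<notin> set xs}"
  by (rule exI[of _ "[]"]) simp

type_synonym bipartition = "partition \<times> partition"

text \<open>Rows, columns and parts are numbered from 1; parts beyond the length are 0.\<close>

definition part :: "partition \<Rightarrow> nat \<Rightarrow> nat" where
  "part p a =
     (if 1 \<le> a \<and> a \<le> length (Rep_partition p) then Rep_partition p ! (a - 1) else 0)"

definition empty_bipartition :: bipartition where
  "empty_bipartition = (Abs_partition [], Abs_partition [])"

definition bip_rank :: "bipartition \<Rightarrow> nat" where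
  "bip_rank lam = sum_list (Rep_partition (fst lam)) + sum_list (Rep_partition (snd lam))"

definition bipartitions :: "nat \<Rightarrow> bipartition set" where
  "bipartitions n = {lam. bip_rank lam = n}"

type_synonym node = "nat \<times> nat \<times> nat"

definition component :: "bipartition \<Rightarrow> nat \<Rightarrow> partition" where
  "component lam c = (if c = 0 then fst lam else snd lam)"

definition diagram :: "bipartition \<Rightarrow> node set" where
  "diagram lam =
     {(a, b, c). c \<in> {0, 1} \<and> 1 \<le> a \<and> 1 \<le> b \<and> b \<le> part (component lam c) a}"

definition adds_node :: "bipartition \<Rightarrow> node \<Rightarrow> bipartition \<Rightarrow> bool" where
  "adds_node lam g mu \<longleftrightarrow> g \<notin> diagram lam \<and> diagram mu = insert g (diagram lam)"

definition addable :: "bipartition \<Rightarrow> node \<Rightarrow> bool" where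
  "addable lam g \<longleftrightarrow> (\<exists>mu. adds_node lam g mu)"

definition removable :: "bipartition \<Rightarrow> node \<Rightarrow> bool" where
  "removable mu g \<longleftrightarrow> (\<exists>lam. adds_node lam g mu)"

type_synonym charge = "int \<times> int"

fun node_content :: "charge \<Rightarrow> node \<Rightarrow> int" where
  "node_content s (a, b, c) = int b - int a + (if c = 0 then fst s else snd s)"

definition node_residue :: "int \<Rightarrow> charge \<Rightarrow> node \<Rightarrow> int" where
  "node_residue e s g = node_content s g mod e"

section \<open>Good nodes, Uglov bipartitions and the crystal isomorphism\<close>

fun node_less :: "charge \<Rightarrow> node \<Rightarrow> node \<Rightarrow> bool" where
  "node_less s (a, b, c) (a', b', c') \<longleftrightarrow>
     node_content s (a, b, c) < node_content s (a', b', c') \<or>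
     node_content s (a, b, c) = node_content s (a', b', c') \<and> c' < c"

definition is_signature :: "int \<Rightarrow> charge \<Rightarrow> int \<Rightarrow> bipartition \<Rightarrow> node list \<Rightarrow> bool" where
  "is_signature e s i lam w \<longleftrightarrow>
     sorted_wrt (node_less s) w \<and>
     set w = {g. (addable lam g \<or> removable lam g) \<and> node_residue e s g = i}"

inductive cancel_RA :: "bipartition \<Rightarrow> node list \<Rightarrow> node list \<Rightarrow> bool" for lam where
  "\<lbrakk>removable lam r; addable lam a\<rbrakk> \<Longrightarrow> cancel_RA lam (xs @ [r, a] @ ys) (xs @ ys)"

definition normal_nodes :: "int \<Rightarrow> charge \<Rightarrow> int \<Rightarrow> bipartition \<Rightarrow> node set" where
  "normal_nodes e s i lam =
     {g. removable lam g \<and>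
         (\<exists>w w'. is_signature e s i lam w \<and> (cancel_RA lam)\<^sup>*\<^sup>* w w' \<and>
                 (\<nexists>w''. cancel_RA lam w' w'') \<and> g \<in> set w')}"

definition good_node :: "int \<Rightarrow> charge \<Rightarrow> int \<Rightarrow> bipartition \<Rightarrow> node \<Rightarrow> bool" where
  "good_node e s i lam g \<longleftrightarrow>
     g \<in> normal_nodes e s i lam \<and>
     (\<forall>h \<in> normal_nodes e s i lam. h \<noteq> g \<longrightarrow> node_less s g h)"

primrec uglov :: "int \<Rightarrow> charge \<Rightarrow> nat \<Rightarrow> bipartition set" where
  "uglov e s 0 = {empty_bipartition}"
| "uglov e s (Suc n) =
     {lam \<in> bipartitions (Suc n).
        \<exists>i g lam'. good_node e s i lam g \<and> adds_node lam' g lam \<and> lam' \<in> uglov e s n}"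

inductive crystal_match :: "int \<Rightarrow> charge \<Rightarrow> charge \<Rightarrow> bipartition \<Rightarrow> bipartition \<Rightarrow> bool"
  for e s s' where
  "crystal_match e s s' empty_bipartition empty_bipartition"
| "\<lbrakk>lam \<in> uglov e s (Suc n); good_node e s i lam g; adds_node lam' g lam; lam' \<in> uglov e s n;
    crystal_match e s s' lam' mu';
    adds_node mu' h mu; good_node e s' i mu h\<rbrakk>
   \<Longrightarrow> crystal_match e s s' lam mu"

definition Psi :: "int \<Rightarrow> charge \<Rightarrow> charge \<Rightarrow> bipartition \<Rightarrow> bipartition" where
  "Psi e s s' lam = (THE mu. crystal_match e s s' lam mu)"

section \<open>The Fock space over the field of rational functions\<close>

text \<open>The field \<open>\<complex>(v)\<close> is the fraction field of \<open>complex poly\<close>.\<close>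

type_synonym scalar = "complex poly fract"

definition v_param :: scalar where
  "v_param = to_fract [:0, 1:]"

definition eval_at_inverse_v :: "complex poly \<Rightarrow> scalar" where
  "eval_at_inverse_v p = poly (map_poly (\<lambda>c. to_fract [:c:]) p) (inverse v_param)"

text \<open>The substitution \<open>p(v) \<mapsto> p(v\<^sup>-\<^sup>1)\<close>; it is independent of the chosen fraction,
  see \<open>bar_scalar_Fract\<close>.\<close>

definition bar_scalar :: "scalar \<Rightarrow> scalar" where
  "bar_scalar r =
     (THE q. \<exists>a b. b \<noteq> 0 \<and> r = Fract a b \<and> q = eval_at_inverse_v a / eval_at_inverse_v b)"

lemma eval_at_inverse_v_0 [simp]: "eval_at_inverse_v 0 = 0"
  by (simp add: eval_at_inverse_v_def)

lemma eval_at_inverse_v_pCons: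
  "eval_at_inverse_v (pCons a p) = to_fract [:a:] + inverse v_param * eval_at_inverse_v p"
  by (cases "pCons a p = 0") (simp_all add: eval_at_inverse_v_def map_poly_pCons)

lemma eval_at_inverse_v_add:
  "eval_at_inverse_v (p + q) = eval_at_inverse_v p + eval_at_inverse_v q"
proof (induction p q rule: poly_induct2)
  case (pCons a p b q)
  have "to_fract [:a + b:] = to_fract [:a:] + to_fract [:b:]"
    by (simp flip: to_fract_add)
  with pCons show ?case
    by (simp add: eval_at_inverse_v_pCons algebra_simps)
qed simp

lemma eval_at_inverse_v_smult:
  "eval_at_inverse_v (smult c p) = to_fract [:c:] * eval_at_inverse_v p"
proof (induction p)
  case (pCons a p)
  have "to_fract [:c * a:] = to_fract [:c:] * to_fract [:a:]"
    by (simp flip: to_fract_mult)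
  with pCons show ?case
    by (simp add: eval_at_inverse_v_pCons algebra_simps)
qed simp

lemma eval_at_inverse_v_mult:
  "eval_at_inverse_v (p * q) = eval_at_inverse_v p * eval_at_inverse_v q"
  by (induction p)
    (simp_all add: eval_at_inverse_v_pCons eval_at_inverse_v_add eval_at_inverse_v_smult
      algebra_simps)

lemma v_param_nonzero: "v_param \<noteq> 0"
  by (simp add: v_param_def)

lemma eval_at_inverse_v_reflect:
  "\<exists>q k. eval_at_inverse_v p * v_param ^ k = to_fract q \<and> (p \<noteq> 0 \<longrightarrow> q \<noteq> 0) \<and> degree q \<le> k"
proof (induction p)
  case 0
  then show ?case by (intro exI[of _ 0]) simp
next
  case (pCons a p)
  then obtain q k where IH: "eval_at_inverse_v p * v_param ^ k = to_fract q"
    "p \<noteq> 0 \<longrightarrow> q \<noteq> 0" "degree q \<le> k"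
    by blast
  let ?q = "monom a (Suc k) + q"
  have "to_fract (monom a m) = to_fract [:a:] * v_param ^ m" for m
  proof (induction m)
    case (Suc m)
    have "monom a (Suc m) = [:0, 1:] * monom a m"
      by (simp add: monom_Suc)
    with Suc show ?case
      by (simp add: v_param_def algebra_simps del: mult_pCons_left mult_pCons_right)
  qed (simp add: monom_0)
  then have "to_fract (monom a (Suc k)) = to_fract [:a:] * v_param ^ Suc k" .
  moreover have "inverse v_param * (eval_at_inverse_v p * v_param ^ Suc k)
      = eval_at_inverse_v p * v_param ^ k"
    using v_param_nonzero by simp
  ultimately have "eval_at_inverse_v (pCons a p) * v_param ^ Suc k = to_fract ?q"
    using IH(1)
    by (simp add: eval_at_inverse_v_pCons distrib_right mult.assoc del: power_Suc)
  moreover have "?q \<noteq> 0" if "pCons a p \<noteq> 0"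
  proof (cases "a = 0")
    case False
    then have "coeff ?q (Suc k) \<noteq> 0"
      using IH(3) by (simp add: coeff_eq_0)
    then show ?thesis by (metis coeff_0)
  qed (use IH(2) that in auto)
  moreover have "degree ?q \<le> Suc k"
    using IH(3) by (intro degree_add_le) (auto intro: degree_monom_le)
  ultimately show ?case by blast
qed

lemma eval_at_inverse_v_nonzero: "p \<noteq> 0 \<Longrightarrow> eval_at_inverse_v p \<noteq> 0"
  using eval_at_inverse_v_reflect[of p] by auto

lemma bar_scalar_Fract:
  assumes "b \<noteq> 0"
  shows "bar_scalar (Fract a b) = eval_at_inverse_v a / eval_at_inverse_v b"
  unfolding bar_scalar_def
proof (rule the_equality)
  fix q
  assume "\<exists>a' b'. b' \<noteq> 0 \<and> Fract a b = Fract a' b' \<and>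
    q = eval_at_inverse_v a' / eval_at_inverse_v b'"
  then obtain a' b' where *: "b' \<noteq> 0" "Fract a b = Fract a' b'"
    "q = eval_at_inverse_v a' / eval_at_inverse_v b'"
    by blast
  then have "a * b' = a' * b"
    using assms by (simp add: eq_fract)
  then have "eval_at_inverse_v a * eval_at_inverse_v b'
      = eval_at_inverse_v a' * eval_at_inverse_v b"
    by (metis eval_at_inverse_v_mult)
  with * assms show "q = eval_at_inverse_v a / eval_at_inverse_v b"
    by (simp add: eval_at_inverse_v_nonzero frac_eq_eq)
qed (use assms in blast)

type_synonym fock = "bipartition \<Rightarrow>\<^sub>0 scalar"

abbreviation coeff_of :: "fock \<Rightarrow> bipartition \<Rightarrow> scalar" where
  "coeff_of \<equiv> Poly_Mapping.lookup"

abbreviation basis_vector :: "bipartition \<Rightarrow> fock" where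
  "basis_vector lam \<equiv> Poly_Mapping.single lam 1"

definition fock_scale :: "scalar \<Rightarrow> fock \<Rightarrow> fock" where
  "fock_scale r x = Poly_Mapping.map ((*) r) x"

lemma lookup_fock_scale: "coeff_of (fock_scale r x) lam = r * coeff_of x lam"
  by (simp add: fock_scale_def Poly_Mapping.map.rep_eq when_def)

interpretation fock: vector_space fock_scale
  by standard
    (auto intro!: poly_mapping_eqI simp: lookup_fock_scale lookup_add algebra_simps)

definition f_exponent :: "charge \<Rightarrow> int \<Rightarrow> bipartition \<Rightarrow> node \<Rightarrow> int" where
  "f_exponent s i lam g =
     (if snd (snd g) = 0 then 0
      else int (card {h. addable lam h \<and> snd (snd h) = 0 \<and> node_content s h = i})
         - int (card {h. removable lam h \<and> snd (snd h) = 0 \<and> node_content s h = i}))"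

text \<open>The index set below is finite: the nodes that can be added to a bipartition, and hence
  the results, are finitely many.\<close>

definition f_basis :: "charge \<Rightarrow> int \<Rightarrow> bipartition \<Rightarrow> fock" where
  "f_basis s i lam =
     (\<Sum>(g, mu) \<in> {(g, mu). adds_node lam g mu \<and> node_content s g = i}.
        fock_scale (v_param powi f_exponent s i lam g) (basis_vector mu))"

definition f_op :: "charge \<Rightarrow> int \<Rightarrow> fock \<Rightarrow> fock" where
  "f_op s i x = (\<Sum>lam \<in> Poly_Mapping.keys x. fock_scale (coeff_of x lam) (f_basis s i lam))"

section \<open>The irreducible submodule and its canonical basis\<close>

definition irr_module :: "charge \<Rightarrow> fock set" where
  "irr_module s = fock.span {foldr (f_op s) is (basis_vector empty_bipartition) | is. True}"

definition is_bar_involution :: "charge \<Rightarrow> (fock \<Rightarrow> fock) \<Rightarrow> bool" where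
  "is_bar_involution s B \<longleftrightarrow>
     (\<forall>x \<in> irr_module s. B x \<in> irr_module s) \<and>
     (\<forall>x \<in> irr_module s. \<forall>y \<in> irr_module s. B (x + y) = B x + B y) \<and>
     B (basis_vector empty_bipartition) = basis_vector empty_bipartition \<and>
     (\<forall>i. \<forall>x \<in> irr_module s. B (f_op s i x) = f_op s i (B x)) \<and>
     (\<forall>p. \<forall>x \<in> irr_module s. B (fock_scale p x) = fock_scale (bar_scalar p) (B x))"

text \<open>As HOL functions are total, the value outside \<open>irr_module s\<close> is fixed to be \<open>undefined\<close>, so that
  the bar involution of \<open>irr_module s\<close> is unique as a function.\<close>

definition bar_involution :: "charge \<Rightarrow> fock \<Rightarrow> fock" where
  "bar_involution s = (THE B. is_bar_involution s B \<and> (\<forall>x. x \<notin> irr_module s \<longrightarrow> B x = undefined))"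

definition of_int_polynomial :: "int poly \<Rightarrow> scalar" where
  "of_int_polynomial p = to_fract (map_poly of_int p)"

definition Phi_infinity :: "charge \<Rightarrow> nat \<Rightarrow> bipartition set" where
  "Phi_infinity s n =
     {lam \<in> bipartitions n.
        \<forall>i\<ge>1. part (fst lam) i \<ge> part (snd lam) (i + nat (snd s - fst s))}"

definition is_canonical :: "charge \<Rightarrow> bipartition \<Rightarrow> fock \<Rightarrow> bool" where
  "is_canonical s lam b \<longleftrightarrow>
     lam \<in> Phi_infinity s (bip_rank lam) \<and>
     b \<in> irr_module s \<and> bar_involution s b = b \<and>
     Poly_Mapping.keys b \<subseteq> bipartitions (bip_rank lam) \<and>
     coeff_of b lam = 1 \<and>
     (\<forall>nu. nu \<noteq> lam \<longrightarrow> (\<exists>p. coeff_of b nu = of_int_polynomial ([:0, 1:] * p)))"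

definition canonical :: "charge \<Rightarrow> bipartition \<Rightarrow> fock" where
  "canonical s lam = (THE b. is_canonical s lam b)"

definition canonical_coeff :: "charge \<Rightarrow> bipartition \<Rightarrow> bipartition \<Rightarrow> int poly" where
  "canonical_coeff s lam nu = (THE p. coeff_of (canonical s lam) nu = of_int_polynomial p)"

definition poly_degree :: "'a::zero poly \<Rightarrow> ereal" where
  "poly_degree p = (if p = 0 then -\<infinity> else ereal (real (degree p)))"

end

theory Submission
  imports Defs
begin

text \<open>
  A bipartition is encoded by its two sets of beads on \<open>\<int>\<close>. The sites carrying a bead of exactly one
  component are read from left to right as a word, with letter \<open>True\<close> for a bead of the second component and
  \<open>False\<close> for the first. Matching each \<open>False\<close> with a preceding \<open>True\<close> as brackets gives a
  diagram of cups, and \<open>\<lambda> \<in> \<Phi>\<^sub>\<infinity>\<close> says that every \<open>False\<close> is matched. The vector obtained by summing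
  over all ways to flip cups, weighted by \<open>v\<close> to the number of flipped cups (Leclerc and Miyachi), is mapped by
  every \<open>f\<^sub>j\<close> to \<open>0\<close>, another such vector or \<open>v + v\<^sup>-\<^sup>1\<close> times such a vector, by a Temperley--Lieb
  straightening. So these vectors form a basis of \<open>L\<^sub>s\<close>, the bar involution is the semilinear map fixing them, and
  they are the canonical basis. The degree is maximal exactly for the bipartition with all cups flipped.
  On the other hand, the signatures for \<open>(s\<^sub>0, s\<^sub>1)\<close> and \<open>(s\<^sub>0, s\<^sub>1 + e)\<close> differ only by exchanging,
  within each content, the two components; flipping all cups compensates for this, so it commutes with
  adding good nodes and is the crystal isomorphism.
\<close>

section \<open>Words and cup diagrams\<close>

text \<open>The number of beads on each site (\<open>level\<close>) together with
  \<open>word\<close> determines the bipartition. All terms of a cup vector have the same levels and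
  \<open>f_op\<close> changes these in one way, so its action reduces to an identity between words;
  the exponents of \<open>f_op\<close> are exactly those that make a new cup and a closed loop come
  out right. Commutation of the bar map with \<open>f_op\<close> then rests on the invariance of the
  loop value under \<open>bar_scalar\<close>. Deletion of pairs in a signature is hard to compare
  for two orders of the nodes. It is therefore replaced by height functions on a scale with two
  positions for each content. At the ends of these blocks the heights depend only on levels, which
  flipping preserves; inside a block a peak means a cup on two neighbouring sites, which flipping
  reverses just as the second order does. So the relevant maximum falls into the same block for both
  orders. For Uglov bipartitions, the matching of every \<open>False\<close> and the inequalities of
  \<open>Phi_infinity\<close> are each propagated along the crystal.\<close>

text \<open>
  Letters are read from the right: \<open>pend w\<close> counts the letters \<open>False\<close> of \<open>w\<close> without a partner to their left.
\<close>

fun pend :: "bool list \<Rightarrow> nat" where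
  "pend [] = 0"
| "pend (True # w) = pend w - 1"
| "pend (False # w) = Suc (pend w)"

text \<open>A \<open>True\<close> is turned over exactly when a \<open>False\<close> to its right
  still waits for a partner; an unmatched \<open>True\<close> stays. A \<open>False\<close> is
  turned over without a test; \<open>count_flip\<close> measures the effect of the unmatched
  ones.\<close>

fun flip :: "bool list \<Rightarrow> bool list" where
  "flip [] = []"
| "flip (False # w) = True # flip w"
| "flip (True # w) = (pend w = 0) # flip w"

text \<open>
  The word \<open>w\<close> is read as a cup diagram, the stack \<open>st\<close> holds the letters of \<open>u\<close> at the cups still open,
  and the result is the number of flipped cups, or \<open>None\<close> if \<open>u\<close> does not arise from \<open>w\<close> by flipping cups.
\<close>

fun cup_deg :: "bool list \<Rightarrow> bool list \<Rightarrow> bool list \<Rightarrow> nat option" where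
  "cup_deg st [] [] = (if False \<in> set st then None else Some 0)"
| "cup_deg st (True # w) (a # u) = cup_deg (a # st) w u"
| "cup_deg (c # st) (False # w) (a # u) =
     (if a = c then None else map_option (if a then Suc else id) (cup_deg st w u))"
| "cup_deg _ _ _ = None"

section \<open>Locality of matching and flipping\<close>

lemma pend_append_cong: "pend y = pend y' \<Longrightarrow> pend (x @ y) = pend (x @ y')"
  by (induction x rule: pend.induct) auto

lemma pend_cup: "pend (x @ True # False # y) = pend (x @ y)"
  by (rule pend_append_cong) simp

lemma length_flip [simp]: "length (flip w) = length w"
  by (induction w rule: flip.induct) auto

text \<open>A tail influences the letters before it only through the number of its waiting
  \<open>False\<close>, so tails with equal \<open>pend\<close> can be exchanged. In particular a
  neighbouring pair \<open>True\<close>, \<open>False\<close> can be inserted or deleted.\<close>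

lemma flip_append: "pend y = pend y' \<Longrightarrow>
  \<exists>z. length z = length x \<and> flip (x @ y) = z @ flip y \<and> flip (x @ y') = z @ flip y'"
proof (induction x rule: flip.induct)
  case (3 w)
  then obtain z where "length z = length w" "flip (w @ y) = z @ flip y" "flip (w @ y') = z @ flip y'"
    by blast
  moreover have "pend (w @ y) = pend (w @ y')" using 3 by (intro pend_append_cong) auto
  ultimately show ?case by (intro exI[of _ "(pend (w @ y) = 0) # z"]) auto
next
  case (2 w)
  then obtain z where "length z = length w" "flip (w @ y) = z @ flip y" "flip (w @ y') = z @ flip y'"
    by blast
  then show ?case by (intro exI[of _ "True # z"]) auto
qed auto

lemma flip_cup:
  "\<exists>z. length z = length x \<and> flip (x @ y) = z @ flip y \<and>
       flip (x @ True # False # y) = z @ False # True # flip y"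
  using flip_append[of y "True # False # y" x] by auto

text \<open>A \<open>False\<close> in a flipped word stems from a \<open>True\<close> with something
  pending behind it. Were the next letter a \<open>True\<close> left unflipped, nothing would be
  pending behind that one, and hence nothing behind the first one either.\<close>

lemma flip_False_True:
  assumes "flip (x @ a # b # y) = z @ False # True # z'" "length z = length x"
  shows "a \<and> \<not> b"
proof -
  obtain z1 where "length z1 = length x" "flip (x @ a # b # y) = z1 @ flip (a # b # y)"
    using flip_append[of "a # b # y" "a # b # y" x] by auto
  then have "flip (a # b # y) = False # True # z'" using assms by simp
  then show ?thesis by (cases a; cases b) auto
qed

lemma count_flip: "count_list (flip w) False + pend w = count_list w False"
  by (induction w rule: flip.induct) auto

lemma cup_deg_length: "cup_deg st w u = Some k \<Longrightarrow> length u = length w"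
  by (induction st w u arbitrary: k rule: cup_deg.induct) (auto split: if_splits)

text \<open>The letter pushed at \<open>True\<close> is popped at once at \<open>False\<close>, so
  \<open>y\<close> sees the same stack as if the pair were absent; the pair contributes only its own
  orientation.\<close>

lemma cup_deg_cup:
  "length x = length x' \<Longrightarrow> cup_deg st (x @ True # False # y) (x' @ a # b # y') =
     (if a = b then None else map_option (if b then Suc else id) (cup_deg st (x @ y) (x' @ y')))"
proof (induction x x' arbitrary: st rule: list_induct2)
  case Nil
  then show ?case by (cases a; cases b) auto
next
  case (Cons c x d x')
  show ?case
  proof (cases c)
    case False
    then show ?thesis using Cons
      by (cases st; cases "cup_deg (tl st) (x @ y) (x' @ y')") auto
  qed (use Cons in auto)
qed

lemma cup_deg_le: "cup_deg st w u = Some k \<Longrightarrow> k \<le> count_list w False"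
  by (induction st w u arbitrary: k rule: cup_deg.induct) (fastforce split: if_splits)+

text \<open>A \<open>False\<close> of \<open>w\<close> contributes one only if its cup is flipped.
  The top \<open>pend w\<close> entries of the stack belong to cups closed inside \<open>w\<close>
  and must be \<open>False\<close>; the entries below them stay unmatched and must be
  \<open>True\<close>.\<close>

lemma cup_deg_max:
  "pend w \<le> length st \<Longrightarrow> cup_deg st w u = Some (count_list w False) \<longleftrightarrow>
     u = flip w \<and> st = replicate (pend w) False @ replicate (length st - pend w) True"
proof (induction w arbitrary: st u rule: flip.induct)
  case 1
  have "False \<notin> set st \<longleftrightarrow> st = replicate (length st) True"
    by (auto simp: list_eq_iff_nth_eq in_set_conv_nth)
  then show ?case by (cases u) auto
next
  case (2 w)
  then obtain c st' where st: "st = c # st'" "pend w \<le> length st'" by (cases st) auto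
  show ?case
  proof (cases u)
    case Nil then show ?thesis by simp
  next
    case (Cons a u')
    show ?thesis using 2(1)[OF st(2), of u'] cup_deg_le[of st' w u'] Cons st
      by (cases a; cases c) (auto split: option.splits)
  qed
next
  case (3 w)
  show ?case
  proof (cases u)
    case Nil then show ?thesis by simp
  next
    case (Cons a u')
    have "pend w \<le> length (a # st)" using 3 by simp
    then show ?thesis using 3(1)[of "a # st" u'] Cons
      by (cases "pend w") (auto simp: Suc_diff_le)
  qed
qed

lemma cup_deg_0:
  "pend w \<le> length st \<Longrightarrow> cup_deg st w u = Some 0 \<longleftrightarrow> u = w \<and> False \<notin> set st"
proof (induction w arbitrary: st u rule: flip.induct)
  case 1
  then show ?case by (cases u) auto
next
  case (2 w)
  then obtain c st' where st: "st = c # st'" "pend w \<le> length st'" by (cases st) auto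
  show ?case
  proof (cases u)
    case (Cons a u')
    show ?thesis using 2(1)[OF st(2), of u'] Cons st by (cases a; cases c) auto
  qed simp
next
  case (3 w)
  show ?case
  proof (cases u)
    case (Cons a u')
    have "pend w \<le> length (a # st)" using 3 by simp
    then show ?thesis using 3(1)[of "a # st" u'] Cons by auto
  qed simp
qed

text \<open>
  Flipping cups lowers the weight, which makes the cup vectors unitriangular.
\<close>

fun weight :: "bool list \<Rightarrow> nat" where
  "weight [] = 0"
| "weight (a # u) = (if a then Suc (length u) else 0) + weight u"

text \<open>Each \<open>False\<close> on the stack forces one \<open>True\<close> of
  \<open>u\<close> at the place of a \<open>False\<close> of \<open>w\<close>. The weight gained
  there is bounded by the remaining length, which gives the correction term.\<close>

lemma cup_deg_weight_le:
  "cup_deg st w u = Some k \<Longrightarrow> weight u \<le> weight w + length w * count_list st False"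
proof (induction st w u arbitrary: k rule: cup_deg.induct)
  case (2 st w a u)
  have "length u = length w" using 2 cup_deg_length by fastforce
  with 2 show ?case by (cases a) (auto simp: algebra_simps)
next
  case (3 c st w a u)
  have "length u = length w" using 3 cup_deg_length by (fastforce split: if_splits)
  with 3 show ?case by (cases a; cases c) (fastforce simp: algebra_simps)+
qed (auto split: if_splits)

lemma cup_deg_weight_less:
  "cup_deg st w u = Some k \<Longrightarrow> False \<notin> set st \<Longrightarrow> u \<noteq> w \<Longrightarrow> weight u < weight w"
proof (induction st w u arbitrary: k rule: cup_deg.induct)
  case (2 st w a u)
  have l: "length u = length w" using 2 cup_deg_length by fastforce
  show ?case
  proof (cases a)
    \<comment> \<open>The cup opened here is flipped: the loss of \<open>Suc (length w)\<close>
      exceeds the \<open>length w\<close> that its closing letter can give back.\<close>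
    case False
    have "weight u \<le> weight w + length w * count_list (a # st) False"
      using 2 by (intro cup_deg_weight_le) auto
    moreover have "count_list st False = 0" using 2 by (simp add: count_list_0_iff)
    ultimately show ?thesis using False by simp
  qed (use 2 l in auto)
next
  case (3 c st w a u)
  have "length u = length w" using 3 cup_deg_length by (fastforce split: if_splits)
  with 3 show ?case by (cases a; cases c) (fastforce simp: algebra_simps)+
qed (auto split: if_splits)

lemma cup_deg_count:
  "cup_deg st w u = Some k \<Longrightarrow> count_list u False + count_list st False = count_list w False"
  by (induction st w u arbitrary: k rule: cup_deg.induct)
     (auto split: if_splits simp: count_list_0_iff)

definition cup_coeff :: "bool list \<Rightarrow> bool list \<Rightarrow> scalar" where
  "cup_coeff w u = (case cup_deg [] w u of None \<Rightarrow> 0 | Some k \<Rightarrow> v_param ^ k)"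

lemma cup_coeff_cup:
  "length x = length x' \<Longrightarrow> cup_coeff (x @ True # False # y) (x' @ a # b # y') =
     (if a = b then 0 else if b then v_param * cup_coeff (x @ y) (x' @ y') else cup_coeff (x @ y) (x' @ y'))"
  by (simp add: cup_coeff_def cup_deg_cup option.case_eq_if map_option_case)

text \<open>A word without the factor \<open>True\<close>, \<open>False\<close> is a block of
  \<open>False\<close> followed by a block of \<open>True\<close>. The first block is unmatched,
  hence empty here.\<close>

lemma cup_or_all_True:
  assumes "pend w = 0"
  shows "w = replicate (length w) True \<or> (\<exists>x y. w = x @ True # False # y)"
proof -
  have "(\<exists>m n. w = replicate m False @ replicate n True) \<or> (\<exists>x y. w = x @ True # False # y)"
  proof (induction w)
    case Nil
    then show ?case by auto
  next
    case (Cons a w)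
    then consider m n where "w = replicate m False @ replicate n True"
      | x y where "w = x @ True # False # y" by blast
    then show ?case
    proof cases
      case 1
      show ?thesis
      proof (cases a)
        case False
        then have "a # w = replicate (Suc m) False @ replicate n True" using 1 by simp
        then show ?thesis by blast
      next
        case True
        show ?thesis
        proof (cases m)
          case 0
          then have "a # w = replicate 0 False @ replicate (Suc n) True" using 1 True by simp
          then show ?thesis by blast
        next
          case (Suc m')
          then have "a # w = [] @ True # False # replicate m' False @ replicate n True" using 1 True by simp
          then show ?thesis by blast
        qed
      qed
    next
      case 2
      then have "a # w = (a # x) @ True # False # y" by simp
      then show ?thesis by blast
    qed
  qed
  moreover have "pend (replicate m False @ z) \<ge> m" for m z by (induction m) auto
  ultimately show ?thesis using assms
  proof (elim disjE exE)
    fix m n assume w: "w = replicate m False @ replicate n True"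
    then have "m = 0" using assms \<open>\<And>z m. pend (replicate m False @ z) \<ge> m\<close>[of m "replicate n True"] by simp
    then show ?thesis using w by simp
  qed blast
qed

text \<open>The quantum integer \<open>[2]\<close>, the value of a closed loop in the
  Temperley--Lieb calculus.\<close>

definition quantum_two :: scalar where "quantum_two = v_param + inverse v_param"

lemma cup_coeff_all_True:
  "w = replicate n True \<Longrightarrow> False \<in> set u \<Longrightarrow> cup_coeff w u = 0"
  using cup_deg_count[of "[]" w u]
  by (cases "cup_deg [] w u") (auto simp: cup_coeff_def count_list_0_iff)

lemma split_list_length:
  assumes "length xs = m + n"
  obtains ys zs where "xs = ys @ zs" "length ys = m" "length zs = n"
  using assms that[of "take m xs" "drop m xs"] by simp

text \<open>The terms are the two ways to pull one of two beads on a site back to its left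
  neighbour. Pulling the bead of the second component carries the factor
  \<open>inverse v_param\<close> prescribed by \<open>f_exponent\<close>, pulling that of the first
  carries 1; see \<open>lookup_f_cap\<close>.\<close>

definition cap_coeff :: "bool list \<Rightarrow> bool list \<Rightarrow> bool list \<Rightarrow> scalar" where
  "cap_coeff w x y =
     inverse v_param * cup_coeff w (x @ True # False # y) + cup_coeff w (x @ False # True # y)"

text \<open>
  Temperley--Lieb straightening: capping two neighbouring sites of a cup diagram closes a loop, joins two
  strands, or gives \<open>0\<close>.
\<close>

lemma cap_cup:
  assumes "pend w = 0" "length w = k + 2 + l"
  shows "\<exists>q w'. length w' = k + l \<and>
    (q = 0 \<or> q \<in> {1, quantum_two} \<and> pend w' = 0 \<and> count_list w False = Suc (count_list w' False)) \<and>
    (\<forall>x y. length x = k \<longrightarrow> length y = l \<longrightarrow> cap_coeff w x y = q * cup_coeff w' (x @ y))"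
  using assms
proof (induction "length w" arbitrary: w k l rule: less_induct)
  case less
  have vi: "inverse v_param * (v_param * c) = c" for c
    using v_param_nonzero by simp
  \<comment> \<open>A flipped cup away from the cap contributes the same factor
    \<open>v_param\<close> to both terms.\<close>
  have comb: "inverse v_param * (v_param * c) + v_param * d = v_param * (inverse v_param * c + d)" for c d
    by (simp add: algebra_simps)
  from cup_or_all_True[OF less(2)] show ?case
  proof
    \<comment> \<open>Both arguments contain a \<open>False\<close>, which a word without cups never
      produces.\<close>
    assume w: "w = replicate (length w) True"
    show ?thesis using cup_coeff_all_True[OF w]
      by (intro exI[of _ 0] exI[of _ "replicate (k + l) True"]) (simp add: cap_coeff_def)
  next
    assume "\<exists>x y. w = x @ True # False # y"
    then obtain p r where w: "w = p @ True # False # r" by blast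
    have pend: "pend (p @ r) = 0" using less(2) w pend_cup by simp
    have cnt: "count_list w False = Suc (count_list (p @ r) False)" using w by simp
    have len: "length p + length r = k + l" using less(3) w by simp
    have less_w: "length (p @ r) < length w" using w by simp
    have straight: ?thesis if "q \<in> {1, quantum_two}"
      "\<And>x y. length x = k \<Longrightarrow> length y = l \<Longrightarrow> cap_coeff w x y = q * cup_coeff (p @ r) (x @ y)" for q
      using that pend cnt len by (intro exI[of _ q] exI[of _ "p @ r"]) simp
    have presb: "k = n \<or> k = Suc n \<or> Suc k = n \<or> (\<exists>k'. k = n + 2 + k') \<or> (\<exists>p'. n = k + 2 + p')" for n :: nat
      by presburger
    \<comment> \<open>The cap sits on the sites \<open>k\<close>, \<open>Suc k\<close> and the
      chosen cup on \<open>length p\<close>, \<open>Suc (length p)\<close>: they coincide, share one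
      site in two possible ways, or are disjoint.\<close>
    consider "k = length p" | "k = Suc (length p)" | "Suc k = length p"
      | k' where "k = length p + 2 + k'" | p' where "length p = k + 2 + p'"
      using presb[of "length p"] by metis
    then show ?thesis
    proof cases
      case 1
      \<comment> \<open>Cap and cup close a loop: the unflipped cup gives
        \<open>inverse v_param\<close>, the flipped one \<open>v_param\<close>.\<close>
      show ?thesis
        by (rule straight[of quantum_two]) (simp_all add: w 1 cap_coeff_def cup_coeff_cup quantum_two_def algebra_simps)
    next
      case 2
      \<comment> \<open>The cap joins the right end of the cup to the next site. For each letter
        \<open>a\<close> one term survives: either with factor 1, or with the \<open>v_param\<close>
        of the flipped cup against the \<open>inverse v_param\<close> of the cap.\<close>
      have "cap_coeff w x y = 1 * cup_coeff (p @ r) (x @ y)" if x: "length x = k" for x y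
      proof -
        obtain x' a where "x = x' @ [a]" "length x' = length p"
          using x 2 by (metis length_Suc_conv_rev)
        then show ?thesis unfolding w by (cases a) (simp_all add: cap_coeff_def cup_coeff_cup vi)
      qed
      then show ?thesis using straight[of 1] by simp
    next
      case 3
      have "cap_coeff w x y = 1 * cup_coeff (p @ r) (x @ y)" if xy: "length x = k" "length y = l" for x y
      proof -
        obtain y' b where y: "y = b # y'" using xy 3 len by (cases y) auto
        have "cup_coeff w (x @ c # d # y) = (if d = b then 0 else if b then v_param * cup_coeff (p @ r) (x @ c # y')
          else cup_coeff (p @ r) (x @ c # y'))" for c d
          using cup_coeff_cup[of p "x @ [c]" r d b y'] xy 3 unfolding w y by simp
        then show ?thesis unfolding y by (cases b) (simp_all add: cap_coeff_def vi)
      qed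
      then show ?thesis using straight[of 1] by simp
    next
      case 4
      \<comment> \<open>A cup to the left of the cap is untouched: the word is straightened without
        it, and the cup is put back afterwards. The case of a cup to the right is the mirror
        image.\<close>
      have "length (p @ r) = (length p + k') + 2 + l" using len less(3) w 4 by simp
      from less(1)[OF less_w pend this] obtain q w' where q: "length w' = length p + k' + l"
        "q = 0 \<or> q \<in> {1, quantum_two} \<and> pend w' = 0 \<and> count_list (p @ r) False = Suc (count_list w' False)"
        "\<And>x y. length x = length p + k' \<Longrightarrow> length y = l \<Longrightarrow> cap_coeff (p @ r) x y = q * cup_coeff w' (x @ y)"
        by blast
      obtain z1 z2 where z: "w' = z1 @ z2" "length z1 = length p" "length z2 = k' + l"
        using split_list_length[of w' "length p" "k' + l"] q(1) by auto
      have "cap_coeff w x y = q * cup_coeff (z1 @ True # False # z2) (x @ y)"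
        if xy: "length x = k" "length y = l" for x y
      proof -
        obtain x1 x3 where x1: "x = x1 @ x3" "length x1 = length p" "length x3 = Suc (Suc k')"
          using split_list_length[of x "length p" "2 + k'"] xy 4 by auto
        then obtain a b x2 where x2: "x3 = a # b # x2" "length x2 = k'" by (metis length_Suc_conv)
        have red: "cup_coeff (u1 @ True # False # u2) (x @ y') = (if a = b then 0 else if b
          then v_param * cup_coeff (u1 @ u2) ((x1 @ x2) @ y') else cup_coeff (u1 @ u2) ((x1 @ x2) @ y'))"
          if "length u1 = length p" for u1 u2 y'
          using cup_coeff_cup[of u1 x1 u2 a b "x2 @ y'"] that x1 x2 by simp
        show ?thesis using q(3)[of "x1 @ x2" y] x1 x2 xy comb
          unfolding cap_coeff_def w red[OF refl] red[OF z(2)] z(1) by simp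
      qed
      moreover have "length (z1 @ True # False # z2) = k + l" using z 4 by simp
      moreover have "pend (z1 @ True # False # z2) = pend w'"
        "count_list (z1 @ True # False # z2) False = Suc (count_list w' False)" using z pend_cup by auto
      ultimately show ?thesis using q(2) cnt by (intro exI[of _ q] exI[of _ "z1 @ True # False # z2"]) auto
    next
      case 5
      have lr: "l = p' + 2 + length r" using 5 len by simp
      have "length (p @ r) = k + 2 + (p' + length r)" using 5 by simp
      from less(1)[OF less_w pend this] obtain q w' where q: "length w' = k + (p' + length r)"
        "q = 0 \<or> q \<in> {1, quantum_two} \<and> pend w' = 0 \<and> count_list (p @ r) False = Suc (count_list w' False)"
        "\<And>x y. length x = k \<Longrightarrow> length y = p' + length r \<Longrightarrow> cap_coeff (p @ r) x y = q * cup_coeff w' (x @ y)"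
        by blast
      obtain z1 z2 where z: "w' = z1 @ z2" "length z1 = k + p'" "length z2 = length r"
        using split_list_length[of w' "k + p'" "length r"] q(1) by auto
      have "cap_coeff w x y = q * cup_coeff (z1 @ True # False # z2) (x @ y)"
        if xy: "length x = k" "length y = l" for x y
      proof -
        obtain y1 y3 where y1: "y = y1 @ y3" "length y1 = p'" "length y3 = Suc (Suc (length r))"
          using split_list_length[of y "p'" "2 + length r"] xy lr by auto
        then obtain a b y2 where y2: "y3 = a # b # y2" "length y2 = length r" by (metis length_Suc_conv)
        have red: "cup_coeff (u1 @ True # False # u2) (x' @ y) = (if a = b then 0 else if b
          then v_param * cup_coeff (u1 @ u2) (x' @ y1 @ y2) else cup_coeff (u1 @ u2) (x' @ y1 @ y2))"
          if "length u1 = length x' + p'" for u1 u2 x'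
          using cup_coeff_cup[of u1 "x' @ y1" u2 a b y2] that y1 y2 by simp
        have cw: "cup_coeff w (x @ c # d # y) = (if a = b then 0 else if b
          then v_param * cup_coeff (p @ r) (x @ c # d # y1 @ y2) else cup_coeff (p @ r) (x @ c # d # y1 @ y2))" for c d
          using red[of p "x @ [c, d]" r] xy 5 unfolding w by simp
        have zl: "length z1 = length x + p'" using z xy by simp
        show ?thesis using q(3)[of x "y1 @ y2"] y1 y2 xy comb
          unfolding cap_coeff_def z(1) cw red[OF zl] by simp
      qed
      moreover have "length (z1 @ True # False # z2) = k + l" using z lr by simp
      moreover have "pend (z1 @ True # False # z2) = pend w'"
        "count_list (z1 @ True # False # z2) False = Suc (count_list w' False)" using z pend_cup by auto
      ultimately show ?thesis using q(2) cnt by (intro exI[of _ q] exI[of _ "z1 @ True # False # z2"]) auto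
    qed
  qed
qed

section \<open>Partitions as bead configurations\<close>

definition nth0 :: "nat list \<Rightarrow> nat \<Rightarrow> nat" where
  "nth0 xs k = (if k < length xs then xs ! k else 0)"

definition is_part :: "nat list \<Rightarrow> bool" where
  "is_part xs \<longleftrightarrow> sorted_wrt (\<ge>) xs \<and> 0 \<notin> set xs"

lemma is_part_Rep: "is_part (Rep_partition p)"
  using Rep_partition[of p] by (simp add: is_part_def)

lemma is_part_Cons: "is_part (c # xs) \<Longrightarrow> is_part xs \<and> nth0 xs 0 \<le> c \<and> 0 < c"
  by (cases xs) (auto simp: is_part_def nth0_def)

lemma part_Suc: "part p (Suc k) = nth0 (Rep_partition p) k"
  by (auto simp: part_def nth0_def)

lemma nth0_Nil [simp]: "nth0 [] k = 0" by (simp add: nth0_def)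
lemma nth0_Cons_0 [simp]: "nth0 (c # xs) 0 = c" by (simp add: nth0_def)
lemma nth0_Cons_Suc [simp]: "nth0 (c # xs) (Suc k) = nth0 xs k" by (simp add: nth0_def)

text \<open>
  Row \<open>a\<close> of a partition gives the bead \<open>part p a - a + t + 1\<close>, so that adding a node of content \<open>j\<close> moves a
  bead from \<open>j\<close> to \<open>j + 1\<close>.
\<close>

fun lbeads :: "int \<Rightarrow> nat list \<Rightarrow> int set" where
  "lbeads t [] = {..t}"
| "lbeads t (c # xs) = insert (t + int c) (lbeads (t - 1) xs)"

definition beads :: "int \<Rightarrow> partition \<Rightarrow> int set" where
  "beads t p = lbeads t (Rep_partition p)"

text \<open>Bead sets of charge \<open>t\<close>: pushing all beads to the left yields
  \<open>{..t}\<close>. The threshold \<open>m\<close> may be lowered at will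
  (\<open>maya_lower\<close>).\<close>

definition maya :: "int \<Rightarrow> int set \<Rightarrow> bool" where
  "maya t S \<longleftrightarrow> (\<exists>m. {..m} \<subseteq> S \<and> finite (S \<inter> {m<..}) \<and> int (card (S \<inter> {m<..})) = t - m)"

lemma lbeads_le: "is_part xs \<Longrightarrow> u \<in> lbeads t xs \<Longrightarrow> u \<le> t + int (nth0 xs 0)"
proof (induction xs arbitrary: t)
  case (Cons c xs)
  then show ?case using is_part_Cons[OF Cons(2)] Cons(1)[of "t - 1"] by fastforce
qed auto

lemma maya_insert:
  assumes "maya (t - 1) S" "k \<notin> S"
  shows "maya t (insert k S)"
proof -
  from assms obtain m where m: "{..m} \<subseteq> S" "finite (S \<inter> {m<..})" "int (card (S \<inter> {m<..})) = t - 1 - m"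
    unfolding maya_def by blast
  have "k > m" using m assms by (meson atMost_iff leI subsetD)
  then have "insert k S \<inter> {m<..} = insert k (S \<inter> {m<..})" by auto
  then show ?thesis unfolding maya_def using m assms by (intro exI[of _ m]) auto
qed

lemma maya_lbeads: "is_part xs \<Longrightarrow> maya t (lbeads t xs)"
proof (induction xs arbitrary: t)
  case Nil
  have "{..t} \<inter> {t<..} = {}" by auto
  then show ?case by (auto simp: maya_def intro!: exI[of _ t])
next
  case (Cons c xs)
  have "t + int c \<notin> lbeads (t - 1) xs"
    using lbeads_le[of xs "t + int c" "t - 1"] is_part_Cons[OF Cons(2)] by auto
  then show ?case using Cons is_part_Cons[OF Cons(2)] by (auto intro: maya_insert)
qed

lemma maya_beads: "maya t (beads t p)"
  unfolding beads_def by (intro maya_lbeads is_part_Rep)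

lemma lbeads_inj: "is_part xs \<Longrightarrow> is_part ys \<Longrightarrow> lbeads t xs = lbeads t ys \<Longrightarrow> xs = ys"
proof (induction xs arbitrary: ys t)
  case Nil
  show ?case
  proof (cases ys)
    case (Cons c zs)
    then have "lbeads t (c # zs) = {..t}" using Nil by simp
    moreover have "t + int c \<in> lbeads t (c # zs)" by simp
    ultimately have "t + int c \<in> {..t}" by blast
    then show ?thesis using is_part_Cons[of c zs] Nil Cons by simp
  qed simp
next
  case (Cons c xs)
  show ?case
  proof (cases ys)
    case Nil
    then have "lbeads t (c # xs) = {..t}" using Cons(4) by simp
    moreover have "t + int c \<in> lbeads t (c # xs)" by simp
    ultimately have "t + int c \<in> {..t}" by blast
    then show ?thesis using is_part_Cons[OF Cons(2)] by simp
  next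
    case Y: (Cons d zs)
    have "t + int c \<in> lbeads t ys" using Cons(4)[symmetric] by simp
    then have "t + int c \<le> t + int d" using lbeads_le[of ys "t + int c" t] Cons(3) Y by simp
    moreover have "t + int d \<in> lbeads t (c # xs)" using Cons(4) Y by simp
    then have "t + int d \<le> t + int c" using lbeads_le[OF Cons(2)] by fastforce
    ultimately have cd: "c = d" by simp
    have n: "t + int c \<notin> lbeads (t - 1) xs" "t + int d \<notin> lbeads (t - 1) zs"
      using lbeads_le[of xs "t + int c" "t - 1"] is_part_Cons[OF Cons(2)]
        lbeads_le[of zs "t + int d" "t - 1"] is_part_Cons[of d zs] Cons Y by auto
    then have "lbeads (t - 1) xs = lbeads (t - 1) zs" using Cons(4) Y cd by (simp add: insert_ident)
    then show ?thesis using Cons Y cd is_part_Cons[OF Cons(2)] is_part_Cons[of d zs] by auto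
  qed
qed

lemma beads_inj: "beads t p = beads t q \<Longrightarrow> p = q"
  unfolding beads_def using lbeads_inj is_part_Rep Rep_partition_inject by blast

text \<open>The largest bead above \<open>m\<close> becomes the first row, and induction applies to
  the others.\<close>

lemma lbeads_surj:
  assumes "{..m} \<subseteq> S" "finite (S \<inter> {m<..})" "card (S \<inter> {m<..}) = n"
  shows "\<exists>xs. is_part xs \<and> lbeads (m + int n) xs = S"
  using assms
proof (induction n arbitrary: S)
  case 0
  then have "S \<inter> {m<..} = {}" by simp
  then have "S = {..m}" using 0(1) by fastforce
  then show ?case by (intro exI[of _ "[]"]) (simp add: is_part_def)
next
  case (Suc n)
  define k where "k = Max (S \<inter> {m<..})"
  have ne: "S \<inter> {m<..} \<noteq> {}" using Suc by auto
  have k: "k \<in> S" "m < k" using Max_in[OF Suc(3) ne] unfolding k_def by auto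
  have le: "u \<le> k" if "u \<in> S" for u
    using that k Max_ge[OF Suc(3), of u] unfolding k_def[symmetric] by (cases "u > m") auto
  let ?S = "S - {k}"
  have eq: "?S \<inter> {m<..} = S \<inter> {m<..} - {k}" by auto
  have "\<exists>xs. is_part xs \<and> lbeads (m + int n) xs = ?S"
    using Suc k by (intro Suc(1)) (auto simp: eq)
  then obtain xs where xs: "is_part xs" "lbeads (m + int n) xs = ?S" by blast
  have top: "m + int n + int (nth0 xs 0) < k"
  proof -
    have "m + int n + int (nth0 xs 0) \<in> lbeads (m + int n) xs" by (cases xs) auto
    then show ?thesis using xs le by fastforce
  qed
  show ?case
  proof (cases "k = m + int (Suc n)")
    \<comment> \<open>The top bead is in its rest position, so its row would have length 0. Lists
      contain no zero parts, so this row is not written; here the whole set is the vacuum.\<close>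
    case True
    then have "xs = []" using top xs by (cases xs) (auto simp: is_part_def)
    then have "{..m + int n} = ?S" using xs by simp
    then have "S = insert k {..m + int n}" using k(1) by (metis insert_Diff)
    then have "S = {..m + int (Suc n)}" using True by auto
    then show ?thesis by (intro exI[of _ "[]"]) (simp add: is_part_def)
  next
    case False
    let ?c = "nat (k - (m + int (Suc n)))"
    have c: "int ?c = k - (m + int (Suc n))" "?c > 0" using top False by auto
    have "is_part (?c # xs)"
    proof (cases xs)
      case (Cons d ys)
      have "d \<le> ?c" using top Cons c by auto
      then show ?thesis using xs(1) c Cons by (auto simp: is_part_def)
    qed (use c in \<open>auto simp: is_part_def\<close>)
    moreover have "lbeads (m + int (Suc n)) (?c # xs) = S"
    proof -
      have "m + int (Suc n) - 1 = m + int n" by simp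
      then have "lbeads (m + int (Suc n)) (?c # xs) = insert (m + int (Suc n) + int ?c) ?S"
        using xs(2) by (simp only: lbeads.simps)
      also have "m + int (Suc n) + int ?c = k" using c(1) by linarith
      also have "insert k ?S = S" using k by auto
      finally show ?thesis .
    qed
    ultimately show ?thesis by blast
  qed
qed

lemma beads_surj:
  assumes "maya t S" shows "\<exists>p. beads t p = S"
proof -
  obtain m where m: "{..m} \<subseteq> S" "finite (S \<inter> {m<..})" "int (card (S \<inter> {m<..})) = t - m"
    using assms unfolding maya_def by blast
  have t: "m + int (card (S \<inter> {m<..})) = t" using m(3) by linarith
  obtain xs where xs: "is_part xs" "lbeads t xs = S"
    using lbeads_surj[OF m(1,2) refl] unfolding t by blast
  then have "Rep_partition (Abs_partition xs) = xs"
    by (simp add: Abs_partition_inverse is_part_def)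
  then show ?thesis unfolding beads_def using xs(2) by metis
qed

text \<open>The beads of successive rows are strictly decreasing, so more than \<open>k\<close> of
  them lie at or beyond \<open>z\<close> iff the one of row \<open>k\<close> does, counting rows
  from 0. This allows diagrams to be compared by counting beads.\<close>

lemma lbeads_count:
  "is_part xs \<Longrightarrow> finite {u \<in> lbeads t xs. z \<le> u} \<and>
    (k < card {u \<in> lbeads t xs. z \<le> u} \<longleftrightarrow> z \<le> t + int (nth0 xs k) - int k)"
proof (induction xs arbitrary: t k)
  case Nil
  have eq: "{u \<in> lbeads t []. z \<le> u} = {z..t}" by auto
  show ?case unfolding eq by (simp, linarith)
next
  case (Cons c xs)
  note p = is_part_Cons[OF Cons(2)]
  have IH: "finite {u \<in> lbeads (t - 1) xs. z \<le> u}"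
    "\<And>k. k < card {u \<in> lbeads (t - 1) xs. z \<le> u} \<longleftrightarrow> z \<le> t - 1 + int (nth0 xs k) - int k"
    using Cons(1)[of "t - 1"] p by auto
  show ?case
  proof (cases "z \<le> t + int c")
    case True
    have eq: "{u \<in> lbeads t (c # xs). z \<le> u} = insert (t + int c) {u \<in> lbeads (t - 1) xs. z \<le> u}"
      using True by auto
    have "t + int c \<notin> lbeads (t - 1) xs"
      using lbeads_le[of xs "t + int c" "t - 1"] p by auto
    then show ?thesis unfolding eq using IH(1) IH(2)[of "k - 1"] True by (cases k) auto
  next
    case False
    have eq: "{u \<in> lbeads t (c # xs). z \<le> u} = {}"
    proof -
      have "\<not> z \<le> u" if "u \<in> lbeads t (c # xs)" for u
        using lbeads_le[OF Cons(2) that] False by simp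
      then show ?thesis by blast
    qed
    have "nth0 (c # xs) k \<le> c" using Cons(2)
      by (auto simp: is_part_def nth0_def nth_Cons split: nat.splits)
    then show ?thesis unfolding eq using False by auto
  qed
qed

section \<open>Adding a box as moving a bead\<close>

definition pdiag :: "partition \<Rightarrow> (nat \<times> nat) set" where
  "pdiag p = {(a, b). 1 \<le> a \<and> 1 \<le> b \<and> b \<le> part p a}"

lemma part_count: "1 \<le> a \<Longrightarrow> int b \<le> int (part p a) \<longleftrightarrow> a \<le> card {u \<in> beads t p. int b - int a + t + 1 \<le> u}"
  using lbeads_count[OF is_part_Rep[of p], of t "int b - int a + t + 1" "a - 1"] part_Suc[of p "a - 1"]
  by (auto simp: beads_def)

lemma finite_beads_ge: "finite {u \<in> beads t p. z \<le> u}"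
  using lbeads_count[OF is_part_Rep] by (auto simp: beads_def)

lemma part_antimono: "1 \<le> a \<Longrightarrow> a \<le> a' \<Longrightarrow> part p a' \<le> part p a"
  using is_part_Rep[of p] by (cases "a = a'") (auto simp: part_def is_part_def sorted_wrt_iff_nth_less)

lemma lbeads_eq: "lbeads t xs = range (\<lambda>k. t + int (nth0 xs k) - int k)"
proof (induction xs arbitrary: t)
  case Nil
  have "u \<in> range (\<lambda>k. t - int k)" if "u \<le> t" for u
    using that by (intro image_eqI[of _ _ "nat (t - u)"]) auto
  then show ?case by auto
next
  case (Cons c xs)
  have "range (\<lambda>k. t + int (nth0 (c # xs) k) - int k) = insert (t + int c) (range (\<lambda>k. t - 1 + int (nth0 xs k) - int k))"
  proof (intro set_eqI iffI)
    fix u assume "u \<in> range (\<lambda>k. t + int (nth0 (c # xs) k) - int k)"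
    then obtain k where "u = t + int (nth0 (c # xs) k) - int k" by blast
    then show "u \<in> insert (t + int c) (range (\<lambda>k. t - 1 + int (nth0 xs k) - int k))"
      by (cases k) auto
  next
    fix u assume "u \<in> insert (t + int c) (range (\<lambda>k. t - 1 + int (nth0 xs k) - int k))"
    then consider "u = t + int (nth0 (c # xs) 0) - int 0" |
      k where "u = t + int (nth0 (c # xs) (Suc k)) - int (Suc k)" by auto
    then show "u \<in> range (\<lambda>k. t + int (nth0 (c # xs) k) - int k)"
      by cases blast+
  qed
  then show ?case using Cons by simp
qed

lemma beads_eq: "beads t p = (\<lambda>a. int (part p a) - int a + t + 1) ` {1..}"
proof -
  have "a \<in> range Suc" if "1 \<le> a" for a using that by (cases a) auto
  then have "{1..} = range Suc" by auto
  then have "(\<lambda>a. int (part p a) - int a + t + 1) ` {1..} = range (\<lambda>k. int (part p (Suc k)) - int (Suc k) + t + 1)"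
    by (simp only: image_image)
  also have "\<dots> = beads t p" unfolding beads_def lbeads_eq part_Suc by (intro image_cong) auto
  finally show ?thesis by simp
qed

definition move :: "int \<Rightarrow> int set \<Rightarrow> int set" where
  "move j S = insert (j + 1) (S - {j})"

lemma beads_row_inj: "1 \<le> a \<Longrightarrow> 1 \<le> a' \<Longrightarrow> int (part p a) - int a = int (part p a') - int a' \<Longrightarrow> a = a'"
  using part_antimono[of a a' p] part_antimono[of a' a p] by linarith

lemma pdiag_insert_part:
  assumes "(a, b) \<notin> pdiag p" "pdiag q = insert (a, b) (pdiag p)"
  shows "1 \<le> a" "1 \<le> b" "part q a = b" "part p a = b - 1"
    "\<And>a'. 1 \<le> a' \<Longrightarrow> a' \<noteq> a \<Longrightarrow> part q a' = part p a'"
proof -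
  have ab: "1 \<le> a" "1 \<le> b" using assms(2) by (auto simp: pdiag_def)
  have iff: "b' \<le> part q a' \<longleftrightarrow> (a', b') = (a, b) \<or> b' \<le> part p a'" if "1 \<le> a'" "1 \<le> b'" for a' b'
    using assms(2) that unfolding pdiag_def set_eq_iff by auto
  have other: "part q a' = part p a'" if "1 \<le> a'" "a' \<noteq> a" for a'
    using iff[of a' "part q a'"] iff[of a' "part p a'"] that by (cases "part q a' = 0"; cases "part p a' = 0") auto
  have nb: "\<not> b \<le> part p a" using assms(1) ab by (auto simp: pdiag_def)
  have qa: "part q a \<ge> b" using iff[of a b] ab by auto
  have q: "part q a = b" using iff[of a "part q a"] qa nb ab by auto
  have p: "part p a = b - 1"
  proof (cases "b = 1")
    case False
    then have "1 \<le> b - 1" "b - 1 \<noteq> b" "b - 1 \<le> part q a" using ab qa by linarith+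
    then have "b - 1 \<le> part p a" using iff[of a "b - 1"] ab by simp
    then show ?thesis using nb by auto
  qed (use nb in auto)
  show "1 \<le> a" "1 \<le> b" "part q a = b" "part p a = b - 1" by (fact ab q p)+
  show "\<And>a'. 1 \<le> a' \<Longrightarrow> a' \<noteq> a \<Longrightarrow> part q a' = part p a'" by (rule other)
qed

lemma pdiag_insert_beads:
  assumes "(a, b) \<notin> pdiag p" "pdiag q = insert (a, b) (pdiag p)"
  shows "int b - int a + t \<in> beads t p" "int b - int a + t + 1 \<notin> beads t p"
    "beads t q = move (int b - int a + t) (beads t p)"
proof -
  note pt = pdiag_insert_part[OF assms]
  note ab = pt(1,2) and other = pt(5)
  have pq: "int (part q a) = int b" "int (part p a) = int b - 1" using pt(2-4) by auto
  let ?x = "\<lambda>p a. int (part p a) - int a + t + 1"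
  have sp: "{1::nat..} = insert a ({1..} - {a})" using ab by auto
  have bp: "beads t p = insert (int b - int a + t) (?x p ` ({1..} - {a}))"
    unfolding beads_eq using pq(2) by (subst sp) auto
  have bq: "beads t q = insert (int b - int a + t + 1) (?x p ` ({1..} - {a}))"
  proof -
    have "?x q ` ({1..} - {a}) = ?x p ` ({1..} - {a})" by (intro image_cong refl) (use other in auto)
    then show ?thesis unfolding beads_eq using pq(1) by (subst sp) (simp only: image_insert)
  qed
  have n1: "int b - int a + t \<notin> ?x p ` ({1..} - {a})"
  proof
    assume "int b - int a + t \<in> ?x p ` ({1..} - {a})"
    then obtain a' where "a' \<in> {1..} - {a}" "int b - int a + t = ?x p a'" by blast
    then have "1 \<le> a'" "a' \<noteq> a" "int b - int a = int (part p a') - int a' + 1" by auto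
    then show False using beads_row_inj[of a a' p] pq(2) ab by simp
  qed
  have n2: "int b - int a + t + 1 \<notin> ?x p ` ({1..} - {a})"
  proof
    assume "int b - int a + t + 1 \<in> ?x p ` ({1..} - {a})"
    then obtain a' where "a' \<in> {1..} - {a}" "int b - int a + t + 1 = ?x p a'" by blast
    then have "1 \<le> a'" "a' \<noteq> a" "int b - int a = int (part p a') - int a'" by auto
    then show False using beads_row_inj[of a a' q] pq(1) ab other[of a'] by simp
  qed
  show "int b - int a + t \<in> beads t p" using bp by auto
  show "int b - int a + t + 1 \<notin> beads t p" using bp n2 by auto
  show "beads t q = move (int b - int a + t) (beads t p)" unfolding bp bq move_def using n1 by auto
qed

text \<open>The move changes the number of beads at or beyond \<open>z\<close> for
  \<open>z = j + 1\<close> alone. By \<open>part_count\<close> the two diagrams can differ only on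
  the diagonal of content \<open>j\<close>, and there in one box.\<close>

lemma beads_move_pdiag:
  assumes "j \<in> beads t p" "j + 1 \<notin> beads t p" "beads t q = move j (beads t p)"
  shows "\<exists>a b. (a, b) \<notin> pdiag p \<and> pdiag q = insert (a, b) (pdiag p) \<and> int b - int a + t = j"
proof -
  let ?N = "\<lambda>p z. card {u \<in> beads t p. z \<le> u}"
  have fin: "finite {u \<in> beads t r. z \<le> u}" for r z using finite_beads_ge .
  have N: "?N q z = ?N p z" if "z \<noteq> j + 1" for z
  proof (cases "z \<le> j")
    case True
    have "{u \<in> beads t q. z \<le> u} = insert (j + 1) ({u \<in> beads t p. z \<le> u} - {j})"
      using True assms(3) by (auto simp: move_def)
    moreover have "j \<in> {u \<in> beads t p. z \<le> u}" using assms True by auto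
    moreover have "j + 1 \<notin> {u \<in> beads t p. z \<le> u}" using assms True by auto
    then have "card (insert (j + 1) ({u \<in> beads t p. z \<le> u} - {j})) = Suc (card ({u \<in> beads t p. z \<le> u} - {j}))"
      by (intro card_insert_disjoint) (use fin[of p z] in simp_all)
    ultimately show ?thesis using card_Suc_Diff1[OF fin[of p z]] by presburger
  next
    case False
    then have "{u \<in> beads t q. z \<le> u} = {u \<in> beads t p. z \<le> u}"
      using that assms(3) by (auto simp: move_def)
    then show ?thesis by simp
  qed
  have N1: "?N q (j + 1) = Suc (?N p (j + 1))"
  proof -
    have "{u \<in> beads t q. j + 1 \<le> u} = insert (j + 1) {u \<in> beads t p. j + 1 \<le> u}"
      unfolding assms(3) move_def by auto
    moreover have "j + 1 \<notin> {u \<in> beads t p. j + 1 \<le> u}" using assms(2) by blast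
    ultimately show ?thesis using card_insert_disjoint[OF fin[of p "j + 1"]] by presburger
  qed
  have N2: "?N p j = Suc (?N p (j + 1))"
  proof -
    have "{u \<in> beads t p. j \<le> u} = insert j {u \<in> beads t p. j + 1 \<le> u}"
      using assms(1) by (auto simp: order.order_iff_strict)
    moreover have "j \<notin> {u \<in> beads t p. j + 1 \<le> u}" by simp
    ultimately show ?thesis using card_insert_disjoint[OF fin[of p "j + 1"]] by presburger
  qed
  \<comment> \<open>The rows above that of the moving bead are those with beads at
    \<open>j + 1\<close> or beyond; \<open>b\<close> below is the column just behind the end of row
    \<open>a\<close>.\<close>
  define a where "a = Suc (?N p (j + 1))"
  have "j \<le> int (part p a) - int a + t + 1"
    using lbeads_count[OF is_part_Rep[of p], of t j "a - 1"] N2 part_Suc[of p "a - 1"]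
    by (simp add: a_def beads_def)
  moreover have "\<not> j + 1 \<le> int (part p a) - int a + t + 1"
    using lbeads_count[OF is_part_Rep[of p], of t "j + 1" "a - 1"] part_Suc[of p "a - 1"]
    by (simp add: a_def beads_def)
  ultimately have pa: "int (part p a) = j + int a - t - 1" by linarith
  define b where "b = Suc (part p a)"
  have b: "int b = j + int a - t" using pa by (simp add: b_def)
  have "(a', b') \<in> pdiag q \<longleftrightarrow> (a', b') = (a, b) \<or> (a', b') \<in> pdiag p" for a' b'
  proof (cases "1 \<le> a' \<and> 1 \<le> b'")
    case True
    have q: "b' \<le> part q a' \<longleftrightarrow> a' \<le> ?N q (int b' - int a' + t + 1)" using part_count[of a' b' q t] True by simp
    have p: "b' \<le> part p a' \<longleftrightarrow> a' \<le> ?N p (int b' - int a' + t + 1)" using part_count[of a' b' p t] True by simp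
    show ?thesis
    proof (cases "int b' - int a' + t = j")
      case eq: True
      then have "a' = a \<longleftrightarrow> a' = a \<and> b' = b" using b by auto
      then show ?thesis using True q p eq N1 by (auto simp: pdiag_def a_def)
    next
      case False
      then have "\<not> (a' = a \<and> b' = b)" using b by auto
      moreover have "b' \<le> part q a' \<longleftrightarrow> b' \<le> part p a'" using q p False N by simp
      ultimately show ?thesis using True by (auto simp: pdiag_def)
    qed
  qed (auto simp: pdiag_def a_def b_def)
  then have "pdiag q = insert (a, b) (pdiag p)" by (auto simp del: Pair_inject)
  moreover have "(a, b) \<notin> pdiag p" by (simp add: pdiag_def b_def)
  ultimately show ?thesis using b by (intro exI[of _ a] exI[of _ b]) auto
qed

lemma pdiag_inj: "pdiag p = pdiag q \<Longrightarrow> p = q"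
proof -
  assume eq: "pdiag p = pdiag q"
  have "part p a = part q a" if "1 \<le> a" for a
  proof -
    have "b \<le> part p a \<longleftrightarrow> b \<le> part q a" for b
    proof (cases "b = 0")
      case False
      have "(a, b) \<in> pdiag p \<longleftrightarrow> (a, b) \<in> pdiag q" using eq by simp
      then show ?thesis using False that by (simp add: pdiag_def)
    qed simp
    then show ?thesis by (metis le_antisym order_refl)
  qed
  then have "beads 0 p = beads 0 q" unfolding beads_eq by (intro image_cong) auto
  then show ?thesis by (rule beads_inj)
qed

lemma card_pdiag: "finite (pdiag p) \<and> card (pdiag p) = sum_list (Rep_partition p)"
proof -
  have "finite {(k, b). 1 \<le> b \<and> b \<le> nth0 xs k} \<and> card {(k, b). 1 \<le> b \<and> b \<le> nth0 xs k} = sum_list xs" for xs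
  proof (induction xs)
    case (Cons c xs)
    let ?A = "{(k, b). 1 \<le> b \<and> b \<le> nth0 xs k}"
    have "{(k, b). 1 \<le> b \<and> b \<le> nth0 (c # xs) k} = Pair 0 ` {1..c} \<union> map_prod Suc id ` ?A"
    proof (intro set_eqI iffI)
      fix z assume "z \<in> {(k, b). 1 \<le> b \<and> b \<le> nth0 (c # xs) k}"
      then obtain k b where z: "z = (k, b)" "1 \<le> b" "b \<le> nth0 (c # xs) k" by blast
      show "z \<in> Pair 0 ` {1..c} \<union> map_prod Suc id ` ?A"
      proof (cases k)
        case (Suc k')
        then have "z = map_prod Suc id (k', b)" "(k', b) \<in> ?A" using z by auto
        then show ?thesis by blast
      qed (use z in auto)
    qed auto
    moreover have "card (Pair (0::nat) ` {1..c}) = c" by (subst card_image) (auto simp: inj_on_def)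
    moreover have "card (map_prod Suc id ` ?A) = card ?A" by (intro card_image) (auto simp: inj_on_def)
    moreover have "Pair 0 ` {1..c} \<inter> map_prod Suc id ` ?A = {}" by auto
    ultimately show ?case using Cons by (simp add: card_Un_disjoint)
  next
    case Nil
    have "{(k :: nat, b). 1 \<le> b \<and> b \<le> nth0 [] k} = {}" by auto
    then show ?case by (simp only: finite.emptyI card.empty sum_list.Nil simp_thms)
  qed
  moreover have "pdiag p = map_prod Suc id ` {(k, b). 1 \<le> b \<and> b \<le> nth0 (Rep_partition p) k}"
  proof (intro set_eqI iffI)
    fix z assume "z \<in> pdiag p"
    then obtain a b where z: "z = (a, b)" "1 \<le> a" "1 \<le> b" "b \<le> part p a" unfolding pdiag_def by blast
    then have "z = map_prod Suc id (a - 1, b)" "b \<le> nth0 (Rep_partition p) (a - 1)"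
      using part_Suc[of p "a - 1"] by auto
    then show "z \<in> map_prod Suc id ` {(k, b). 1 \<le> b \<and> b \<le> nth0 (Rep_partition p) k}" using z by blast
  qed (auto simp: pdiag_def part_Suc)
  moreover have "inj_on (map_prod Suc id) A" for A :: "(nat \<times> nat) set" by (auto simp: inj_on_def)
  ultimately show ?thesis by (simp add: card_image)
qed

section \<open>Bipartitions and the operators on the Fock space\<close>

lemma maya_lower:
  assumes "{..m} \<subseteq> S" "finite (S \<inter> {m<..})" "int (card (S \<inter> {m<..})) = t - m" "m' \<le> m"
  shows "{..m'} \<subseteq> S" "finite (S \<inter> {m'<..})" "int (card (S \<inter> {m'<..})) = t - m'"
proof -
  have eq: "S \<inter> {m'<..} = (S \<inter> {m<..}) \<union> {m'<..m}" using assms by auto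
  show "{..m'} \<subseteq> S" using assms by auto
  show "finite (S \<inter> {m'<..})" unfolding eq using assms by auto
  have "card (S \<inter> {m'<..}) = card (S \<inter> {m<..}) + card {m'<..m}"
    unfolding eq using assms by (intro card_Un_disjoint) auto
  then show "int (card (S \<inter> {m'<..})) = t - m'" using assms by simp
qed

lemma maya_remove:
  assumes "maya t S" "k \<in> S"
  shows "maya (t - 1) (S - {k})"
proof -
  from assms obtain m0 where m0: "{..m0} \<subseteq> S" "finite (S \<inter> {m0<..})" "int (card (S \<inter> {m0<..})) = t - m0"
    unfolding maya_def by blast
  define m where "m = min m0 (k - 1)"
  have m: "{..m} \<subseteq> S" "finite (S \<inter> {m<..})" "int (card (S \<inter> {m<..})) = t - m"
    using maya_lower[OF m0, of m] by (auto simp: m_def)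
  have "m < k" by (simp add: m_def)
  have eq: "(S - {k}) \<inter> {m<..} = S \<inter> {m<..} - {k}" by auto
  have mem: "k \<in> S \<inter> {m<..}" using assms \<open>m < k\<close> by auto
  have "card (S \<inter> {m<..} - {k}) = card (S \<inter> {m<..}) - 1" "card (S \<inter> {m<..}) > 0"
    using mem m(2) by (auto simp: card_gt_0_iff)
  then have "int (card ((S - {k}) \<inter> {m<..})) = t - 1 - m" unfolding eq using m(3) by linarith
  moreover have "{..m} \<subseteq> S - {k}" using m(1) \<open>m < k\<close> by auto
  moreover have "finite ((S - {k}) \<inter> {m<..})" unfolding eq using m(2) by auto
  ultimately show ?thesis unfolding maya_def by blast
qed

lemma maya_exchange: "maya t S \<Longrightarrow> a \<in> S \<Longrightarrow> b \<notin> S \<Longrightarrow> maya t (insert b (S - {a}))"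
  using maya_insert[of t "S - {a}" b] maya_remove[of t S a] by auto

section \<open>Bead configurations of bipartitions\<close>

definition cbeads :: "charge \<Rightarrow> bipartition \<Rightarrow> nat \<Rightarrow> int set" where
  "cbeads s lam c = beads (if c = 0 then fst s else snd s) (component lam c)"

text \<open>The bead form of adding a node of content \<open>j\<close> in component
  \<open>c\<close>; \<open>adds_node_raises\<close> and \<open>raises_adds_node\<close> translate in
  both directions.\<close>

definition raises :: "charge \<Rightarrow> int \<Rightarrow> nat \<Rightarrow> bipartition \<Rightarrow> bipartition \<Rightarrow> bool" where
  "raises s j c lam mu \<longleftrightarrow> c \<in> {0, 1} \<and> j \<in> cbeads s lam c \<and> j + 1 \<notin> cbeads s lam c \<and>
     cbeads s mu c = move j (cbeads s lam c) \<and> cbeads s mu (1 - c) = cbeads s lam (1 - c)"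

lemma maya_cbeads: "maya (fst s) (cbeads s lam 0)" "maya (snd s) (cbeads s lam (Suc 0))"
  by (simp_all add: cbeads_def maya_beads)

lemma bipartition_eqI:
  assumes "cbeads s lam 0 = cbeads s mu 0" "cbeads s lam (Suc 0) = cbeads s mu (Suc 0)"
  shows "lam = mu"
  using assms by (auto simp: cbeads_def component_def intro!: prod_eqI beads_inj)

lemma bipartition_ex:
  assumes "maya (fst s) P" "maya (snd s) Q"
  obtains lam where "cbeads s lam 0 = P" "cbeads s lam (Suc 0) = Q"
proof -
  obtain p q where "beads (fst s) p = P" "beads (snd s) q = Q" using assms beads_surj by metis
  then show ?thesis using that[of "(p, q)"] by (simp add: cbeads_def component_def)
qed

lemma mem_diagram: "(a, b, c) \<in> diagram lam \<longleftrightarrow> c \<in> {0, 1} \<and> (a, b) \<in> pdiag (component lam c)"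
  by (auto simp: diagram_def pdiag_def)

lemma adds_node_component:
  assumes "adds_node lam (a, b, c) mu"
  shows "c \<in> {0, 1}" "component mu (1 - c) = component lam (1 - c)"
    "(a, b) \<notin> pdiag (component lam c)" "pdiag (component mu c) = insert (a, b) (pdiag (component lam c))"
proof -
  have ad: "(a, b, c) \<notin> diagram lam" "diagram mu = insert (a, b, c) (diagram lam)"
    using assms unfolding adds_node_def by auto
  then show c: "c \<in> {0, 1}" using mem_diagram[of a b c mu] by auto
  have in_mu: "(a', b') \<in> pdiag (component mu c') \<longleftrightarrow> (a', b', c') = (a, b, c) \<or> (a', b') \<in> pdiag (component lam c')"
    if "c' \<in> {0, 1}" for a' b' c'
    using ad(2) mem_diagram[of a' b' c' mu] mem_diagram[of a' b' c' lam] that by auto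
  show "component mu (1 - c) = component lam (1 - c)"
    by (rule pdiag_inj) (use in_mu[of "1 - c"] c in auto)
  show "(a, b) \<notin> pdiag (component lam c)" using ad(1) c by (auto simp: mem_diagram)
  show "pdiag (component mu c) = insert (a, b) (pdiag (component lam c))"
    using in_mu[OF c] by auto
qed

lemma adds_node_raises:
  assumes "adds_node lam g mu"
  shows "raises s (node_content s g) (snd (snd g)) lam mu"
proof -
  obtain a b c where g: "g = (a, b, c)" by (cases g) auto
  note ad = adds_node_component[OF assms[unfolded g]]
  show ?thesis unfolding raises_def g cbeads_def
    using pdiag_insert_beads[OF ad(3,4), of "if c = 0 then fst s else snd s"] ad(1,2) by auto
qed

lemma raises_adds_node:
  assumes "raises s j c lam mu"
  obtains g where "adds_node lam g mu" "node_content s g = j" "snd (snd g) = c"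
proof -
  let ?t = "if c = 0 then fst s else snd s"
  have c: "c \<in> {0, 1}" and r: "j \<in> beads ?t (component lam c)" "j + 1 \<notin> beads ?t (component lam c)"
    "beads ?t (component mu c) = move j (beads ?t (component lam c))"
    and o: "cbeads s mu (1 - c) = cbeads s lam (1 - c)"
    using assms by (auto simp: raises_def cbeads_def)
  obtain a b where ab: "(a, b) \<notin> pdiag (component lam c)"
    "pdiag (component mu c) = insert (a, b) (pdiag (component lam c))" "int b - int a + ?t = j"
    using beads_move_pdiag[OF r] by blast
  have o': "component mu (1 - c) = component lam (1 - c)"
    using o beads_inj by (auto simp: cbeads_def)
  have "(a', b', c') \<in> diagram mu \<longleftrightarrow> (a', b', c') \<in> insert (a, b, c) (diagram lam)" for a' b' c'
  proof (cases "c' = c")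
    case True
    then show ?thesis using ab c by (auto simp: mem_diagram)
  next
    case False
    show ?thesis
    proof (cases "c' \<in> {0, 1}")
      case True
      then have "c' = 1 - c" using False c by auto
      then show ?thesis using False o' by (auto simp: mem_diagram)
    qed (use False in \<open>auto simp: mem_diagram\<close>)
  qed
  then have "diagram mu = insert (a, b, c) (diagram lam)" by auto
  moreover have "(a, b, c) \<notin> diagram lam" using ab(1) by (auto simp: mem_diagram)
  ultimately have "adds_node lam (a, b, c) mu" by (simp add: adds_node_def)
  then show ?thesis using that[of "(a, b, c)"] ab(3) by simp
qed

lemma adds_node_unique: "adds_node lam g mu \<Longrightarrow> adds_node lam g' mu \<Longrightarrow> g = g'"
  by (auto simp: adds_node_def)

lemma raises_unique_comp: "raises s j c lam mu \<Longrightarrow> raises s j' c' lam mu \<Longrightarrow> j = j' \<and> c = c'"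
  by (metis raises_adds_node adds_node_unique)

lemma raises_unique: "raises s j c lam mu \<Longrightarrow> raises s j c lam mu' \<Longrightarrow> mu = mu'"
  by (rule bipartition_eqI[of s]) (auto simp: raises_def)

lemma raises_unique': "raises s j c lam mu \<Longrightarrow> raises s j c lam' mu \<Longrightarrow> lam = lam'"
proof (rule bipartition_eqI[of s])
  assume *: "raises s j c lam mu" "raises s j c lam' mu"
  have "S = insert j (move j S - {j + 1})" if "j \<in> S" "j + 1 \<notin> S" for S
    using that by (auto simp: move_def)
  then have "cbeads s lam c = cbeads s lam' c" using * unfolding raises_def by metis
  then show "cbeads s lam 0 = cbeads s lam' 0" "cbeads s lam (Suc 0) = cbeads s lam' (Suc 0)"
    using * by (auto simp: raises_def)
qed

lemma raises_ex:
  assumes "c \<in> {0, 1}" "j \<in> cbeads s lam c" "j + 1 \<notin> cbeads s lam c"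
  obtains mu where "raises s j c lam mu"
proof -
  let ?f = "\<lambda>d. if d = c then move j (cbeads s lam c) else cbeads s lam d"
  have "maya (fst s) (?f 0)" "maya (snd s) (?f (Suc 0))"
    using assms maya_cbeads(1)[of s lam] maya_cbeads(2)[of s lam]
      maya_exchange[of _ "cbeads s lam c" j "j + 1"]
    by (auto simp: move_def)
  then obtain mu where "cbeads s mu 0 = ?f 0" "cbeads s mu (Suc 0) = ?f (Suc 0)"
    by (rule bipartition_ex)
  then have "raises s j c lam mu" using assms by (auto simp: raises_def)
  then show ?thesis using that by blast
qed

lemma raises_ex':
  assumes "c \<in> {0, 1}" "j \<notin> cbeads s mu c" "j + 1 \<in> cbeads s mu c"
  obtains lam where "raises s j c lam mu"
proof -
  let ?f = "\<lambda>d. if d = c then insert j (cbeads s mu c - {j + 1}) else cbeads s mu d"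
  have "maya (fst s) (?f 0)" "maya (snd s) (?f (Suc 0))"
    using assms maya_cbeads(1)[of s mu] maya_cbeads(2)[of s mu]
      maya_exchange[of _ "cbeads s mu c" "j + 1" j]
    by auto
  then obtain lam where l: "cbeads s lam 0 = ?f 0" "cbeads s lam (Suc 0) = ?f (Suc 0)"
    by (rule bipartition_ex)
  have "move j (insert j (cbeads s mu c - {j + 1})) = cbeads s mu c" using assms by (auto simp: move_def)
  then have "raises s j c lam mu" using assms l by (auto simp: raises_def)
  then show ?thesis using that by blast
qed

lemma raises_ex_iff: "(\<exists>lam. raises s j c lam mu) \<longleftrightarrow> c \<in> {0, 1} \<and> j \<notin> cbeads s mu c \<and> j + 1 \<in> cbeads s mu c"
  by (metis raises_ex' raises_def move_def insertCI insertE Diff_iff singletonI add.right_neutral add_cancel_left_right zero_neq_one)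

lemma card_addable:
  assumes "c \<in> {0, 1}"
  shows "card {h. addable lam h \<and> snd (snd h) = c \<and> node_content s h = j} =
    of_bool (j \<in> cbeads s lam c \<and> j + 1 \<notin> cbeads s lam c)"
proof (cases "j \<in> cbeads s lam c \<and> j + 1 \<notin> cbeads s lam c")
  case True
  then obtain mu where mu: "raises s j c lam mu" using raises_ex assms by metis
  then obtain g where g: "adds_node lam g mu" "node_content s g = j" "snd (snd g) = c"
    by (rule raises_adds_node)
  have "{h. addable lam h \<and> snd (snd h) = c \<and> node_content s h = j} = {g}"
  proof (intro equalityI subsetI)
    fix h assume "h \<in> {h. addable lam h \<and> snd (snd h) = c \<and> node_content s h = j}"
    then obtain mu' where h: "adds_node lam h mu'" "snd (snd h) = c" "node_content s h = j"
      unfolding addable_def by blast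
    then have "mu' = mu" using adds_node_raises[OF h(1), of s] mu raises_unique by metis
    then show "h \<in> {g}" using h(1) g(1) adds_node_unique by blast
  qed (use g in \<open>auto simp: addable_def simp del: split_paired_Ex\<close>)
  then show ?thesis using True by simp
next
  case False
  then have "{h. addable lam h \<and> snd (snd h) = c \<and> node_content s h = j} = {}"
    using adds_node_raises[where s = s] unfolding addable_def raises_def by blast
  then show ?thesis using False by (simp only: card.empty) simp
qed

lemma card_removable:
  assumes "c \<in> {0, 1}"
  shows "card {h. removable lam h \<and> snd (snd h) = c \<and> node_content s h = j} =
    of_bool (j \<notin> cbeads s lam c \<and> j + 1 \<in> cbeads s lam c)"
proof (cases "j \<notin> cbeads s lam c \<and> j + 1 \<in> cbeads s lam c")
  case True
  then obtain mu where mu: "raises s j c mu lam" using raises_ex' assms by metis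
  then obtain g where g: "adds_node mu g lam" "node_content s g = j" "snd (snd g) = c"
    by (rule raises_adds_node)
  have "{h. removable lam h \<and> snd (snd h) = c \<and> node_content s h = j} = {g}"
  proof (intro equalityI subsetI)
    fix h assume "h \<in> {h. removable lam h \<and> snd (snd h) = c \<and> node_content s h = j}"
    then obtain mu' where h: "adds_node mu' h lam" "snd (snd h) = c" "node_content s h = j"
      unfolding removable_def by blast
    then have "mu' = mu" using adds_node_raises[OF h(1), of s] mu raises_unique' by metis
    then show "h \<in> {g}" using h(1) g(1) adds_node_unique by blast
  qed (use g in \<open>auto simp: removable_def simp del: split_paired_Ex\<close>)
  then show ?thesis using True by simp
next
  case False
  then have "{h. removable lam h \<and> snd (snd h) = c \<and> node_content s h = j} = {}"
    using adds_node_raises[where s = s] raises_ex_iff unfolding removable_def by blast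
  then show ?thesis using False by (simp only: card.empty) simp
qed

text \<open>For a given content a component has at most one addable or removable node. If both or
  none of the sites \<open>i\<close>, \<open>i + 1\<close> are occupied it has neither, and the two
  indicators cancel.\<close>

lemma f_exponent_eq:
  "f_exponent s i lam g = (if snd (snd g) = 0 then 0 else
     of_bool (i \<in> cbeads s lam 0) - of_bool (i + 1 \<in> cbeads s lam 0))"
  unfolding f_exponent_def using card_addable[of 0 lam s i] card_removable[of 0 lam s i] by auto

text \<open>The source of the bead move ending in \<open>mu\<close>; an arbitrary value if there is
  none, so statements about it carry the bead conditions of \<open>raises_ex_iff\<close>.\<close>

definition lowered :: "charge \<Rightarrow> int \<Rightarrow> nat \<Rightarrow> bipartition \<Rightarrow> bipartition" where
  "lowered s j c mu = (SOME lam. raises s j c lam mu)"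

text \<open>Expressed by the result \<open>mu\<close>: for \<open>c = 1\<close> the first component
  is unchanged, so the exponent can be read off after the node has been added.\<close>

definition raise_coeff :: "charge \<Rightarrow> int \<Rightarrow> nat \<Rightarrow> bipartition \<Rightarrow> scalar" where
  "raise_coeff s j c mu = (if c = 0 then 1 else
     v_param powi (of_bool (j \<in> cbeads s mu 0) - of_bool (j + 1 \<in> cbeads s mu 0)))"

lemma finite_f_basis: "finite {(g, mu). adds_node lam g mu \<and> node_content s g = j}"
proof (rule finite_imageD[where f = "\<lambda>(g, mu). snd (snd g)"])
  have "snd (snd g) \<in> {0, 1}" if "adds_node lam g mu" for g mu
    using adds_node_raises[OF that, of s] unfolding raises_def by blast
  then have "(\<lambda>(g, mu). snd (snd g)) ` {(g, mu). adds_node lam g mu \<and> node_content s g = j} \<subseteq> {0, 1}"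
  proof (intro image_subsetI)
    fix x assume "x \<in> {(g, mu). adds_node lam g mu \<and> node_content s g = j}"
    then obtain g mu where "x = (g, mu)" "adds_node lam g mu" by blast
    then show "(case x of (g, mu) \<Rightarrow> snd (snd g)) \<in> {0, 1}"
      using \<open>\<And>mu g. adds_node lam g mu \<Longrightarrow> snd (snd g) \<in> {0, 1}\<close>[of g mu] by simp
  qed
  then show "finite ((\<lambda>(g, mu). snd (snd g)) ` {(g, mu). adds_node lam g mu \<and> node_content s g = j})"
    by (rule finite_subset) simp
  show "inj_on (\<lambda>(g, mu). snd (snd g)) {(g, mu). adds_node lam g mu \<and> node_content s g = j}"
  proof (rule inj_onI)
    fix x y assume *: "x \<in> {(g, mu). adds_node lam g mu \<and> node_content s g = j}"
      "y \<in> {(g, mu). adds_node lam g mu \<and> node_content s g = j}"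
      "(case x of (g, mu) \<Rightarrow> snd (snd g)) = (case y of (g, mu) \<Rightarrow> snd (snd g))"
    obtain g mu h nu where xy: "x = (g, mu)" "y = (h, nu)" by (metis surj_pair)
    have r: "raises s j (snd (snd g)) lam mu" "raises s j (snd (snd g)) lam nu"
      using * adds_node_raises[of lam g mu s] adds_node_raises[of lam h nu s] unfolding xy by auto
    then have "mu = nu" by (rule raises_unique)
    then show "x = y" using * adds_node_unique[of lam g mu h] unfolding xy by auto
  qed
qed

lemma lookup_f_basis:
  "coeff_of (f_basis s j lam) nu =
    (if raises s j 0 lam nu then raise_coeff s j 0 nu else 0) +
    (if raises s j 1 lam nu then raise_coeff s j 1 nu else 0)"
proof -
  let ?A = "{(g, mu). adds_node lam g mu \<and> node_content s g = j}"
  have "coeff_of (f_basis s j lam) nu =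
    (\<Sum>(g, mu) \<in> ?A. if mu = nu then v_param powi f_exponent s j lam g else 0)"
    unfolding f_basis_def lookup_sum
    by (intro sum.cong refl) (auto simp: lookup_fock_scale lookup_single when_def)
  also have "\<dots> = (\<Sum>(g, mu) \<in> {(g, mu) \<in> ?A. mu = nu}. v_param powi f_exponent s j lam g)"
    by (rule sum.mono_neutral_cong_right) (use finite_f_basis[of lam s j] in \<open>auto split: if_splits\<close>)
  also have "\<dots> = (if raises s j 0 lam nu then raise_coeff s j 0 nu else 0) +
    (if raises s j 1 lam nu then raise_coeff s j 1 nu else 0)"
  proof (cases "\<exists>c. raises s j c lam nu")
    case True
    then obtain c where c: "raises s j c lam nu" by blast
    then obtain g where g: "adds_node lam g nu" "node_content s g = j" "snd (snd g) = c"
      by (rule raises_adds_node)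
    have eq: "{(g, mu) \<in> ?A. mu = nu} = {(g, nu)}" using g adds_node_unique by blast
    have rc: "raises s j d lam nu \<longleftrightarrow> d = c" for d using c raises_unique_comp by blast
    have c01: "c = 0 \<or> c = 1" using c by (auto simp: raises_def)
    have fe: "f_exponent s j lam g = (if c = 0 then 0 else
      of_bool (j \<in> cbeads s lam 0) - of_bool (j + 1 \<in> cbeads s lam 0))"
      by (simp add: f_exponent_eq g(3))
    have "c = 1 \<Longrightarrow> cbeads s nu 0 = cbeads s lam 0" using c by (auto simp: raises_def)
    then show ?thesis unfolding eq rc using c01 fe by (elim disjE) (simp_all add: raise_coeff_def)
  next
    case False
    then have eq: "{(g, mu) \<in> ?A. mu = nu} = {}" using adds_node_raises by blast
    show ?thesis unfolding eq using False by simp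
  qed
  finally show ?thesis .
qed

text \<open>The transposed description of the operator: a given \<open>nu\<close> has at most one
  predecessor for each component, so its coefficient is a sum of at most two terms.\<close>

lemma lookup_f_op:
  "coeff_of (f_op s j x) nu = (\<Sum>c\<in>{0, 1}.
    (if j \<notin> cbeads s nu c \<and> j + 1 \<in> cbeads s nu c
     then raise_coeff s j c nu * coeff_of x (lowered s j c nu) else 0))"
proof -
  have one: "(\<Sum>lam \<in> Poly_Mapping.keys x. coeff_of x lam * (if raises s j c lam nu then k else 0)) =
    (if j \<notin> cbeads s nu c \<and> j + 1 \<in> cbeads s nu c then k * coeff_of x (lowered s j c nu) else 0)"
    if "c \<in> {0, 1}" for c k
  proof (cases "j \<notin> cbeads s nu c \<and> j + 1 \<in> cbeads s nu c")
    case True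
    then have ex: "\<exists>lam. raises s j c lam nu" using raises_ex_iff that by blast
    then have l: "raises s j c (lowered s j c nu) nu" unfolding lowered_def by (rule someI_ex)
    have "(\<Sum>lam \<in> Poly_Mapping.keys x. coeff_of x lam * (if raises s j c lam nu then k else 0)) =
      (\<Sum>lam \<in> Poly_Mapping.keys x. if lam = lowered s j c nu then coeff_of x lam * k else 0)"
      using l raises_unique' by (intro sum.cong refl) auto
    also have "\<dots> = coeff_of x (lowered s j c nu) * k"
      by (simp add: sum.delta in_keys_iff)
    finally show ?thesis using True by (simp add: mult.commute)
  next
    case False
    then have "\<not> raises s j c lam nu" for lam using raises_ex_iff by blast
    then show ?thesis unfolding if_not_P[OF False] by simp
  qed
  have "coeff_of (f_op s j x) nu = (\<Sum>lam \<in> Poly_Mapping.keys x. coeff_of x lam * coeff_of (f_basis s j lam) nu)"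
    unfolding f_op_def lookup_sum by (simp add: lookup_fock_scale)
  also have "\<dots> = (\<Sum>c\<in>{0, 1}. \<Sum>lam \<in> Poly_Mapping.keys x. coeff_of x lam * (if raises s j c lam nu then raise_coeff s j c nu else 0))"
    by (simp add: lookup_f_basis distrib_left sum.distrib del: One_nat_def)
  also have "\<dots> = (\<Sum>c\<in>{0, 1}. (if j \<notin> cbeads s nu c \<and> j + 1 \<in> cbeads s nu c
     then raise_coeff s j c nu * coeff_of x (lowered s j c nu) else 0))"
    using one by (intro sum.cong refl) blast
  finally show ?thesis .
qed

lemma f_op_add: "f_op s j (x + y) = f_op s j x + f_op s j y"
  by (intro poly_mapping_eqI) (simp add: lookup_f_op lookup_add algebra_simps)

lemma f_op_scale: "f_op s j (fock_scale r x) = fock_scale r (f_op s j x)"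
  by (intro poly_mapping_eqI) (simp add: lookup_f_op lookup_fock_scale algebra_simps)

lemma bip_rank_diagram: "bip_rank lam = card (diagram lam)" "finite (diagram lam)"
proof -
  have eq: "diagram lam = (\<lambda>(a, b). (a, b, 0)) ` pdiag (fst lam) \<union> (\<lambda>(a, b). (a, b, 1)) ` pdiag (snd lam)"
  proof (intro set_eqI iffI)
    fix z assume "z \<in> diagram lam"
    moreover obtain a b c where "z = (a, b, c)" by (cases z) auto
    ultimately show "z \<in> (\<lambda>(a, b). (a, b, 0)) ` pdiag (fst lam) \<union> (\<lambda>(a, b). (a, b, 1)) ` pdiag (snd lam)"
      by (auto simp: mem_diagram component_def intro: image_eqI[of _ _ "(a, b)"])
  qed (auto simp: mem_diagram component_def)
  have fin: "finite (pdiag p)" for p using card_pdiag by blast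
  show "finite (diagram lam)" unfolding eq using fin by auto
  have "card (diagram lam) = card ((\<lambda>(a, b). (a, b, 0 :: nat)) ` pdiag (fst lam)) + card ((\<lambda>(a, b). (a, b, 1 :: nat)) ` pdiag (snd lam))"
    unfolding eq by (intro card_Un_disjoint) (use fin in auto)
  also have "\<dots> = card (pdiag (fst lam)) + card (pdiag (snd lam))"
    by (intro arg_cong2[of _ _ _ _ "(+)"] card_image) (auto simp: inj_on_def)
  finally show "bip_rank lam = card (diagram lam)" using card_pdiag by (simp add: bip_rank_def)
qed

lemma adds_node_rank: "adds_node lam g mu \<Longrightarrow> bip_rank mu = Suc (bip_rank lam)"
  unfolding adds_node_def using bip_rank_diagram by simp

lemma raises_rank: "raises s j c lam mu \<Longrightarrow> bip_rank mu = Suc (bip_rank lam)"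
  by (metis raises_adds_node adds_node_rank)

section \<open>Cup vectors\<close>

definition level :: "charge \<Rightarrow> bipartition \<Rightarrow> int \<Rightarrow> nat" where
  "level s lam k = of_bool (k \<in> cbeads s lam 0) + of_bool (k \<in> cbeads s lam (Suc 0))"

text \<open>The restriction to a set of sites allows the word to be cut around \<open>j\<close> and
  \<open>j + 1\<close>, outside of which a bead move changes nothing.\<close>

definition word_on :: "charge \<Rightarrow> bipartition \<Rightarrow> int set \<Rightarrow> bool list" where
  "word_on s lam A =
     map (\<lambda>k. k \<in> cbeads s lam (Suc 0)) (sorted_list_of_set {k \<in> A. level s lam k = 1})"

abbreviation word :: "charge \<Rightarrow> bipartition \<Rightarrow> bool list" where
  "word s lam \<equiv> word_on s lam UNIV"

lemma level_le: "level s lam k \<le> 2"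
  by (simp add: level_def)

lemma level_simps:
  "level s lam k = 0 \<longleftrightarrow> k \<notin> cbeads s lam 0 \<and> k \<notin> cbeads s lam (Suc 0)"
  "level s lam k = Suc 0 \<longleftrightarrow> (k \<in> cbeads s lam 0) \<noteq> (k \<in> cbeads s lam (Suc 0))"
  "level s lam k = 2 \<longleftrightarrow> k \<in> cbeads s lam 0 \<and> k \<in> cbeads s lam (Suc 0)"
  by (auto simp: level_def)

lemma finite_level_1: "finite {k. level s lam k = 1}"
proof -
  obtain m where m: "{..m} \<subseteq> cbeads s lam 0" "finite (cbeads s lam 0 \<inter> {m<..})"
    using maya_cbeads(1)[of s lam] unfolding maya_def by blast
  obtain n where n: "{..n} \<subseteq> cbeads s lam (Suc 0)" "finite (cbeads s lam (Suc 0) \<inter> {n<..})"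
    using maya_cbeads(2)[of s lam] unfolding maya_def by blast
  have "{k. level s lam k = 1} \<subseteq> (cbeads s lam 0 \<inter> {m<..}) \<union> (cbeads s lam (Suc 0) \<inter> {n<..}) \<union> {m<..n} \<union> {n<..m}"
  proof
    fix k assume "k \<in> {k. level s lam k = 1}"
    then have k: "(k \<in> cbeads s lam 0) \<noteq> (k \<in> cbeads s lam (Suc 0))" by (simp add: level_simps)
    show "k \<in> (cbeads s lam 0 \<inter> {m<..}) \<union> (cbeads s lam (Suc 0) \<inter> {n<..}) \<union> {m<..n} \<union> {n<..m}"
    proof (cases "k \<in> cbeads s lam 0")
      case True
      then have "n < k" using k n(1) by (meson atMost_iff leI subsetD)
      then show ?thesis using True by auto
    next
      case False
      then have "m < k" using m(1) by (meson atMost_iff leI subsetD)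
      then show ?thesis using False k by auto
    qed
  qed
  then show ?thesis by (rule finite_subset) (use m(2) n(2) in auto)
qed

lemma sorted_list_of_set_Un:
  fixes A B :: "int set"
  assumes "finite A" "finite B" "\<And>a b. a \<in> A \<Longrightarrow> b \<in> B \<Longrightarrow> a < b"
  shows "sorted_list_of_set (A \<union> B) = sorted_list_of_set A @ sorted_list_of_set B"
proof -
  let ?l = "sorted_list_of_set A @ sorted_list_of_set B"
  have "sorted ?l" using assms by (auto simp: sorted_append intro: less_imp_le)
  moreover have "distinct ?l" using assms by force
  moreover have "set ?l = A \<union> B" using assms by simp
  ultimately show ?thesis by (metis sorted_list_of_set.idem_if_sorted_distinct)
qed

lemma word_on_Un:
  assumes "\<And>a b. a \<in> A \<Longrightarrow> b \<in> B \<Longrightarrow> a < b"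
  shows "word_on s lam (A \<union> B) = word_on s lam A @ word_on s lam B"
proof -
  have fin: "finite {k \<in> C. level s lam k = 1}" for C
    using finite_level_1[of s lam] by (rule finite_subset[rotated]) auto
  have "{k \<in> A \<union> B. level s lam k = 1} = {k \<in> A. level s lam k = 1} \<union> {k \<in> B. level s lam k = 1}" by auto
  then show ?thesis unfolding word_on_def
    using assms by (simp only: map_append[symmetric]) (subst sorted_list_of_set_Un, use fin in auto)
qed

lemma word_on_singleton: "word_on s lam {k} = (if level s lam k = 1 then [k \<in> cbeads s lam (Suc 0)] else [])"
proof -
  have "{i \<in> {k}. level s lam i = 1} = (if level s lam k = 1 then {k} else {})" by auto
  then show ?thesis by (simp add: word_on_def)
qed

lemma word_split:
  "word s lam = word_on s lam {..<j} @ word_on s lam {j} @ word_on s lam {j + 1} @ word_on s lam {j + 1<..}"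
proof -
  have "UNIV = {..<j} \<union> ({j} \<union> ({j + 1} \<union> {j + 1<..}))" by auto
  then have "word s lam = word_on s lam ({..<j} \<union> ({j} \<union> ({j + 1} \<union> {j + 1<..})))" by (rule arg_cong)
  also have "\<dots> = word_on s lam {..<j} @ word_on s lam {j} @ word_on s lam {j + 1} @ word_on s lam {j + 1<..}"
    by (subst word_on_Un, force)+ simp
  finally show ?thesis .
qed

lemma word_on_cong:
  assumes "\<And>k. k \<in> A \<Longrightarrow> k \<in> cbeads s lam 0 \<longleftrightarrow> k \<in> cbeads s mu 0"
    "\<And>k. k \<in> A \<Longrightarrow> k \<in> cbeads s lam (Suc 0) \<longleftrightarrow> k \<in> cbeads s mu (Suc 0)"
  shows "word_on s lam A = word_on s mu A"
proof -
  have eq: "{k \<in> A. level s lam k = 1} = {k \<in> A. level s mu k = 1}" using assms by (auto simp: level_def)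
  have fin: "finite {k \<in> A. level s mu k = 1}"
    using finite_level_1[of s mu] by (rule finite_subset[rotated]) auto
  show ?thesis unfolding word_on_def eq using assms fin by (intro map_cong refl) auto
qed

lemma length_word_on: "level s lam = level s mu \<Longrightarrow> length (word_on s lam A) = length (word_on s mu A)"
  by (simp add: word_on_def)

lemma level_word_inj:
  assumes "level s lam = level s mu" "word s lam = word s mu"
  shows "lam = mu"
proof -
  have "k \<in> cbeads s lam (Suc 0) \<longleftrightarrow> k \<in> cbeads s mu (Suc 0)" if "level s lam k = 1" for k
  proof -
    have "k \<in> set (sorted_list_of_set {k. level s mu k = 1})"
      using that assms(1) finite_level_1[of s mu] by simp
    then show ?thesis using assms(2) unfolding word_on_def assms(1) by (simp add: map_eq_conv)
  qed
  then have "k \<in> cbeads s lam 0 \<longleftrightarrow> k \<in> cbeads s mu 0" "k \<in> cbeads s lam (Suc 0) \<longleftrightarrow> k \<in> cbeads s mu (Suc 0)" for k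
    using fun_cong[OF assms(1), of k] unfolding level_def
    by (cases "k \<in> cbeads s lam 0"; cases "k \<in> cbeads s lam (Suc 0)";
        cases "k \<in> cbeads s mu 0"; cases "k \<in> cbeads s mu (Suc 0)"; simp)+
  then show ?thesis by (intro bipartition_eqI[of s]) auto
qed

section \<open>Bipartitions with prescribed levels and word\<close>

lemma maya_Un:
  "finite D \<Longrightarrow> D \<inter> B = {} \<Longrightarrow> maya t B \<Longrightarrow> maya (t + int (card D)) (B \<union> D)"
proof (induction D rule: finite_induct)
  case (insert k D)
  then show ?case using maya_insert[of "t + int (card D) + 1" "B \<union> D" k]
    by (simp add: algebra_simps)
qed simp

lemma maya_Diff:
  "finite D \<Longrightarrow> D \<subseteq> S \<Longrightarrow> maya t S \<Longrightarrow> maya (t - int (card D)) (S - D)"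
proof (induction D rule: finite_induct)
  case (insert k D)
  then have "maya (t - int (card D) - 1) (S - D - {k})"
    by (intro maya_remove) auto
  moreover have "S - insert k D = S - D - {k}" by auto
  ultimately show ?case using insert by (simp add: algebra_simps)
qed simp

lemma maya_swap:
  assumes "maya t S" "finite D" "D \<subseteq> S" "finite D'" "D' \<inter> (S - D) = {}" "card D = card D'"
  shows "maya t ((S - D) \<union> D')"
  using maya_Un[OF assms(4,5) maya_Diff[OF assms(2,3,1)]] assms(6) by simp

lemma card_letters:
  assumes "distinct ks" "length w = length ks"
  shows "card {k. \<exists>i<length ks. ks ! i = k \<and> w ! i = b} = count_list w b"
proof -
  have "{k. \<exists>i<length ks. ks ! i = k \<and> w ! i = b} = (\<lambda>i. ks ! i) ` {i. i < length w \<and> w ! i = b}"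
    using assms by auto
  moreover have "inj_on (\<lambda>i. ks ! i) {i. i < length w \<and> w ! i = b}"
    using assms by (auto simp: inj_on_def nth_eq_iff_index_eq)
  moreover have "card {i. i < length w \<and> w ! i = b} = count_list w b"
    by (simp add: count_list_eq_length_filter length_filter_conv_card eq_commute)
  ultimately show ?thesis by (simp add: card_image)
qed

text \<open>The levels fix the sites of the letters. The number of letters of each kind is kept
  because it determines the charges of the two components.\<close>

lemma realize_word:
  assumes "length w = length (word s lam)" "count_list w False = count_list (word s lam) False"
  obtains mu where "level s mu = level s lam" "word s mu = w"
proof -
  let ?K = "{k. level s lam k = 1}"
  define ks where "ks = sorted_list_of_set ?K"
  have ks: "set ks = ?K" "distinct ks" "sorted ks" using finite_level_1[of s lam] by (auto simp: ks_def)
  have u: "word s lam = map (\<lambda>k. k \<in> cbeads s lam (Suc 0)) ks" by (simp add: word_on_def ks_def)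
  have len: "length w = length ks" using assms u by simp
  define D where "D u b = {k. \<exists>i<length ks. ks ! i = k \<and> u ! i = b}" for u :: "bool list" and b
  have D_sub: "D v b \<subseteq> ?K" for v b unfolding D_def ks(1)[symmetric] by auto
  have D_fin: "finite (D v b)" for v b using D_sub finite_level_1 by (rule finite_subset)
  have card: "card (D v b) = count_list v b" if "length v = length ks" for v b
    unfolding D_def using ks that by (intro card_letters)
  have cnt: "count_list w b = count_list (word s lam) b" for b
  proof -
    have "count_list v True + count_list v False = length v" for v by (induction v) auto
    then show ?thesis using assms by (cases b) (metis add_right_cancel)+
  qed
  have card_eq: "card (D (word s lam) b) = card (D w b)" for b
    using card[OF len] card[of "word s lam"] u cnt by simp
  have D_u: "k \<in> D (word s lam) b \<longleftrightarrow> k \<in> ?K \<and> (k \<in> cbeads s lam (Suc 0)) = b" for k b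
    unfolding D_def u ks(1)[symmetric] by (auto simp: in_set_conv_nth)
  have D_w: "k \<in> D w (\<not> b) \<longleftrightarrow> k \<in> ?K \<and> k \<notin> D w b" for k b
    unfolding D_def ks(1)[symmetric] using ks(2) len by (auto simp: in_set_conv_nth nth_eq_iff_index_eq)
  \<comment> \<open>On sites of level 1 the beads of \<open>lam\<close> are replaced by those that
    \<open>w\<close> prescribes; sites of level 0 or 2 keep theirs.\<close>
  let ?P = "(cbeads s lam 0 - D (word s lam) False) \<union> D w False"
  let ?Q = "(cbeads s lam (Suc 0) - D (word s lam) True) \<union> D w True"
  have "maya (fst s) ?P"
  proof (rule maya_swap[OF maya_cbeads(1) D_fin _ D_fin _ card_eq])
    show "D (word s lam) False \<subseteq> cbeads s lam 0" using D_u by (auto simp: level_simps)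
    show "D w False \<inter> (cbeads s lam 0 - D (word s lam) False) = {}"
      using D_u D_sub[of w False] by (auto simp: level_simps)
  qed
  moreover have "maya (snd s) ?Q"
  proof (rule maya_swap[OF maya_cbeads(2) D_fin _ D_fin _ card_eq])
    show "D (word s lam) True \<subseteq> cbeads s lam (Suc 0)" using D_u by (auto simp: level_simps)
    show "D w True \<inter> (cbeads s lam (Suc 0) - D (word s lam) True) = {}"
      using D_u D_sub[of w True] by (auto simp: level_simps)
  qed
  ultimately obtain mu where mu: "cbeads s mu 0 = ?P" "cbeads s mu (Suc 0) = ?Q"
    by (rule bipartition_ex)
  have lev: "level s mu k = level s lam k" for k
  proof (cases "level s lam k = 1")
    case True
    have "k \<in> ?P \<longleftrightarrow> k \<in> D w False" using True D_u[of k False] by (auto simp: level_simps)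
    moreover have "k \<in> ?Q \<longleftrightarrow> k \<in> D w True" using True D_u[of k True] by (auto simp: level_simps)
    ultimately show ?thesis using True D_w[of k False] unfolding level_def mu by auto
  next
    case False
    then have "k \<notin> D v b" for v b using D_sub by auto
    then show ?thesis unfolding level_def mu by simp
  qed
  have lev': "level s mu = level s lam" by (rule ext) (rule lev)
  have "sorted_list_of_set {k \<in> UNIV. level s mu k = 1} = ks" unfolding lev' ks_def by simp
  then have "word s mu = map (\<lambda>k. k \<in> cbeads s mu (Suc 0)) ks" unfolding word_on_def by simp
  then have "word s mu = map (\<lambda>k. k \<in> ?Q) ks" by (simp only: mu(2))
  also have "\<dots> = w"
  proof (rule nth_equalityI)
    fix i assume i: "i < length (map (\<lambda>k. k \<in> ?Q) ks)"
    then have "ks ! i \<in> ?K" using nth_mem[of i ks] unfolding ks(1) length_map by blast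
    then have "ks ! i \<in> ?Q \<longleftrightarrow> ks ! i \<in> D w True" using D_u[of "ks ! i" True] by auto
    also have "\<dots> \<longleftrightarrow> w ! i" unfolding D_def using i ks(2) by (auto simp: nth_eq_iff_index_eq)
    finally show "map (\<lambda>k. k \<in> ?Q) ks ! i = w ! i" using i by (simp only: length_map nth_map)
  qed (simp add: len)
  finally show ?thesis using lev' that by blast
qed

lemma finite_same_level: "finite {mu. level s mu = level s lam}"
proof (rule finite_imageD)
  let ?g = "word s"
  have "?g ` {mu. level s mu = level s lam} \<subseteq> {xs. set xs \<subseteq> UNIV \<and> length xs = length (word s lam)}"
    using length_word_on by blast
  then show "finite (?g ` {mu. level s mu = level s lam})"
    by (rule finite_subset) (rule finite_lists_length_eq, simp)
  show "inj_on ?g {mu. level s mu = level s lam}"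
  proof (rule inj_onI)
    fix mu nu assume "mu \<in> {mu. level s mu = level s lam}" "nu \<in> {mu. level s mu = level s lam}"
      "word s mu = word s nu"
    then show "mu = nu" using level_word_inj[of s mu nu] by simp
  qed
qed

definition cup_vector :: "charge \<Rightarrow> bipartition \<Rightarrow> fock" where
  "cup_vector s lam = Abs_poly_mapping
     (\<lambda>mu. if level s mu = level s lam then cup_coeff (word s lam) (word s mu) else 0)"

lemma lookup_cup_vector:
  "coeff_of (cup_vector s lam) mu =
     (if level s mu = level s lam then cup_coeff (word s lam) (word s mu) else 0)"
proof -
  have "finite {mu. (if level s mu = level s lam then cup_coeff (word s lam) (word s mu) else 0) \<noteq> 0}"
    using finite_same_level by (rule finite_subset[rotated]) auto
  then show ?thesis unfolding cup_vector_def by (simp add: Abs_poly_mapping_inverse)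
qed

section \<open>Action of the operators on cup vectors\<close>

definition shift :: "int \<Rightarrow> (int \<Rightarrow> nat) \<Rightarrow> int \<Rightarrow> nat" where
  "shift j L = L(j := L j - 1, j + 1 := Suc (L (j + 1)))"

lemma raises_level:
  assumes "raises s j c lam mu"
  shows "level s mu = shift j (level s lam)" "1 \<le> level s lam j" "level s lam (j + 1) \<le> 1"
proof -
  have r: "c = 0 \<or> c = Suc 0" "j \<in> cbeads s lam c" "j + 1 \<notin> cbeads s lam c"
    using assms by (auto simp: raises_def)
  have M: "k \<in> cbeads s mu d \<longleftrightarrow> (if d = c then k = j + 1 \<or> k \<in> cbeads s lam d \<and> k \<noteq> j else k \<in> cbeads s lam d)"
    if "d = 0 \<or> d = Suc 0" for d k
    using assms that unfolding raises_def move_def by auto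
  have "level s mu k = shift j (level s lam) k" for k
    unfolding level_def M[of 0, OF disjI1[OF refl]] M[of "Suc 0", OF disjI2[OF refl]] shift_def
    using r by (cases "k = j"; cases "k = j + 1"; elim disjE) simp_all
  then show "level s mu = shift j (level s lam)" by (rule ext)
  show "1 \<le> level s lam j" "level s lam (j + 1) \<le> 1"
    using r unfolding level_def by (elim disjE; simp)+
qed

text \<open>The subtraction in \<open>shift\<close> is truncated, so the old value at
  \<open>j\<close> can be recovered because it was positive.\<close>

lemma shift_inj: "shift j L = shift j M \<Longrightarrow> 1 \<le> L j \<Longrightarrow> 1 \<le> M j \<Longrightarrow> L = M"
proof (rule ext)
  fix k assume *: "shift j L = shift j M" "1 \<le> L j" "1 \<le> M j"
  show "L k = M k"
  proof (cases "k = j")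
    case True
    then show ?thesis using fun_cong[OF *(1), of j] *(2,3) by (simp add: shift_def)
  next
    case False
    then show ?thesis using fun_cong[OF *(1), of k] by (cases "k = j + 1") (simp_all add: shift_def)
  qed
qed

lemma raises_word_on:
  assumes "raises s j c lam mu" "j \<notin> A" "j + 1 \<notin> A"
  shows "word_on s mu A = word_on s lam A"
  using assms by (intro word_on_cong) (auto simp: raises_def move_def)

lemma raises_lowered:
  assumes "c \<in> {0, 1}" "j \<notin> cbeads s mu c" "j + 1 \<in> cbeads s mu c"
  shows "raises s j c (lowered s j c mu) mu"
  unfolding lowered_def using assms raises_ex_iff by (metis someI_ex)

lemma lookup_f_cup_vector:
  "coeff_of (f_op s j (cup_vector s lam)) nu =
    (if 1 \<le> level s lam j \<and> level s lam (j + 1) \<le> 1 \<and> level s nu = shift j (level s lam)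
     then \<Sum>c\<in>{0, Suc 0}. if j \<notin> cbeads s nu c \<and> j + 1 \<in> cbeads s nu c
       then raise_coeff s j c nu * cup_coeff (word s lam) (word s (lowered s j c nu)) else 0 else 0)"
proof -
  have *: "coeff_of (cup_vector s lam) (lowered s j c nu) =
    (if 1 \<le> level s lam j \<and> level s lam (j + 1) \<le> 1 \<and> level s nu = shift j (level s lam)
    then cup_coeff (word s lam) (word s (lowered s j c nu)) else 0)"
    if "c \<in> {0, Suc 0}" "j \<notin> cbeads s nu c" "j + 1 \<in> cbeads s nu c" for c
  proof -
    have r: "raises s j c (lowered s j c nu) nu" using that raises_lowered by simp
    note l = raises_level[OF r]
    have "level s (lowered s j c nu) = level s lam \<longleftrightarrow>
      1 \<le> level s lam j \<and> level s lam (j + 1) \<le> 1 \<and> level s nu = shift j (level s lam)"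
      using l shift_inj[of j "level s (lowered s j c nu)" "level s lam"] by auto
    then show ?thesis by (simp add: lookup_cup_vector)
  qed
  show ?thesis unfolding lookup_f_op using *[of 0] *[of "Suc 0"] by auto
qed

lemma f_cup_vector_0:
  assumes "level s lam j = 0 \<or> level s lam (j + 1) = 2"
  shows "f_op s j (cup_vector s lam) = 0"
  using assms by (intro poly_mapping_eqI) (auto simp: lookup_f_cup_vector)

lemma lowered_word:
  assumes "c \<in> {0, Suc 0}" "j \<notin> cbeads s nu c" "j + 1 \<in> cbeads s nu c"
  shows "word s (lowered s j c nu) = word_on s nu {..<j} @
    (if j \<in> cbeads s nu (1 - c) then [] else [c = 1]) @
    (if j + 1 \<in> cbeads s nu (1 - c) then [c = 0] else []) @ word_on s nu {j + 1<..}"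
proof -
  have r: "raises s j c (lowered s j c nu) nu" using assms raises_lowered by simp
  have 1: "word_on s (lowered s j c nu) {..<j} = word_on s nu {..<j}"
    "word_on s (lowered s j c nu) {j + 1<..} = word_on s nu {j + 1<..}"
    using raises_word_on[OF r] by auto
  have "word_on s (lowered s j c nu) {j} = (if j \<in> cbeads s nu (1 - c) then [] else [c = 1])"
    "word_on s (lowered s j c nu) {j + 1} = (if j + 1 \<in> cbeads s nu (1 - c) then [c = 0] else [])"
    using r assms(1) unfolding raises_def word_on_singleton by (auto simp: level_def)
  then show ?thesis using word_split[of s "lowered s j c nu" j] 1 by simp
qed

text \<open>One letter changes its site between \<open>j\<close> and \<open>j + 1\<close> without
  meeting another one. When a bead of the second component moves, the first component has beads on
  both sites or on none, so the exponent of \<open>v_param\<close> is 0.\<close>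

lemma f_cup_vector_single:
  assumes "level s lam j = 1 \<and> level s lam (j + 1) = 0 \<or> level s lam j = 2 \<and> level s lam (j + 1) = 1"
    "raises s j c lam mu"
  shows "f_op s j (cup_vector s lam) = cup_vector s mu" "word s mu = word s lam"
proof -
  note l = raises_level[OF assms(2)]
  have o: "word_on s mu {..<j} = word_on s lam {..<j}" "word_on s mu {j + 1<..} = word_on s lam {j + 1<..}"
    using raises_word_on[OF assms(2)] by auto
  have "word_on s mu {j} @ word_on s mu {j + 1} = word_on s lam {j} @ word_on s lam {j + 1}"
    using assms unfolding word_on_singleton raises_def move_def level_def by (auto split: if_splits)
  then show w: "word s mu = word s lam"
    unfolding word_split[of s mu j] word_split[of s lam j] o append_assoc[symmetric] by simp
  show "f_op s j (cup_vector s lam) = cup_vector s mu"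
  proof (rule poly_mapping_eqI)
    fix nu
    show "coeff_of (f_op s j (cup_vector s lam)) nu = coeff_of (cup_vector s mu) nu"
    proof (cases "level s nu = level s mu")
      case True
      have lev: "level s nu j = 0 \<and> level s nu (j + 1) = 1 \<or> level s nu j = 1 \<and> level s nu (j + 1) = 2"
        unfolding True l(1) shift_def using assms(1) by auto
      have lw: "word s (lowered s j c nu) = word s nu" if "c \<in> {0, Suc 0}" "j \<notin> cbeads s nu c" "j + 1 \<in> cbeads s nu c" for c
        unfolding lowered_word[OF that] word_split[of s nu j] word_on_singleton
        using lev that by (auto simp: level_simps)
      have mem: "j \<notin> cbeads s nu 0 \<and> j \<notin> cbeads s nu (Suc 0) \<and> (j + 1 \<in> cbeads s nu 0) \<noteq> (j + 1 \<in> cbeads s nu (Suc 0)) \<or>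
        (j \<in> cbeads s nu 0) \<noteq> (j \<in> cbeads s nu (Suc 0)) \<and> j + 1 \<in> cbeads s nu 0 \<and> j + 1 \<in> cbeads s nu (Suc 0)"
        using lev by (simp add: level_simps)
      have cond: "1 \<le> level s lam j \<and> level s lam (j + 1) \<le> 1 \<and> level s nu = shift j (level s lam)"
        using l True by simp
      show ?thesis
        unfolding lookup_f_cup_vector if_P[OF cond] lookup_cup_vector if_P[OF True] w
        using mem lw[of 0] lw[of "Suc 0"]
        by (elim disjE; cases "j \<in> cbeads s nu 0"; cases "j + 1 \<in> cbeads s nu 0") (simp_all add: raise_coeff_def)
    qed (use l in \<open>simp add: lookup_f_cup_vector lookup_cup_vector\<close>)
  qed
qed

text \<open>Two beads on \<open>j\<close> and none on \<open>j + 1\<close> create a cup. Moving the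
  bead of the first component gives its unflipped state with factor 1. Moving the other gives the
  flipped state, and the bead of the first component left on \<open>j\<close> supplies the factor
  \<open>v_param\<close>.\<close>

lemma f_cup_vector_cup:
  assumes "level s lam j = 2" "level s lam (j + 1) = 0" "raises s j 0 lam mu"
  shows "f_op s j (cup_vector s lam) = cup_vector s mu"
    "word s lam = word_on s lam {..<j} @ word_on s lam {j + 1<..}"
    "word s mu = word_on s lam {..<j} @ True # False # word_on s lam {j + 1<..}"
proof -
  note l = raises_level[OF assms(3)]
  have o: "word_on s mu {..<j} = word_on s lam {..<j}" "word_on s mu {j + 1<..} = word_on s lam {j + 1<..}"
    using raises_word_on[OF assms(3)] by auto
  show wl: "word s lam = word_on s lam {..<j} @ word_on s lam {j + 1<..}"
    unfolding word_split[of s lam j] using assms by (simp add: word_on_singleton)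
  have "word_on s mu {j} = [True]" "word_on s mu {j + 1} = [False]"
    using assms unfolding word_on_singleton raises_def move_def by (auto simp: level_simps level_def)
  then show wm: "word s mu = word_on s lam {..<j} @ True # False # word_on s lam {j + 1<..}"
    unfolding word_split[of s mu j] o by simp
  show "f_op s j (cup_vector s lam) = cup_vector s mu"
  proof (rule poly_mapping_eqI)
    fix nu
    show "coeff_of (f_op s j (cup_vector s lam)) nu = coeff_of (cup_vector s mu) nu"
    proof (cases "level s nu = level s mu")
      case True
      have lev: "level s nu j = 1" "level s nu (j + 1) = 1"
        unfolding True l(1) shift_def using assms by auto
      have wn: "word s nu = word_on s nu {..<j} @ (j \<in> cbeads s nu (Suc 0)) # (j + 1 \<in> cbeads s nu (Suc 0)) # word_on s nu {j + 1<..}"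
        unfolding word_split[of s nu j] word_on_singleton lev by simp
      have len: "length (word_on s lam {..<j}) = length (word_on s nu {..<j})"
        using length_word_on[OF True] o by simp
      have lw: "word s (lowered s j c nu) = word_on s nu {..<j} @ word_on s nu {j + 1<..}"
        if "c \<in> {0, Suc 0}" "j \<notin> cbeads s nu c" "j + 1 \<in> cbeads s nu c" for c
        unfolding lowered_word[OF that] using lev that by (auto simp: level_simps)
      have mem: "j \<in> cbeads s nu (Suc 0) \<longleftrightarrow> j \<notin> cbeads s nu 0" "j + 1 \<in> cbeads s nu (Suc 0) \<longleftrightarrow> j + 1 \<notin> cbeads s nu 0"
        using lev by (auto simp: level_simps)
      have cond: "1 \<le> level s lam j \<and> level s lam (j + 1) \<le> 1 \<and> level s nu = shift j (level s lam)"
        using l True by simp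
      show ?thesis
        unfolding lookup_f_cup_vector if_P[OF cond] lookup_cup_vector if_P[OF True] wm wn cup_coeff_cup[OF len]
        using mem lw[of 0] lw[of "Suc 0"] wl
        by (cases "j \<in> cbeads s nu 0"; cases "j + 1 \<in> cbeads s nu 0") (simp_all add: raise_coeff_def)
    qed (use l in \<open>simp add: lookup_f_cup_vector lookup_cup_vector\<close>)
  qed
qed

text \<open>In \<open>nu\<close> the first component has a bead on \<open>j + 1\<close> and none on
  \<open>j\<close>, so the exponent for the second component is -1, in agreement with
  \<open>cap_coeff\<close>.\<close>

lemma lookup_f_cap:
  assumes "level s lam j = 1" "level s lam (j + 1) = 1" "level s nu = shift j (level s lam)"
  shows "coeff_of (f_op s j (cup_vector s lam)) nu =
    cap_coeff (word s lam) (word_on s nu {..<j}) (word_on s nu {j + 1<..})"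
    "word s nu = word_on s nu {..<j} @ word_on s nu {j + 1<..}"
proof -
  have lev: "level s nu j = 0" "level s nu (j + 1) = 2"
    unfolding assms(3) shift_def using assms by auto
  have "word s (lowered s j c nu) = word_on s nu {..<j} @ (c = 1) # (c = 0) # word_on s nu {j + 1<..}"
    if "c \<in> {0, Suc 0}" for c
  proof -
    have "j \<notin> cbeads s nu c" "j + 1 \<in> cbeads s nu c" using lev that by (auto simp: level_simps)
    from lowered_word[OF that this] show ?thesis using lev that by (auto simp: level_simps)
  qed
  note lw = this
  have mem: "j \<notin> cbeads s nu 0" "j \<notin> cbeads s nu (Suc 0)" "j + 1 \<in> cbeads s nu 0" "j + 1 \<in> cbeads s nu (Suc 0)"
    using lev by (simp_all add: level_simps)
  have cond: "1 \<le> level s lam j \<and> level s lam (j + 1) \<le> 1 \<and> level s nu = shift j (level s lam)"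
    using assms by simp
  show "coeff_of (f_op s j (cup_vector s lam)) nu =
    cap_coeff (word s lam) (word_on s nu {..<j}) (word_on s nu {j + 1<..})"
    unfolding lookup_f_cup_vector if_P[OF cond] using mem lw[of 0] lw[of "Suc 0"]
    by (simp add: raise_coeff_def power_int_minus cap_coeff_def)
  show "word s nu = word_on s nu {..<j} @ word_on s nu {j + 1<..}"
    unfolding word_split[of s nu j] word_on_singleton lev by simp
qed

text \<open>The cup joins the two sites themselves, so a loop is closed. In contrast to the general
  cap the resulting bipartition is named, as \<open>cup_vector_generated\<close> has to reach a
  given one.\<close>

lemma f_cup_vector_cap_adjacent:
  assumes "level s lam j = 1" "level s lam (j + 1) = 1" "raises s j (Suc 0) lam mu"
  shows "f_op s j (cup_vector s lam) = fock_scale quantum_two (cup_vector s mu)"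
    "word s lam = word_on s lam {..<j} @ True # False # word_on s lam {j + 1<..}"
    "word s mu = word_on s lam {..<j} @ word_on s lam {j + 1<..}"
proof -
  note l = raises_level[OF assms(3)]
  have o: "word_on s mu {..<j} = word_on s lam {..<j}" "word_on s mu {j + 1<..} = word_on s lam {j + 1<..}"
    using raises_word_on[OF assms(3)] by auto
  have "word_on s lam {j} = [True]" "word_on s lam {j + 1} = [False]"
    using assms unfolding word_on_singleton raises_def by auto
  then show wl: "word s lam = word_on s lam {..<j} @ True # False # word_on s lam {j + 1<..}"
    unfolding word_split[of s lam j] by simp
  show wm: "word s mu = word_on s lam {..<j} @ word_on s lam {j + 1<..}"
    using lookup_f_cap(2)[OF assms(1,2) l(1)] o by simp
  show "f_op s j (cup_vector s lam) = fock_scale quantum_two (cup_vector s mu)"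
  proof (rule poly_mapping_eqI)
    fix nu
    show "coeff_of (f_op s j (cup_vector s lam)) nu = coeff_of (fock_scale quantum_two (cup_vector s mu)) nu"
    proof (cases "level s nu = level s mu")
      case True
      have len: "length (word_on s lam {..<j}) = length (word_on s nu {..<j})"
        using length_word_on[OF True] o by simp
      have lv: "level s nu = shift j (level s lam)" using True l(1) by simp
      show ?thesis
        unfolding lookup_f_cap(1)[OF assms(1,2) lv] cap_coeff_def lookup_fock_scale lookup_cup_vector wl wm cup_coeff_cup[OF len]
          lookup_f_cap(2)[OF assms(1,2) lv] using True by (simp add: quantum_two_def algebra_simps)
    qed (use l in \<open>simp add: lookup_f_cup_vector lookup_cup_vector lookup_fock_scale\<close>)
  qed
qed

lemma f_cup_vector_cap:
  assumes "level s lam j = 1" "level s lam (j + 1) = 1" "pend (word s lam) = 0"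
  shows "f_op s j (cup_vector s lam) = 0 \<or>
    (\<exists>q mu. q \<in> {1, quantum_two} \<and> pend (word s mu) = 0 \<and> f_op s j (cup_vector s lam) = fock_scale q (cup_vector s mu))"
proof -
  let ?k = "length (word_on s lam {..<j})" and ?l = "length (word_on s lam {j + 1<..})"
  let ?L = "shift j (level s lam)"
  have wl: "word s lam = word_on s lam {..<j} @ (j \<in> cbeads s lam (Suc 0)) # (j + 1 \<in> cbeads s lam (Suc 0)) # word_on s lam {j + 1<..}"
    unfolding word_split[of s lam j] word_on_singleton using assms by simp
  have len: "length (word s lam) = ?k + 2 + ?l" unfolding wl by simp
  have lens: "length (word_on s nu {..<j}) = ?k" "length (word_on s nu {j + 1<..}) = ?l"
    if "level s nu = ?L" for nu
  proof -
    have "{k. k < j \<and> level s nu k = 1} = {k. k < j \<and> level s lam k = 1}"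
      "{k. j + 1 < k \<and> level s nu k = 1} = {k. j + 1 < k \<and> level s lam k = 1}"
      unfolding that shift_def by auto
    then show "length (word_on s nu {..<j}) = ?k" "length (word_on s nu {j + 1<..}) = ?l"
      by (simp_all add: word_on_def)
  qed
  obtain q w' where q: "length w' = ?k + ?l"
    "q = 0 \<or> q \<in> {1, quantum_two} \<and> pend w' = 0 \<and> count_list (word s lam) False = Suc (count_list w' False)"
    and cap: "\<And>x y. length x = ?k \<Longrightarrow> length y = ?l \<Longrightarrow> cap_coeff (word s lam) x y = q * cup_coeff w' (x @ y)"
    using cap_cup[OF assms(3) len] by blast
  have lookup: "coeff_of (f_op s j (cup_vector s lam)) nu =
    (if level s nu = ?L then q * cup_coeff w' (word s nu) else 0)" for nu
    using lookup_f_cap[OF assms(1,2)] cap[OF lens, of nu nu] by (simp add: lookup_f_cup_vector)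
  show ?thesis
  proof (cases "q = 0")
    case True
    then show ?thesis using lookup by (intro disjI1 poly_mapping_eqI) simp
  next
    case False
    obtain x y where xy: "w' = x @ y" "length x = ?k" "length y = ?l"
      using q(1) by (rule split_list_length)
    \<comment> \<open>\<open>cap_cup\<close> provides only the word \<open>w'\<close>. Inserting
      \<open>False\<close>, \<open>True\<close> at the two sites gives a word with as many
      \<open>False\<close> as that of \<open>lam\<close>, so it can be realized on the levels of
      \<open>lam\<close>; moving its bead of the first component from \<open>j\<close> to
      \<open>j + 1\<close> then leaves \<open>w'\<close>.\<close>
    obtain lam1 where lam1: "level s lam1 = level s lam" "word s lam1 = x @ False # True # y"
      by (rule realize_word[of "x @ False # True # y" s lam]) (use len xy q(2) False in auto)
    have lens1: "length (word_on s lam1 {..<j}) = ?k" using length_word_on[OF lam1(1)] .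
    have "word s lam1 = word_on s lam1 {..<j} @ (j \<in> cbeads s lam1 (Suc 0)) # (j + 1 \<in> cbeads s lam1 (Suc 0)) # word_on s lam1 {j + 1<..}"
      unfolding word_split[of s lam1 j] word_on_singleton using assms lam1(1) by simp
    then have w1: "word_on s lam1 {..<j} = x" "j \<notin> cbeads s lam1 (Suc 0)" "j + 1 \<in> cbeads s lam1 (Suc 0)"
      "word_on s lam1 {j + 1<..} = y" using lam1(2) lens1 xy(2) by auto
    have "j \<in> cbeads s lam1 0" "j + 1 \<notin> cbeads s lam1 0"
      using w1 assms(1,2) unfolding lam1(1)[symmetric] by (auto simp: level_simps)
    then obtain mu where mu: "raises s j 0 lam1 mu" using raises_ex[of 0 j s lam1] by blast
    have lm: "level s mu = ?L" using raises_level(1)[OF mu] lam1(1) by simp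
    have wm: "word s mu = w'"
      using lookup_f_cap(2)[OF assms(1,2) lm] raises_word_on[OF mu] w1 xy(1) by auto
    have "f_op s j (cup_vector s lam) = fock_scale q (cup_vector s mu)"
      by (rule poly_mapping_eqI) (simp add: lookup lookup_fock_scale lookup_cup_vector lm wm)
    then show ?thesis using q(2) False wm by blast
  qed
qed

lemma f_cup_vector:
  assumes "pend (word s lam) = 0"
  shows "f_op s j (cup_vector s lam) = 0 \<or>
    (\<exists>q mu. q \<in> {1, quantum_two} \<and> pend (word s mu) = 0 \<and> f_op s j (cup_vector s lam) = fock_scale q (cup_vector s mu))"
proof -
  have one: "\<exists>q mu. q \<in> {1, quantum_two} \<and> pend (word s mu) = 0 \<and> f_op s j (cup_vector s lam) = fock_scale q (cup_vector s mu)"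
    if "f_op s j (cup_vector s lam) = cup_vector s mu" "pend (word s mu) = 0" for mu
    using that by (intro exI[of _ 1] exI[of _ mu]) simp
  have "level s lam j \<in> {0, 1, 2}" "level s lam (j + 1) \<in> {0, 1, 2}" by (auto simp: level_def)
  then consider "level s lam j = 0 \<or> level s lam (j + 1) = 2"
    | "level s lam j = 1 \<and> level s lam (j + 1) = 0 \<or> level s lam j = 2 \<and> level s lam (j + 1) = 1"
    | "level s lam j = 2" "level s lam (j + 1) = 0"
    | "level s lam j = 1" "level s lam (j + 1) = 1" by auto
  then show ?thesis
  proof cases
    case 1
    then show ?thesis using f_cup_vector_0 by blast
  next
    case 2
    then have "\<exists>c \<in> {0, 1}. j \<in> cbeads s lam c \<and> j + 1 \<notin> cbeads s lam c"
      by (auto simp: level_simps)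
    then obtain c mu where "raises s j c lam mu" using raises_ex by metis
    then show ?thesis using f_cup_vector_single[OF 2] assms one by metis
  next
    case 3
    then obtain mu where "raises s j 0 lam mu" using raises_ex[of 0 j s lam] by (auto simp: level_simps)
    from f_cup_vector_cup[OF 3 this] show ?thesis using assms one pend_cup by metis
  next
    case 4
    then show ?thesis using f_cup_vector_cap assms by blast
  qed
qed

section \<open>A basis of the irreducible submodule\<close>

lemma eval_at_inverse_v_1 [simp]: "eval_at_inverse_v 1 = 1"
  using eval_at_inverse_v_pCons[of 1 0] by (simp add: one_pCons[symmetric])

lemma bar_scalar_to_fract: "bar_scalar (to_fract p) = eval_at_inverse_v p"
  using bar_scalar_Fract[of 1 p] by (simp add: to_fract_def)

lemma bar_scalar_add: "bar_scalar (x + y) = bar_scalar x + bar_scalar y"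
proof -
  obtain a b c d where "x = Fract a b" "b \<noteq> 0" "y = Fract c d" "d \<noteq> 0"
    by (metis Fract_cases)
  then show ?thesis
    by (simp add: bar_scalar_Fract eval_at_inverse_v_add eval_at_inverse_v_mult eval_at_inverse_v_nonzero divide_simps)
qed

lemma bar_scalar_mult: "bar_scalar (x * y) = bar_scalar x * bar_scalar y"
proof -
  obtain a b c d where "x = Fract a b" "b \<noteq> 0" "y = Fract c d" "d \<noteq> 0"
    by (metis Fract_cases)
  then show ?thesis
    by (simp add: bar_scalar_Fract eval_at_inverse_v_mult)
qed

lemma bar_scalar_0 [simp]: "bar_scalar 0 = 0"
  using bar_scalar_to_fract[of 0] by simp

lemma bar_scalar_1 [simp]: "bar_scalar 1 = 1"
  using bar_scalar_to_fract[of 1] by simp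

lemma bar_scalar_v: "bar_scalar v_param = inverse v_param"
  unfolding v_param_def bar_scalar_to_fract
  using eval_at_inverse_v_pCons[of 0 "[:1:]"] by (simp add: one_pCons[symmetric] v_param_def)

text \<open>The symmetry behind \<open>cup_bar_f_op\<close>: an operator maps a cup vector to a cup
  vector times 0, 1 or this scalar.\<close>

lemma bar_scalar_quantum_two: "bar_scalar quantum_two = quantum_two"
proof -
  have "bar_scalar v_param * bar_scalar (inverse v_param) = 1"
    using v_param_nonzero by (simp flip: bar_scalar_mult)
  then have "bar_scalar (inverse v_param) = v_param"
    using v_param_nonzero unfolding bar_scalar_v by (simp add: field_simps)
  then show ?thesis unfolding quantum_two_def bar_scalar_add bar_scalar_v by simp
qed

lemma quantum_two_nonzero: "quantum_two \<noteq> 0"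
proof -
  have "v_param * quantum_two = to_fract [:1, 0, 1:]"
  proof -
    have "v_param * quantum_two = v_param * v_param + 1" using v_param_nonzero by (simp add: quantum_two_def algebra_simps)
    also have "\<dots> = to_fract ([:0, 1:] * [:0, 1:] + 1)"
      unfolding v_param_def by (simp only: to_fract_add to_fract_mult to_fract_1)
    also have "[:0, 1:] * [:0, 1:] + 1 = ([:1, 0, 1:] :: complex poly)" by (simp add: one_pCons)
    finally show ?thesis .
  qed
  moreover have "[:1, 0, 1:] \<noteq> (0 :: complex poly)" by simp
  ultimately show ?thesis by (metis mult_zero_right to_fract_eq_0_iff)
qed

lemma of_int_polynomial_0 [simp]: "of_int_polynomial 0 = 0"
  by (simp add: of_int_polynomial_def)

lemma of_int_polynomial_1 [simp]: "of_int_polynomial 1 = 1"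
  by (simp add: of_int_polynomial_def)

lemma of_int_polynomial_diff: "of_int_polynomial (p - q) = of_int_polynomial p - of_int_polynomial q"
proof -
  have "map_poly (of_int :: int \<Rightarrow> complex) (p - q) = map_poly of_int p - map_poly of_int q"
    by (rule poly_eqI) (simp add: coeff_map_poly)
  then show ?thesis by (simp add: of_int_polynomial_def to_fract_diff)
qed

lemma of_int_polynomial_mult: "of_int_polynomial (p * q) = of_int_polynomial p * of_int_polynomial q"
proof -
  have "map_poly (of_int :: int \<Rightarrow> complex) (p * q) = map_poly of_int p * map_poly of_int q"
    by (rule poly_eqI) (simp add: coeff_map_poly coeff_mult)
  then show ?thesis by (simp add: of_int_polynomial_def to_fract_mult)
qed

lemma of_int_polynomial_inj: "of_int_polynomial p = of_int_polynomial q \<Longrightarrow> p = q"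
proof (rule poly_eqI)
  fix k assume "of_int_polynomial p = of_int_polynomial q"
  then have "map_poly (of_int :: int \<Rightarrow> complex) p = map_poly of_int q"
    by (simp add: of_int_polynomial_def)
  then have "coeff (map_poly (of_int :: int \<Rightarrow> complex) p) k = coeff (map_poly of_int q) k" by simp
  then show "coeff p k = coeff q k" by (simp add: coeff_map_poly)
qed

lemma of_int_polynomial_monom: "of_int_polynomial (monom 1 k) = v_param ^ k"
proof (induction k)
  case 0
  then show ?case by (simp flip: one_pCons monom_0)
next
  case (Suc k)
  have "monom 1 (Suc k) = [:0, 1:] * monom (1 :: int) k" by (simp add: monom_Suc)
  moreover have "of_int_polynomial [:0, 1:] = v_param"
    by (simp add: of_int_polynomial_def v_param_def map_poly_pCons)
  ultimately show ?case using Suc by (simp only: of_int_polynomial_mult power_Suc)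
qed

text \<open>For a polynomial \<open>P\<close> in \<open>v\<close>, multiplying its bar image by a
  suitable \<open>v^k\<close> gives a polynomial of degree at most \<open>k\<close>. If
  \<open>P\<close> is invariant this product is \<open>P v^k\<close>, so \<open>P\<close> is
  constant, and its constant term is 0.\<close>

lemma bar_invariant_multiple_of_v:
  assumes "bar_scalar (of_int_polynomial ([:0, 1:] * p)) = of_int_polynomial ([:0, 1:] * p)"
  shows "of_int_polynomial ([:0, 1:] * p) = 0"
proof -
  define P where "P = map_poly (of_int :: int \<Rightarrow> complex) ([:0, 1:] * p)"
  have fP: "of_int_polynomial ([:0, 1:] * p) = to_fract P" by (simp add: of_int_polynomial_def P_def)
  obtain q k where q: "eval_at_inverse_v P * v_param ^ k = to_fract q" "degree q \<le> k"
    using eval_at_inverse_v_reflect by blast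
  have "to_fract P * v_param ^ k = to_fract q"
    using assms q(1) unfolding fP bar_scalar_to_fract by simp
  moreover have "v_param ^ k = to_fract (monom 1 k)" for k
  proof (induction k)
    case (Suc k)
    have "monom 1 (Suc k) = [:0, 1:] * monom (1 :: complex) k" by (simp add: monom_Suc)
    then show ?case using Suc by (simp only: power_Suc v_param_def to_fract_mult)
  qed (simp flip: one_pCons monom_0)
  ultimately have "to_fract (P * monom 1 k) = to_fract q" by (simp only: to_fract_mult)
  then have eq: "P * monom 1 k = q" by (simp only: to_fract_eq_iff)
  have "P = 0"
  proof (rule ccontr)
    assume "P \<noteq> 0"
    have "coeff P 0 = 0" by (simp add: P_def coeff_map_poly)
    have "degree P \<noteq> 0"
    proof
      assume "degree P = 0"
      then have "P = [:coeff P 0:]" by (metis degree_0_id)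
      then show False using \<open>coeff P 0 = 0\<close> \<open>P \<noteq> 0\<close> by simp
    qed
    moreover have "degree (P * monom 1 k) = degree P + k"
      using \<open>P \<noteq> 0\<close> by (simp add: degree_mult_eq degree_monom_eq)
    ultimately show False using eq q(2) by simp
  qed
  then show ?thesis unfolding fP by simp
qed

lemma cup_coeff_self: "pend w = 0 \<Longrightarrow> cup_coeff w w = 1"
  using cup_deg_0[of w "[]" w] by (simp add: cup_coeff_def)

lemma lookup_cup_vector_self: "pend (word s lam) = 0 \<Longrightarrow> coeff_of (cup_vector s lam) lam = 1"
  by (simp add: lookup_cup_vector cup_coeff_self)

lemma lookup_cup_vector_other:
  assumes "pend (word s lam) = 0" "nu \<noteq> lam" "coeff_of (cup_vector s lam) nu \<noteq> 0"
  shows "\<exists>k. coeff_of (cup_vector s lam) nu = v_param ^ Suc k" "weight (word s nu) < weight (word s lam)"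
proof -
  have lev: "level s nu = level s lam" and c: "cup_coeff (word s lam) (word s nu) \<noteq> 0"
    using assms(3) by (auto simp: lookup_cup_vector split: if_splits)
  have ne: "word s nu \<noteq> word s lam" using lev level_word_inj assms(2) by blast
  obtain k where k: "cup_deg [] (word s lam) (word s nu) = Some k"
    using c by (auto simp: cup_coeff_def split: option.splits)
  show "weight (word s nu) < weight (word s lam)"
    by (rule cup_deg_weight_less[OF k]) (use ne in auto)
  have "k \<noteq> 0" using cup_deg_0[of "word s lam" "[]" "word s nu"] k ne assms(1) by auto
  then obtain k' where "k = Suc k'" by (cases k) auto
  then show "\<exists>k. coeff_of (cup_vector s lam) nu = v_param ^ Suc k"
    using lev k by (auto simp: lookup_cup_vector cup_coeff_def)
qed

section \<open>Independence and generation\<close>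

definition standard :: "charge \<Rightarrow> bipartition set" where
  "standard s = {lam. pend (word s lam) = 0}"

text \<open>Take \<open>mu\<close> of largest weight in \<open>F\<close>. In the cup vector of any
  other label from \<open>F\<close>, every term apart from the label weighs less than the label, so
  \<open>mu\<close> does not occur there.\<close>

lemma combination_leading_coeff:
  assumes "finite F" "F \<noteq> {}" "F \<subseteq> standard s"
  shows "\<exists>mu \<in> F. coeff_of (\<Sum>nu\<in>F. fock_scale (a nu) (cup_vector s nu)) mu = a mu"
proof -
  obtain mu where mu: "mu \<in> F" "\<And>nu. nu \<in> F \<Longrightarrow> weight (word s nu) \<le> weight (word s mu)"
  proof -
    have "Max ((\<lambda>nu. weight (word s nu)) ` F) \<in> (\<lambda>nu. weight (word s nu)) ` F"
      using assms by (intro Max_in) auto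
    then obtain mu where "mu \<in> F" "weight (word s mu) = Max ((\<lambda>nu. weight (word s nu)) ` F)" by auto
    then show ?thesis using that[of mu] assms(1) by simp
  qed
  have "coeff_of (\<Sum>nu\<in>F. fock_scale (a nu) (cup_vector s nu)) mu = (\<Sum>nu\<in>F. a nu * coeff_of (cup_vector s nu) mu)"
    by (simp add: lookup_sum lookup_fock_scale)
  also have "\<dots> = (\<Sum>nu\<in>F. if nu = mu then a nu else 0)"
  proof (rule sum.cong[OF refl])
    fix nu assume nu: "nu \<in> F"
    have "pend (word s nu) = 0" using nu assms(3) by (auto simp: standard_def)
    then have "coeff_of (cup_vector s nu) mu = (if nu = mu then 1 else 0)"
      using lookup_cup_vector_other(2)[of s nu mu] lookup_cup_vector_self[of s nu] mu(2)[OF nu] by (cases "nu = mu") force+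
    then show "a nu * coeff_of (cup_vector s nu) mu = (if nu = mu then a nu else 0)" by simp
  qed
  also have "\<dots> = a mu" using mu(1) assms(1) by simp
  finally show ?thesis using mu(1) by blast
qed

lemma cup_vector_inj: "inj_on (cup_vector s) (standard s)"
proof (rule inj_onI, rule ccontr)
  fix mu nu assume *: "mu \<in> standard s" "nu \<in> standard s" "cup_vector s mu = cup_vector s nu" "mu \<noteq> nu"
  then have p: "pend (word s mu) = 0" "pend (word s nu) = 0" by (auto simp: standard_def)
  have "coeff_of (cup_vector s mu) nu \<noteq> 0" "coeff_of (cup_vector s nu) mu \<noteq> 0"
    using lookup_cup_vector_self[OF p(1)] lookup_cup_vector_self[OF p(2)] *(3) by auto
  then show False using lookup_cup_vector_other(2)[OF p(1)] lookup_cup_vector_other(2)[OF p(2)] *(4)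
    by (metis less_asym)
qed

lemma independent_cup_vectors: "fock.independent (cup_vector s ` standard s)"
proof
  assume "fock.dependent (cup_vector s ` standard s)"
  then obtain t u where t: "finite t" "t \<subseteq> cup_vector s ` standard s" "(\<Sum>v\<in>t. fock_scale (u v) v) = 0"
    and ex: "\<exists>v\<in>t. u v \<noteq> 0" unfolding fock.dependent_explicit by blast
  define F where "F = {mu \<in> standard s. cup_vector s mu \<in> t \<and> u (cup_vector s mu) \<noteq> 0}"
  have inj: "inj_on (cup_vector s) F" using cup_vector_inj by (rule inj_on_subset) (auto simp: F_def)
  have img: "cup_vector s ` F = {v \<in> t. u v \<noteq> 0}" using t(2) by (auto simp: F_def)
  have "finite (cup_vector s ` F)" unfolding img using t(1) by simp
  then have fin: "finite F" using inj by (rule finite_imageD)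
  have ne: "F \<noteq> {}" using img ex by auto
  have "(\<Sum>mu\<in>F. fock_scale (u (cup_vector s mu)) (cup_vector s mu)) = (\<Sum>v\<in>cup_vector s ` F. fock_scale (u v) v)"
    by (simp add: sum.reindex[OF inj])
  also have "\<dots> = (\<Sum>v\<in>t. fock_scale (u v) v)"
    unfolding img by (rule sum.mono_neutral_left) (use t(1) in auto)
  finally have "(\<Sum>mu\<in>F. fock_scale (u (cup_vector s mu)) (cup_vector s mu)) = 0" using t(3) by simp
  then obtain mu where "mu \<in> F" "u (cup_vector s mu) = 0"
    using combination_leading_coeff[OF fin ne, of s "\<lambda>mu. u (cup_vector s mu)"] by (auto simp: F_def)
  then show False by (simp add: F_def)
qed

lemma cbeads_empty: "cbeads s empty_bipartition 0 = {..fst s}" "cbeads s empty_bipartition (Suc 0) = {..snd s}"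
  by (simp_all add: cbeads_def component_def empty_bipartition_def beads_def Abs_partition_inverse)

lemma f_op_0 [simp]: "f_op s j 0 = 0"
  by (simp add: f_op_def)

lemma word_empty:
  assumes "fst s \<le> snd s"
  shows "word s empty_bipartition = replicate (length (word s empty_bipartition)) True"
proof -
  have "True = b" if "b \<in> set (word s empty_bipartition)" for b
    using that assms finite_level_1[of s empty_bipartition]
    by (auto simp: word_on_def level_simps cbeads_empty)
  then show ?thesis by (metis replicate_eqI)
qed

lemma pend_replicate_True: "pend (replicate n True) = 0"
  by (induction n) auto

lemma cup_vector_empty:
  assumes "fst s \<le> snd s"
  shows "cup_vector s empty_bipartition = basis_vector empty_bipartition"
    "empty_bipartition \<in> standard s"
proof -
  have p: "pend (word s empty_bipartition) = 0"
    by (subst word_empty[OF assms]) (rule pend_replicate_True)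
  then show "empty_bipartition \<in> standard s" by (simp add: standard_def)
  show "cup_vector s empty_bipartition = basis_vector empty_bipartition"
  proof (rule poly_mapping_eqI)
    fix nu
    show "coeff_of (cup_vector s empty_bipartition) nu = coeff_of (basis_vector empty_bipartition) nu"
    proof (cases "nu = empty_bipartition")
      case True
      then show ?thesis using lookup_cup_vector_self[OF p] by simp
    next
      case False
      have "coeff_of (cup_vector s empty_bipartition) nu = 0"
      proof (rule ccontr)
        assume nz: "coeff_of (cup_vector s empty_bipartition) nu \<noteq> 0"
        then have lev: "level s nu = level s empty_bipartition" and c: "cup_coeff (word s empty_bipartition) (word s nu) \<noteq> 0"
          by (auto simp: lookup_cup_vector split: if_splits)
        have "False \<notin> set (word s nu)" using c cup_coeff_all_True[OF word_empty[OF assms]] by blast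
        then have "word s nu = replicate (length (word s nu)) True"
          by (intro replicate_eqI) (auto, metis (full_types))
        also have "length (word s nu) = length (word s empty_bipartition)" using length_word_on[OF lev] .
        finally have "word s nu = word s empty_bipartition" using word_empty[OF assms] by simp
        then show False using level_word_inj lev False by blast
      qed
      then show ?thesis using False by (simp add: lookup_single)
    qed
  qed
qed

lemma keys_f_op:
  assumes "Poly_Mapping.keys x \<subseteq> bipartitions n"
  shows "Poly_Mapping.keys (f_op s j x) \<subseteq> bipartitions (Suc n)"
proof
  fix nu assume "nu \<in> Poly_Mapping.keys (f_op s j x)"
  then have "coeff_of (f_op s j x) nu \<noteq> 0" by (simp add: in_keys_iff)
  then obtain c where c: "c \<in> {0, 1}" "j \<notin> cbeads s nu c" "j + 1 \<in> cbeads s nu c"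
    "coeff_of x (lowered s j c nu) \<noteq> 0"
    unfolding lookup_f_op by (elim sum.not_neutral_contains_not_neutral) (auto split: if_splits)
  then have "lowered s j c nu \<in> bipartitions n" using assms by (auto simp: in_keys_iff)
  then show "nu \<in> bipartitions (Suc n)"
    using raises_rank[OF raises_lowered[OF c(1-3)]] by (simp add: bipartitions_def)
qed

lemma keys_fock_scale: "Poly_Mapping.keys (fock_scale r x) \<subseteq> Poly_Mapping.keys x"
  by (auto simp: in_keys_iff lookup_fock_scale)

lemma maya_down_closed:
  assumes "maya t S" "\<And>k. k + 1 \<in> S \<Longrightarrow> k \<in> S"
  shows "S = {..t}"
proof -
  obtain m where m: "{..m} \<subseteq> S" "finite (S \<inter> {m<..})" "int (card (S \<inter> {m<..})) = t - m"
    using assms(1) unfolding maya_def by blast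
  have down: "u \<in> S" if "v \<in> S" "u \<le> v" for u v
    using that(2) that(1) by (induction rule: int_le_induct) (use assms(2) in \<open>metis diff_add_cancel\<close>)+
  show ?thesis
  proof (cases "S \<inter> {m<..} = {}")
    case True
    then have "S = {..m}" using m(1) by (auto simp: disjoint_iff)
    then show ?thesis using m(3) True by simp
  next
    case False
    define M where "M = Max (S \<inter> {m<..})"
    have M: "M \<in> S" "m < M" using Max_in[OF m(2) False] by (auto simp: M_def)
    have "u \<le> M" if "u \<in> S" for u
      using Max_ge[OF m(2), of u] that M(2) unfolding M_def[symmetric] by (cases "m < u") auto
    then have S: "S = {..M}" using down[OF M(1)] by auto
    have "S \<inter> {m<..} = {m<..M}" unfolding S by auto
    then show ?thesis using m(3) M(2) S by simp
  qed
qed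

lemma pend_False_pos: "set x \<subseteq> {False} \<Longrightarrow> 0 < pend (x @ False # y)"
  by (induction x) auto

text \<open>
  The sites \<open>j\<close> found here are those at which \<open>\<lambda>\<close> is, up to a scalar, an \<open>f\<^sub>j\<close>-image of a smaller cup vector.
\<close>

lemma std_descent:
  assumes "lam \<in> standard s" "lam \<noteq> empty_bipartition"
  shows "\<exists>j. level s lam j < level s lam (j + 1) \<or>
    (j \<notin> cbeads s lam 0 \<and> j \<in> cbeads s lam (Suc 0) \<and> j + 1 \<in> cbeads s lam 0 \<and> j + 1 \<notin> cbeads s lam (Suc 0))"
proof (rule ccontr)
  assume "\<not> ?thesis"
  then have mono: "level s lam (j + 1) \<le> level s lam j" and
    nocup: "\<not> (j \<notin> cbeads s lam 0 \<and> j \<in> cbeads s lam (Suc 0) \<and> j + 1 \<in> cbeads s lam 0 \<and> j + 1 \<notin> cbeads s lam (Suc 0))" for j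
    by (auto simp: not_less)
  \<comment> \<open>Were the bead on \<open>k\<close> missing, decreasing levels would leave exactly
    the excluded pattern \<open>True\<close>, \<open>False\<close> on \<open>k\<close>,
    \<open>k + 1\<close>.\<close>
  have X: "k \<in> cbeads s lam 0" if "k + 1 \<in> cbeads s lam 0" for k
    using that mono[of k] nocup[of k] unfolding level_def by (auto simp: of_bool_def split: if_splits)
  have X_eq: "cbeads s lam 0 = {..fst s}" using maya_down_closed[OF maya_cbeads(1) X] .
  have Y: "k \<in> cbeads s lam (Suc 0)" if k1: "k + 1 \<in> cbeads s lam (Suc 0)" for k
  proof (rule ccontr)
    assume k: "k \<notin> cbeads s lam (Suc 0)"
    then have kX: "k \<in> cbeads s lam 0"
      using k1 mono[of k] unfolding level_def by (auto simp: of_bool_def split: if_splits)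
    have "word_on s lam {k} = [False]" using k kX by (simp add: word_on_singleton level_def)
    \<comment> \<open>All sites left of \<open>k\<close> carry a bead of the first component, so
      those of level 1 have the letter \<open>False\<close>. This leaves the \<open>False\<close> on
      \<open>k\<close> without a partner.\<close>
    moreover have "set (word_on s lam {..<k}) \<subseteq> {False}"
    proof -
      have fin: "finite {i \<in> {..<k}. level s lam i = 1}"
        using finite_level_1[of s lam] by (rule finite_subset[rotated]) auto
      have "i \<notin> cbeads s lam (Suc 0)" if "i < k" "level s lam i = 1" for i
        using that kX unfolding X_eq level_simps One_nat_def by auto
      then show ?thesis unfolding word_on_def using fin by auto
    qed
    ultimately have "0 < pend (word s lam)" using pend_False_pos word_split[of s lam k] by simp
    then show False using assms(1) by (simp add: standard_def)
  qed
  have Y_eq: "cbeads s lam (Suc 0) = {..snd s}" using maya_down_closed[OF maya_cbeads(2) Y] .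
  have "lam = empty_bipartition" by (rule bipartition_eqI[of s]) (simp_all add: X_eq Y_eq cbeads_empty)
  then show False using assms(2) by simp
qed

lemma irr_module_f_op: "x \<in> irr_module s \<Longrightarrow> f_op s j x \<in> irr_module s"
  unfolding irr_module_def
proof (induction rule: fock.span_induct_alt)
  case base
  then show ?case by (simp add: fock.span_zero)
next
  case (step c x y)
  then obtain is' where x: "x = foldr (f_op s) is' (basis_vector empty_bipartition)" by blast
  have "f_op s j x \<in> fock.span {foldr (f_op s) is (basis_vector empty_bipartition) | is. True}"
    by (rule fock.span_base) (auto simp: x intro: exI[of _ "j # is'"])
  then show ?case using step by (auto simp: f_op_add f_op_scale intro: fock.span_add fock.span_scale)
qed

lemma irr_module_scale: "x \<in> irr_module s \<Longrightarrow> fock_scale c x \<in> irr_module s"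
  unfolding irr_module_def by (rule fock.span_scale)

text \<open>Induction on the rank, undoing one operator at a site given by
  \<open>std_descent\<close>. The bound on the support is carried along because each operator raises
  the rank by one.\<close>

lemma cup_vector_generated:
  assumes "fst s \<le> snd s" "lam \<in> standard s"
  shows "cup_vector s lam \<in> irr_module s \<and> Poly_Mapping.keys (cup_vector s lam) \<subseteq> bipartitions (bip_rank lam)"
  using assms(2)
proof (induction "bip_rank lam" arbitrary: lam rule: less_induct)
  case less
  have p: "pend (word s lam) = 0" using less(2) by (simp add: standard_def)
  have step: ?case if "raises s j c mu lam" "mu \<in> standard s" "cup_vector s lam = fock_scale r (f_op s j (cup_vector s mu))" for j c mu r
  proof -
    have rank: "bip_rank lam = Suc (bip_rank mu)" using raises_rank[OF that(1)] .
    then have mu: "cup_vector s mu \<in> irr_module s" "Poly_Mapping.keys (cup_vector s mu) \<subseteq> bipartitions (bip_rank mu)"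
      using less(1)[of mu] that(2) by auto
    show ?thesis unfolding that(3) rank
      using irr_module_scale[OF irr_module_f_op[OF mu(1)]] keys_f_op[OF mu(2)] keys_fock_scale by blast
  qed
  show ?case
  proof (cases "lam = empty_bipartition")
    case True
    have "basis_vector empty_bipartition \<in> irr_module s"
      unfolding irr_module_def by (rule fock.span_base) (auto intro: exI[of _ "[]"])
    then show ?thesis using True cup_vector_empty(1)[OF assms(1)]
      by (simp add: bipartitions_def)
  next
    case False
    obtain j where j: "level s lam j < level s lam (j + 1) \<or>
      (j \<notin> cbeads s lam 0 \<and> j \<in> cbeads s lam (Suc 0) \<and> j + 1 \<in> cbeads s lam 0 \<and> j + 1 \<notin> cbeads s lam (Suc 0))"
      using std_descent[OF less(2) False] by blast
    have "level s lam j \<in> {0, 1, 2}" "level s lam (j + 1) \<in> {0, 1, 2}" by (auto simp: level_def)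
    then consider "level s lam j = 0 \<and> level s lam (j + 1) = 1 \<or> level s lam j = 1 \<and> level s lam (j + 1) = 2"
      | "level s lam j = 0" "level s lam (j + 1) = 2"
      | "j \<notin> cbeads s lam 0" "j \<in> cbeads s lam (Suc 0)" "j + 1 \<in> cbeads s lam 0" "j + 1 \<notin> cbeads s lam (Suc 0)"
      using j by auto
    then show ?thesis
    proof cases
      case 1
      then have "\<exists>c \<in> {0, 1}. j \<notin> cbeads s lam c \<and> j + 1 \<in> cbeads s lam c"
        by (auto simp: level_simps)
      then obtain c where "c \<in> {0, 1}" "j \<notin> cbeads s lam c" "j + 1 \<in> cbeads s lam c" by blast
      then obtain mu where mu: "raises s j c mu lam" using raises_ex' by metis
      note l = raises_level[OF mu]
      have "level s lam j = level s mu j - 1" "level s lam (j + 1) = Suc (level s mu (j + 1))"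
        unfolding l(1) shift_def by auto
      then have "level s mu j = 1 \<and> level s mu (j + 1) = 0 \<or> level s mu j = 2 \<and> level s mu (j + 1) = 1"
        using 1 l(2,3) by auto
      from f_cup_vector_single[OF this mu] show ?thesis
        using step[OF mu, of 1] p by (simp add: standard_def)
    next
      case 2
      then have m: "j \<notin> cbeads s lam 0" "j \<notin> cbeads s lam (Suc 0)" "j + 1 \<in> cbeads s lam 0" "j + 1 \<in> cbeads s lam (Suc 0)"
        by (auto simp: level_simps)
      \<comment> \<open>Pulling back the bead of the second component leaves a cup on
        \<open>j\<close>, \<open>j + 1\<close>. The operator closes it to a loop, whose nonzero
        value is divided out.\<close>
      then obtain mu where mu: "raises s j (Suc 0) mu lam" using raises_ex'[of "Suc 0" j s lam] by auto
      have "level s mu j = 1" "level s mu (j + 1) = 1"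
        using mu m unfolding raises_def by (auto simp: level_simps)
      from f_cup_vector_cap_adjacent[OF this mu]
      have "f_op s j (cup_vector s mu) = fock_scale quantum_two (cup_vector s lam)" "mu \<in> standard s"
        using p pend_cup by (auto simp: standard_def)
      then show ?thesis using step[OF mu, of "inverse quantum_two"] quantum_two_nonzero by simp
    next
      case 3
      then obtain mu where mu: "raises s j 0 mu lam" using raises_ex'[of 0 j s lam] by auto
      have "level s mu j = 2" "level s mu (j + 1) = 0"
        using mu 3 unfolding raises_def by (auto simp: level_def)
      from f_cup_vector_cup[OF this mu] have "f_op s j (cup_vector s mu) = cup_vector s lam" "mu \<in> standard s"
        using p pend_cup by (auto simp: standard_def)
      then show ?thesis using step[OF mu, of 1] by simp
    qed
  qed
qed

lemma span_cup_vectors_f_op: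
  "x \<in> fock.span (cup_vector s ` standard s) \<Longrightarrow> f_op s j x \<in> fock.span (cup_vector s ` standard s)"
proof (induction rule: fock.span_induct_alt)
  case base
  then show ?case by (simp add: fock.span_zero)
next
  case (step c x y)
  then obtain lam where lam: "lam \<in> standard s" "x = cup_vector s lam" by blast
  have "f_op s j x \<in> fock.span (cup_vector s ` standard s)"
  proof -
    have "pend (word s lam) = 0" using lam(1) by (simp add: standard_def)
    from f_cup_vector[OF this, of j] show ?thesis
    proof (elim disjE exE conjE)
      fix q mu assume "pend (word s mu) = 0" and f: "f_op s j (cup_vector s lam) = fock_scale q (cup_vector s mu)"
      then have "cup_vector s mu \<in> fock.span (cup_vector s ` standard s)"
        by (intro fock.span_base imageI) (simp add: standard_def)
      then show ?thesis unfolding lam(2) f by (rule fock.span_scale)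
    qed (simp add: lam(2) fock.span_zero)
  qed
  then show ?case using step by (auto simp: f_op_add f_op_scale intro: fock.span_add fock.span_scale)
qed

lemma irr_module_eq_span:
  assumes "fst s \<le> snd s"
  shows "irr_module s = fock.span (cup_vector s ` standard s)"
proof
  have "foldr (f_op s) is (basis_vector empty_bipartition) \<in> fock.span (cup_vector s ` standard s)" for "is"
  proof (induction "is")
    case Nil
    then show ?case using cup_vector_empty[OF assms] by (auto intro!: fock.span_base simp flip: cup_vector_empty(1)[OF assms])
  next
    case (Cons j "is")
    then show ?case by (simp add: span_cup_vectors_f_op)
  qed
  then show "irr_module s \<subseteq> fock.span (cup_vector s ` standard s)"
    unfolding irr_module_def by (intro fock.span_minimal fock.subspace_span) auto
  show "fock.span (cup_vector s ` standard s) \<subseteq> irr_module s"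
    using cup_vector_generated[OF assms] unfolding irr_module_def
    by (intro fock.span_minimal fock.subspace_span) auto
qed

section \<open>Bar involution and canonical basis\<close>

text \<open>The semilinear map fixing the cup vectors. Outside their span
  \<open>fock.representation\<close> is 0 everywhere, and so is this map.\<close>

definition cup_bar :: "charge \<Rightarrow> fock \<Rightarrow> fock" where
  "cup_bar s x = (\<Sum>b | fock.representation (cup_vector s ` standard s) x b \<noteq> 0.
     fock_scale (bar_scalar (fock.representation (cup_vector s ` standard s) x b)) b)"

lemma cup_bar_superset:
  assumes "finite S" "{b. fock.representation (cup_vector s ` standard s) x b \<noteq> 0} \<subseteq> S"
  shows "cup_bar s x = (\<Sum>b\<in>S. fock_scale (bar_scalar (fock.representation (cup_vector s ` standard s) x b)) b)"
  unfolding cup_bar_def using assms by (intro sum.mono_neutral_left) auto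

lemma cup_bar_add:
  assumes "x \<in> fock.span (cup_vector s ` standard s)" "y \<in> fock.span (cup_vector s ` standard s)"
  shows "cup_bar s (x + y) = cup_bar s x + cup_bar s y"
proof -
  let ?R = "fock.representation (cup_vector s ` standard s)"
  let ?S = "{b. ?R x b \<noteq> 0} \<union> {b. ?R y b \<noteq> 0}"
  have fin: "finite ?S" using fock.finite_representation by auto
  have R: "?R (x + y) = (\<lambda>b. ?R x b + ?R y b)"
    using fock.representation_add[OF independent_cup_vectors assms(2,1)] .
  have "cup_bar s (x + y) = (\<Sum>b\<in>?S. fock_scale (bar_scalar (?R (x + y) b)) b)"
    by (intro cup_bar_superset fin) (auto simp: R)
  also have "\<dots> = (\<Sum>b\<in>?S. fock_scale (bar_scalar (?R x b)) b) + (\<Sum>b\<in>?S. fock_scale (bar_scalar (?R y b)) b)"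
    by (simp add: R bar_scalar_add fock.scale_left_distrib sum.distrib)
  also have "\<dots> = cup_bar s x + cup_bar s y"
    using cup_bar_superset[OF fin, of s x] cup_bar_superset[OF fin, of s y] by auto
  finally show ?thesis .
qed

lemma cup_bar_scale:
  assumes "x \<in> fock.span (cup_vector s ` standard s)"
  shows "cup_bar s (fock_scale c x) = fock_scale (bar_scalar c) (cup_bar s x)"
proof -
  let ?R = "fock.representation (cup_vector s ` standard s)"
  let ?S = "{b. ?R x b \<noteq> 0}"
  have fin: "finite ?S" using fock.finite_representation by auto
  have R: "?R (fock_scale c x) = (\<lambda>b. c * ?R x b)"
    using fock.representation_scale[OF independent_cup_vectors assms] .
  have "cup_bar s (fock_scale c x) = (\<Sum>b\<in>?S. fock_scale (bar_scalar (?R (fock_scale c x) b)) b)"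
    by (intro cup_bar_superset fin) (auto simp: R)
  then show ?thesis by (simp add: R bar_scalar_mult cup_bar_def fock.scale_sum_right)
qed

lemma cup_bar_cup_vector:
  assumes "lam \<in> standard s"
  shows "cup_bar s (cup_vector s lam) = cup_vector s lam"
proof -
  have R: "fock.representation (cup_vector s ` standard s) (cup_vector s lam) = (\<lambda>b. if b = cup_vector s lam then 1 else 0)"
    using fock.representation_basis[OF independent_cup_vectors] assms by auto
  have "cup_bar s (cup_vector s lam) = (\<Sum>b\<in>{cup_vector s lam}. fock_scale (bar_scalar (fock.representation (cup_vector s ` standard s) (cup_vector s lam) b)) b)"
    by (intro cup_bar_superset) (auto simp: R)
  then show ?thesis by (simp add: R)
qed

lemma cup_bar_0: "cup_bar s 0 = 0"
  by (simp add: cup_bar_def fock.representation_zero)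

lemma cup_bar_closed: "cup_bar s x \<in> fock.span (cup_vector s ` standard s)"
  unfolding cup_bar_def
proof (rule fock.span_sum)
  fix b assume "b \<in> {b. fock.representation (cup_vector s ` standard s) x b \<noteq> 0}"
  then have "b \<in> cup_vector s ` standard s" using fock.representation_ne_zero by blast
  then show "fock_scale (bar_scalar (fock.representation (cup_vector s ` standard s) x b)) b \<in> fock.span (cup_vector s ` standard s)"
    by (intro fock.span_scale fock.span_base)
qed

lemma cup_bar_f_op:
  assumes "x \<in> fock.span (cup_vector s ` standard s)"
  shows "cup_bar s (f_op s j x) = f_op s j (cup_bar s x)"
proof -
  have "x \<in> fock.span (cup_vector s ` standard s) \<and> cup_bar s (f_op s j x) = f_op s j (cup_bar s x)"
    using assms
  proof (induction rule: fock.span_induct_alt)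
    case base
    then show ?case by (simp add: cup_bar_0 fock.span_zero)
  next
    case (step c x y)
    then obtain lam where lam: "lam \<in> standard s" "x = cup_vector s lam" by blast
    have x: "x \<in> fock.span (cup_vector s ` standard s)" using step by (intro fock.span_base)
    have y: "y \<in> fock.span (cup_vector s ` standard s)" using step by blast
    have eq: "cup_bar s (f_op s j x) = f_op s j x"
    proof -
      have "pend (word s lam) = 0" using lam(1) by (simp add: standard_def)
      from f_cup_vector[OF this, of j] show ?thesis
      proof (elim disjE exE conjE)
        fix q mu assume *: "q \<in> {1, quantum_two}" "pend (word s mu) = 0" "f_op s j (cup_vector s lam) = fock_scale q (cup_vector s mu)"
        then have mu: "mu \<in> standard s" by (simp add: standard_def)
        have "bar_scalar q = q" using *(1) bar_scalar_quantum_two by auto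
        then show ?thesis unfolding lam(2) *(3)
          by (subst cup_bar_scale) (use mu cup_bar_cup_vector fock.span_base in auto)
      qed (simp add: lam(2) cup_bar_0)
    qed
    have f: "f_op s j x \<in> fock.span (cup_vector s ` standard s)" "f_op s j y \<in> fock.span (cup_vector s ` standard s)"
      using x y span_cup_vectors_f_op by auto
    have "cup_bar s (f_op s j (fock_scale c x + y)) = fock_scale (bar_scalar c) (f_op s j x) + f_op s j (cup_bar s y)"
      using f by (simp add: f_op_add f_op_scale cup_bar_add cup_bar_scale fock.span_scale eq step(2)[THEN conjunct2])
    also have "\<dots> = f_op s j (cup_bar s (fock_scale c x + y))"
      using x y lam by (simp add: f_op_add f_op_scale cup_bar_add cup_bar_scale fock.span_scale cup_bar_cup_vector)
    finally show ?case using x y by (simp add: fock.span_add fock.span_scale)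
  qed
  then show ?thesis by blast
qed

lemma bar_involution_unique:
  assumes "is_bar_involution s B" "is_bar_involution s B'" "x \<in> irr_module s"
  shows "B x = B' x"
proof -
  let ?G = "{foldr (f_op s) is (basis_vector empty_bipartition) | is. True}"
  have gen: "foldr (f_op s) is (basis_vector empty_bipartition) \<in> irr_module s" for "is"
    unfolding irr_module_def by (rule fock.span_base) auto
  have eq: "B (foldr (f_op s) is (basis_vector empty_bipartition)) = B' (foldr (f_op s) is (basis_vector empty_bipartition))" for "is"
    by (induction "is") (use assms(1,2) gen in \<open>simp_all add: is_bar_involution_def\<close>)
  have zero: "C 0 = 0" if "is_bar_involution s C" for C
  proof -
    have "(0 :: fock) \<in> irr_module s" unfolding irr_module_def by (rule fock.span_zero)
    then have "C (0 + 0) = C 0 + C 0" using that unfolding is_bar_involution_def by blast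
    then show ?thesis by simp
  qed
  have "x \<in> fock.span ?G" using assms(3) by (simp add: irr_module_def)
  then have "x \<in> irr_module s \<and> B x = B' x"
  proof (induction rule: fock.span_induct_alt)
    case base
    then show ?case using zero[OF assms(1)] zero[OF assms(2)] by (simp add: irr_module_def fock.span_zero)
  next
    case (step c x y)
    then have x: "x \<in> irr_module s" "B x = B' x" using gen eq by auto
    have y: "y \<in> irr_module s" "B y = B' y" using step by auto
    have "C (fock_scale c x + y) = fock_scale (bar_scalar c) (C x) + C y" if "is_bar_involution s C" for C
      using that x(1) y(1) irr_module_scale[OF x(1)] unfolding is_bar_involution_def by metis
    from this[OF assms(1)] this[OF assms(2)] have "B (fock_scale c x + y) = B' (fock_scale c x + y)"
      using x(2) y(2) by simp
    moreover have "fock_scale c x + y \<in> irr_module s"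
      using irr_module_scale[OF x(1)] y(1) unfolding irr_module_def by (rule fock.span_add)
    ultimately show ?case by blast
  qed
  then show ?thesis by blast
qed

lemma is_bar_involution_cup_bar:
  assumes "fst s \<le> snd s"
  shows "is_bar_involution s (cup_bar s)"
  unfolding is_bar_involution_def irr_module_eq_span[OF assms]
proof (intro conjI ballI allI)
  show "cup_bar s (basis_vector empty_bipartition) = basis_vector empty_bipartition"
    using cup_bar_cup_vector[OF cup_vector_empty(2)[OF assms]] cup_vector_empty(1)[OF assms] by simp
qed (simp_all add: cup_bar_closed cup_bar_add cup_bar_f_op cup_bar_scale)

lemma bar_involution_eq:
  assumes "fst s \<le> snd s" "x \<in> irr_module s"
  shows "bar_involution s x = cup_bar s x"
proof -
  \<comment> \<open>\<open>bar_involution\<close> selects the map that is \<open>undefined\<close>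
    outside the module, so \<open>cup_bar\<close> is modified there.\<close>
  let ?B = "\<lambda>x. if x \<in> irr_module s then cup_bar s x else undefined"
  let ?P = "\<lambda>B. is_bar_involution s B \<and> (\<forall>x. x \<notin> irr_module s \<longrightarrow> B x = undefined)"
  have e: "basis_vector empty_bipartition \<in> irr_module s"
    unfolding irr_module_def by (rule fock.span_base) (auto intro: exI[of _ "[]"])
  have "x + y \<in> irr_module s" if "x \<in> irr_module s" "y \<in> irr_module s" for x y
    using that unfolding irr_module_def by (rule fock.span_add)
  then have "?P ?B"
    using is_bar_involution_cup_bar[OF assms(1)] e irr_module_scale irr_module_f_op
    unfolding is_bar_involution_def by simp
  moreover have "B = ?B" if "?P B" for B
  proof
    fix y
    show "B y = ?B y"
    proof (cases "y \<in> irr_module s")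
      case True
      then show ?thesis using that calculation bar_involution_unique[of s B ?B y] by blast
    qed (use that in simp)
  qed
  ultimately have "bar_involution s = ?B" unfolding bar_involution_def by (rule the_equality)
  then show ?thesis using assms(2) by simp
qed

lemma span_cup_vectors_combination:
  assumes "x \<in> fock.span (cup_vector s ` standard s)"
  obtains F a where "finite F" "F \<subseteq> standard s" "\<And>mu. mu \<in> F \<Longrightarrow> a mu \<noteq> 0"
    "x = (\<Sum>mu\<in>F. fock_scale (a mu) (cup_vector s mu))"
    "cup_bar s x = (\<Sum>mu\<in>F. fock_scale (bar_scalar (a mu)) (cup_vector s mu))"
proof -
  let ?R = "fock.representation (cup_vector s ` standard s) x"
  define F where "F = {mu \<in> standard s. ?R (cup_vector s mu) \<noteq> 0}"
  have inj: "inj_on (cup_vector s) F" using cup_vector_inj by (rule inj_on_subset) (auto simp: F_def)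
  have img: "cup_vector s ` F = {b. ?R b \<noteq> 0}" using fock.representation_ne_zero unfolding F_def by blast
  have fin: "finite F" by (rule finite_imageD[OF _ inj]) (unfold img, rule fock.finite_representation)
  have "x = (\<Sum>b | ?R b \<noteq> 0. fock_scale (?R b) b)"
    using fock.sum_nonzero_representation_eq[OF independent_cup_vectors assms] by simp
  then have x: "x = (\<Sum>mu\<in>F. fock_scale (?R (cup_vector s mu)) (cup_vector s mu))"
    unfolding img[symmetric] by (simp add: sum.reindex[OF inj])
  have bar: "cup_bar s x = (\<Sum>mu\<in>F. fock_scale (bar_scalar (?R (cup_vector s mu))) (cup_vector s mu))"
    unfolding cup_bar_def img[symmetric] by (simp add: sum.reindex[OF inj])
  show ?thesis
  proof (rule that[of F "\<lambda>mu. ?R (cup_vector s mu)"])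
    show "F \<subseteq> standard s" by (auto simp: F_def)
    show "?R (cup_vector s mu) \<noteq> 0" if "mu \<in> F" for mu using that unfolding F_def by blast
  qed (fact fin x bar)+
qed

text \<open>By independence the coefficients in the expansion by cup vectors are themselves
  bar-invariant. The one at a label of largest weight is also a coefficient of \<open>x\<close>,
  hence divisible by \<open>v\<close>, and \<open>bar_invariant_multiple_of_v\<close> makes it
  vanish.\<close>

lemma bar_invariant_small_eq_0:
  assumes "x \<in> fock.span (cup_vector s ` standard s)" "cup_bar s x = x"
    "\<And>nu. \<exists>p. coeff_of x nu = of_int_polynomial ([:0, 1:] * p)"
  shows "x = 0"
proof -
  obtain F a where F: "finite F" "F \<subseteq> standard s" "\<And>mu. mu \<in> F \<Longrightarrow> a mu \<noteq> 0"
    "x = (\<Sum>mu\<in>F. fock_scale (a mu) (cup_vector s mu))"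
    "cup_bar s x = (\<Sum>mu\<in>F. fock_scale (bar_scalar (a mu)) (cup_vector s mu))"
    by (rule span_cup_vectors_combination[OF assms(1)]) blast
  have inv: "bar_scalar (a mu) = a mu" if "mu \<in> F" for mu
  proof (rule ccontr)
    assume ne: "bar_scalar (a mu) \<noteq> a mu"
    define E where "E = {nu \<in> F. bar_scalar (a nu) - a nu \<noteq> 0}"
    have "(\<Sum>nu\<in>E. fock_scale (bar_scalar (a nu) - a nu) (cup_vector s nu)) =
      (\<Sum>nu\<in>F. fock_scale (bar_scalar (a nu) - a nu) (cup_vector s nu))"
      unfolding E_def by (rule sum.mono_neutral_left) (use F(1) in auto)
    also have "\<dots> = cup_bar s x - x" unfolding F(5) by (subst F(4)) (simp add: fock.scale_left_diff_distrib sum_subtractf)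
    finally have "(\<Sum>nu\<in>E. fock_scale (bar_scalar (a nu) - a nu) (cup_vector s nu)) = 0" using assms(2) by simp
    moreover have "mu \<in> E" using that ne by (simp add: E_def)
    then have "E \<noteq> {}" by blast
    moreover have "E \<subseteq> standard s" "finite E" using F(1,2) by (auto simp: E_def)
    ultimately obtain nu where "nu \<in> E" "bar_scalar (a nu) - a nu = 0"
      using combination_leading_coeff[of E s "\<lambda>nu. bar_scalar (a nu) - a nu"] by auto
    then show False by (simp add: E_def)
  qed
  have "F = {}"
  proof (rule ccontr)
    assume "F \<noteq> {}"
    then obtain mu where mu: "mu \<in> F" "coeff_of x mu = a mu"
      using combination_leading_coeff[OF F(1) _ F(2), of a] F(4) by auto
    obtain p where p: "a mu = of_int_polynomial ([:0, 1:] * p)" using assms(3)[of mu] mu(2) by auto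
    then show False using bar_invariant_multiple_of_v[of p] inv[OF mu(1)] F(3)[OF mu(1)] by simp
  qed
  then show ?thesis using F(4) by simp
qed

lemma v_power_Suc_multiple: "\<exists>p. v_param ^ Suc k = of_int_polynomial ([:0, 1:] * p)"
proof -
  have "monom 1 (Suc k) = [:0, 1:] * monom (1 :: int) k" by (simp add: monom_Suc)
  then show ?thesis using of_int_polynomial_monom[of "Suc k"] by metis
qed

lemma cup_vector_coeff_multiple:
  assumes "lam \<in> standard s" "nu \<noteq> lam"
  shows "\<exists>p. coeff_of (cup_vector s lam) nu = of_int_polynomial ([:0, 1:] * p)"
proof (cases "coeff_of (cup_vector s lam) nu = 0")
  case True
  then show ?thesis by (intro exI[of _ 0]) simp
next
  case False
  then show ?thesis using lookup_cup_vector_other(1)[of s lam nu] assms v_power_Suc_multiple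
    by (auto simp: standard_def)
qed

text \<open>Two candidates with coefficient 1 at \<open>lam\<close> differ by a bar-invariant vector
  all of whose coefficients are divisible by \<open>v\<close>, which is 0.\<close>

lemma canonical_eq_cup_vector:
  assumes "fst s \<le> snd s" "lam \<in> standard s" "lam \<in> Phi_infinity s (bip_rank lam)"
  shows "canonical s lam = cup_vector s lam"
  unfolding canonical_def
proof (rule the_equality)
  have irr: "cup_vector s lam \<in> irr_module s" and keys: "Poly_Mapping.keys (cup_vector s lam) \<subseteq> bipartitions (bip_rank lam)"
    using cup_vector_generated[OF assms(1,2)] by auto
  have one: "coeff_of (cup_vector s lam) lam = 1"
    using lookup_cup_vector_self assms(2) by (simp add: standard_def)
  show "is_canonical s lam (cup_vector s lam)"
    unfolding is_canonical_def
    using assms irr keys one bar_involution_eq[OF assms(1) irr] cup_bar_cup_vector cup_vector_coeff_multiple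
    by simp
  fix b assume b: "is_canonical s lam b"
  then have bi: "b \<in> irr_module s" "bar_involution s b = b" "coeff_of b lam = 1"
    "\<And>nu. nu \<noteq> lam \<Longrightarrow> \<exists>p. coeff_of b nu = of_int_polynomial ([:0, 1:] * p)"
    by (auto simp: is_canonical_def)
  have sp: "b \<in> fock.span (cup_vector s ` standard s)" "cup_vector s lam \<in> fock.span (cup_vector s ` standard s)"
    using bi(1) irr irr_module_eq_span[OF assms(1)] by auto
  let ?d = "b - cup_vector s lam"
  have d: "?d \<in> fock.span (cup_vector s ` standard s)" using sp by (rule fock.span_diff)
  have "cup_bar s (?d + cup_vector s lam) = cup_bar s ?d + cup_bar s (cup_vector s lam)"
    using cup_bar_add d sp(2) by blast
  then have "cup_bar s ?d = ?d"
    using bi(1,2) bar_involution_eq[OF assms(1), of b] cup_bar_cup_vector[OF assms(2)] by (simp add: eq_diff_eq)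
  moreover have "\<exists>p. coeff_of ?d nu = of_int_polynomial ([:0, 1:] * p)" for nu
  proof (cases "nu = lam")
    case True
    then show ?thesis using one bi(3) by (intro exI[of _ 0]) (simp add: lookup_minus)
  next
    case False
    obtain p q where "coeff_of b nu = of_int_polynomial ([:0, 1:] * p)"
      "coeff_of (cup_vector s lam) nu = of_int_polynomial ([:0, 1:] * q)"
      using bi(4)[OF False] cup_vector_coeff_multiple[OF assms(2) False] by blast
    then have "coeff_of ?d nu = of_int_polynomial ([:0, 1:] * (p - q))"
      by (simp only: lookup_minus of_int_polynomial_diff[symmetric] right_diff_distrib)
    then show ?thesis by blast
  qed
  ultimately have "?d = 0" using bar_invariant_small_eq_0 d by blast
  then show "b = cup_vector s lam" by simp
qed

section \<open>Degrees of the canonical coefficients\<close>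

lemma cup_coeff_of_int_polynomial:
  "cup_coeff w u = of_int_polynomial (case cup_deg [] w u of None \<Rightarrow> 0 | Some k \<Rightarrow> monom 1 k)"
  by (simp add: cup_coeff_def of_int_polynomial_monom split: option.splits)

lemma canonical_coeff_eq:
  assumes "canonical s lam = cup_vector s lam"
  shows "canonical_coeff s lam nu = (if level s nu = level s lam then
    case cup_deg [] (word s lam) (word s nu) of None \<Rightarrow> 0 | Some k \<Rightarrow> monom 1 k else 0)"
  unfolding canonical_coeff_def assms lookup_cup_vector
  by (rule the_equality)
    (auto simp: cup_coeff_of_int_polynomial split: if_splits dest: of_int_polynomial_inj
      intro!: of_int_polynomial_inj)

lemma canonical_coeff_max:
  assumes "canonical s lam = cup_vector s lam" "lam \<in> standard s"
    "level s th = level s lam" "word s th = flip (word s lam)" "th \<in> bipartitions n"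
  shows "(\<forall>nu \<in> bipartitions n. poly_degree (canonical_coeff s lam nu) \<le> poly_degree (canonical_coeff s lam mu)) \<longleftrightarrow> mu = th"
proof -
  let ?N = "count_list (word s lam) False"
  have p: "pend (word s lam) = 0" using assms(2) by (simp add: standard_def)
  have deg: "poly_degree (canonical_coeff s lam nu) = (if level s nu = level s lam then
    case cup_deg [] (word s lam) (word s nu) of None \<Rightarrow> -\<infinity> | Some k \<Rightarrow> ereal (real k) else -\<infinity>)" for nu
    unfolding canonical_coeff_eq[OF assms(1)]
    by (simp add: poly_degree_def degree_monom_eq split: option.splits)
  have le: "poly_degree (canonical_coeff s lam nu) \<le> ereal (real ?N)" for nu
    unfolding deg using cup_deg_le by (auto split: option.splits)
  have eq: "poly_degree (canonical_coeff s lam nu) = ereal (real ?N) \<longleftrightarrow> nu = th" for nu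
  proof -
    have "poly_degree (canonical_coeff s lam nu) = ereal (real ?N) \<longleftrightarrow>
      level s nu = level s lam \<and> cup_deg [] (word s lam) (word s nu) = Some ?N"
      unfolding deg by (auto split: option.splits)
    also have "\<dots> \<longleftrightarrow> level s nu = level s th \<and> word s nu = word s th"
      using cup_deg_max[of "word s lam" "[]" "word s nu"] p assms(3,4) by simp
    also have "\<dots> \<longleftrightarrow> nu = th" using level_word_inj by blast
    finally show ?thesis .
  qed
  show ?thesis
  proof
    assume "\<forall>nu \<in> bipartitions n. poly_degree (canonical_coeff s lam nu) \<le> poly_degree (canonical_coeff s lam mu)"
    then have "ereal (real ?N) \<le> poly_degree (canonical_coeff s lam mu)" using assms(5) eq[of th] by metis
    then show "mu = th" using le[of mu] eq[of mu] by (metis order.antisym)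
  next
    assume "mu = th"
    then show "\<forall>nu \<in> bipartitions n. poly_degree (canonical_coeff s lam nu) \<le> poly_degree (canonical_coeff s lam mu)"
      using le eq[of th] by metis
  qed
qed

section \<open>Good nodes and heights\<close>

text \<open>
  Height function of a signature: addable nodes count \<open>+1\<close>, removable ones \<open>-1\<close>. A removable node survives the
  cancellation of pairs \<open>RA\<close> iff the height stays below its value just before the node, and the good node
  is the step following the last maximum.
\<close>

definition hgt :: "('a \<Rightarrow> bool) \<Rightarrow> ('a \<Rightarrow> int) \<Rightarrow> 'a set \<Rightarrow> int \<Rightarrow> int" where
  "hgt A idx S m = (\<Sum>x \<in> {x \<in> S. idx x < m}. if A x then 1 else - 1)"

definition falls_after :: "('a \<Rightarrow> bool) \<Rightarrow> ('a \<Rightarrow> int) \<Rightarrow> 'a set \<Rightarrow> 'a \<Rightarrow> bool" where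
  "falls_after A idx S g \<longleftrightarrow> (\<forall>m > idx g. hgt A idx S m < hgt A idx S (idx g))"

lemma hgt_step:
  assumes "finite S" "inj_on idx S" "x \<in> S"
  shows "hgt A idx S (idx x + 1) = hgt A idx S (idx x) + (if A x then 1 else - 1)"
proof -
  have "{y \<in> S. idx y < idx x + 1} = insert x {y \<in> S. idx y < idx x}"
  proof (intro set_eqI iffI)
    fix y assume y: "y \<in> {y \<in> S. idx y < idx x + 1}"
    then have "idx y = idx x \<longrightarrow> y = x" using assms by (auto simp: inj_on_def)
    then show "y \<in> insert x {y \<in> S. idx y < idx x}" using y by auto
  qed (use assms(3) in auto)
  then show ?thesis using assms(1) by (simp add: hgt_def)
qed

lemma hgt_const:
  assumes "m \<le> n" "\<And>x. x \<in> S \<Longrightarrow> m \<le> idx x \<Longrightarrow> idx x < n \<Longrightarrow> False"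
  shows "hgt A idx S n = hgt A idx S m"
proof -
  have "{x \<in> S. idx x < n} = {x \<in> S. idx x < m}" using assms by force
  then show ?thesis by (simp add: hgt_def)
qed

text \<open>The pair steps down at \<open>r\<close> and back up at \<open>a\<close>, so its only
  effect is a dent of depth 1 in between.\<close>

lemma hgt_cancel:
  assumes "finite S" "r \<in> S" "a \<in> S" "\<not> A r" "A a" "idx r < idx a"
  shows "hgt A idx S m = hgt A idx (S - {r, a}) m - (if idx r < m \<and> m \<le> idx a then 1 else 0)"
proof -
  let ?v = "\<lambda>x. if A x then 1 else - 1 :: int"
  have ra: "r \<noteq> a" using assms by auto
  have "{x \<in> S. idx x < m} = {x \<in> S - {r, a}. idx x < m} \<union> {x \<in> {r, a}. idx x < m}"
    using assms by auto
  then have "hgt A idx S m = hgt A idx (S - {r, a}) m + sum ?v {x \<in> {r, a}. idx x < m}"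
    unfolding hgt_def using assms(1) by (simp only:) (rule sum.union_disjoint, auto)
  moreover have "sum ?v {x \<in> {r, a}. idx x < m} = - (if idx r < m \<and> m \<le> idx a then 1 else 0)"
  proof -
    consider "m \<le> idx r" | "idx r < m" "m \<le> idx a" | "idx a < m" by linarith
    then show ?thesis
    proof cases
      case 1
      then have eq: "{x \<in> {r, a}. idx x < m} = {}" using assms(6) by auto
      show ?thesis unfolding eq using 1 by simp
    next
      case 2
      then have eq: "{x \<in> {r, a}. idx x < m} = {r}" by auto
      show ?thesis unfolding eq using 2 assms(4) by simp
    next
      case 3
      then have eq: "{x \<in> {r, a}. idx x < m} = {r, a}" using assms(6) by auto
      show ?thesis unfolding eq using 3 assms(4,5) ra by simp
    qed
  qed
  ultimately show ?thesis by simp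
qed

text \<open>\<open>r\<close> itself does not survive, since behind \<open>a\<close> the height is
  back at its value before \<open>r\<close>. For a node before the pair, the dent cannot spoil the
  fall and shows no value above the one reached behind \<open>a\<close>; nodes after the pair see
  the same heights.\<close>

lemma falls_after_cancel:
  assumes "finite S" "inj_on idx S" "r \<in> S" "a \<in> S" "\<not> A r" "A a" "idx r < idx a"
    "\<And>x. x \<in> S \<Longrightarrow> idx x \<le> idx r \<or> idx a \<le> idx x"
    "g \<in> S" "\<not> A g"
  shows "falls_after A idx S g \<longleftrightarrow> g \<in> S - {r, a} \<and> falls_after A idx (S - {r, a}) g"
proof (cases "g = r")
  case True
  have "hgt A idx (S - {r, a}) (idx a + 1) = hgt A idx (S - {r, a}) (idx r)"
  proof (rule hgt_const)
    fix x assume x: "x \<in> S - {r, a}" "idx r \<le> idx x" "idx x < idx a + 1"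
    then have "idx x \<noteq> idx r" "idx x \<noteq> idx a" using assms(2-4) by (auto simp: inj_on_def)
    then show False using assms(8)[of x] x by auto
  qed (use assms(7) in simp)
  then have "hgt A idx S (idx a + 1) = hgt A idx S (idx r)"
    unfolding hgt_cancel[OF assms(1,3-7)] using assms(7) by simp
  then have "\<not> falls_after A idx S g" unfolding falls_after_def True using assms(7) by (auto intro!: exI[of _ "idx a + 1"])
  then show ?thesis using True by simp
next
  case False
  have ga: "g \<noteq> a" using assms by auto
  let ?S = "S - {r, a}"
  note H = hgt_cancel[OF assms(1,3-7)]
  have neq: "idx g \<noteq> idx r" "idx g \<noteq> idx a" using False ga assms(2,3,4,9) by (auto simp: inj_on_def)
  have g: "g \<in> ?S" using False ga assms(9) by simp
  consider "idx g < idx r" | "idx a < idx g" using neq assms(8)[OF assms(9)] by linarith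
  then show ?thesis
  proof cases
    case 1
    \<comment> \<open>Without the pair the height is constant along the former dent, equal to its
      value behind \<open>a\<close>, and there the assumption on the larger signature
      applies.\<close>
    have const: "hgt A idx ?S m = hgt A idx ?S (idx a + 1)" if "idx r < m" "m \<le> idx a" for m
    proof (rule hgt_const[symmetric])
      fix x assume x: "x \<in> ?S" "m \<le> idx x" "idx x < idx a + 1"
      then have "idx x \<noteq> idx a" using assms(2,4) by (auto simp: inj_on_def)
      then show False using assms(8)[of x] that x by auto
    qed (use that in simp)
    have "falls_after A idx S g \<longleftrightarrow> falls_after A idx ?S g"
    proof
      assume f: "falls_after A idx S g"
      show "falls_after A idx ?S g" unfolding falls_after_def
      proof (intro allI impI)
        fix m assume m: "idx g < m"
        show "hgt A idx ?S m < hgt A idx ?S (idx g)"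
        proof (cases "idx r < m \<and> m \<le> idx a")
          case True
          have "hgt A idx S (idx a + 1) < hgt A idx S (idx g)"
            using f 1 assms(7) unfolding falls_after_def by auto
          then show ?thesis using const True 1 assms(7) unfolding H by auto
        next
          case False
          have "hgt A idx S m < hgt A idx S (idx g)" using f m unfolding falls_after_def by auto
          then show ?thesis using False 1 assms(7) unfolding H by (auto split: if_splits)
        qed
      qed
    next
      assume f: "falls_after A idx ?S g"
      show "falls_after A idx S g" unfolding falls_after_def
      proof (intro allI impI)
        fix m assume m: "idx g < m"
        then have "hgt A idx ?S m < hgt A idx ?S (idx g)" using f unfolding falls_after_def by auto
        then show "hgt A idx S m < hgt A idx S (idx g)" using 1 unfolding H by (auto split: if_splits)
      qed
    qed
    then show ?thesis using g by simp
  next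
    case 2
    then have "hgt A idx S m = hgt A idx ?S m" if "idx g \<le> m" for m unfolding H using that by auto
    then show ?thesis using g unfolding falls_after_def by auto
  qed
qed

lemma sorted_cancel:
  assumes "sorted_wrt (\<lambda>x y. idx x < idx y) (xs @ [r, a] @ ys)"
  shows "set (xs @ ys) = set (xs @ [r, a] @ ys) - {r, a}"
    "x \<in> set (xs @ [r, a] @ ys) \<Longrightarrow> idx x \<le> idx r \<or> idx a \<le> idx x"
    "sorted_wrt (\<lambda>x y. idx x < idx y) (xs @ ys)" "idx r < (idx a :: int)"
proof -
  have s: "\<And>x. x \<in> set xs \<Longrightarrow> idx x < idx r" "\<And>x. x \<in> set xs \<Longrightarrow> idx x < idx a"
    "\<And>y. y \<in> set ys \<Longrightarrow> idx r < idx y" "\<And>y. y \<in> set ys \<Longrightarrow> idx a < idx y"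
    and ra: "idx r < idx a" and srt: "sorted_wrt (\<lambda>x y. idx x < idx y) (xs @ ys)"
    using assms by (auto simp: sorted_wrt_append)
  show "idx r < idx a" "sorted_wrt (\<lambda>x y. idx x < idx y) (xs @ ys)" by (fact ra srt)+
  have "r \<notin> set xs" "a \<notin> set xs" "r \<notin> set ys" "a \<notin> set ys" using s by blast+
  then show "set (xs @ ys) = set (xs @ [r, a] @ ys) - {r, a}" by auto
  show "idx x \<le> idx r \<or> idx a \<le> idx x" if "x \<in> set (xs @ [r, a] @ ys)" for x
    using that s(1,4)[of x] ra by auto
qed

lemma sorted_inj: "sorted_wrt (\<lambda>x y. idx x < (idx y :: int)) w \<Longrightarrow> inj_on idx (set w)"
proof (induction w)
  case (Cons a w)
  have "idx a < idx x" if "x \<in> set w" for x using Cons(2) that by simp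
  then have "idx a \<notin> idx ` (set w - {a})" by fastforce
  then show ?case using Cons by simp
qed simp

lemma addable_cbeads:
  assumes "addable lam g"
  shows "snd (snd g) \<in> {0, 1} \<and> node_content s g \<in> cbeads s lam (snd (snd g)) \<and>
    node_content s g + 1 \<notin> cbeads s lam (snd (snd g))"
  using assms adds_node_raises[where s = s] unfolding addable_def raises_def by blast

lemma removable_cbeads:
  assumes "removable lam g"
  shows "snd (snd g) \<in> {0, 1} \<and> node_content s g \<notin> cbeads s lam (snd (snd g)) \<and>
    node_content s g + 1 \<in> cbeads s lam (snd (snd g))"
proof -
  obtain mu where "adds_node mu g lam" using assms unfolding removable_def by blast
  then have "raises s (node_content s g) (snd (snd g)) mu lam" by (rule adds_node_raises)
  then show ?thesis using raises_ex_iff by blast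
qed

lemma addable_removable: "addable lam g \<Longrightarrow> \<not> removable lam g"
  using addable_cbeads[of lam g "(0, 0)"] removable_cbeads[of lam g "(0, 0)"] by blast

lemma cancel_RA_falls_after:
  assumes "(cancel_RA lam)\<^sup>*\<^sup>* w w'" "sorted_wrt (\<lambda>x y. idx x < idx y) w"
  shows "sorted_wrt (\<lambda>x y. idx x < idx y) w' \<and> set w' \<subseteq> set w \<and> (\<forall>g. removable lam g \<longrightarrow>
    (g \<in> set w \<and> falls_after (addable lam) idx (set w) g \<longleftrightarrow> g \<in> set w' \<and> falls_after (addable lam) idx (set w') g))"
  using assms(1,2)
proof (induction rule: rtranclp_induct)
  case (step y z)
  then have IH: "sorted_wrt (\<lambda>x y. idx x < idx y) y" "set y \<subseteq> set w"
    "\<And>g. removable lam g \<Longrightarrow> g \<in> set w \<and> falls_after (addable lam) idx (set w) g \<longleftrightarrow> g \<in> set y \<and> falls_after (addable lam) idx (set y) g"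
    by auto
  from step(2) obtain xs r a ys where y: "y = xs @ [r, a] @ ys" "z = xs @ ys" "removable lam r" "addable lam a"
    by (auto elim!: cancel_RA.cases)
  note s = sorted_cancel[OF IH(1)[unfolded y(1)]]
  have inj: "inj_on idx (set y)" using IH(1) by (rule sorted_inj)
  have "g \<in> set y \<and> falls_after (addable lam) idx (set y) g \<longleftrightarrow> g \<in> set z \<and> falls_after (addable lam) idx (set z) g"
    if "removable lam g" for g
  proof (cases "g \<in> set y")
    case True
    have na: "\<not> addable lam r" "\<not> addable lam g" using addable_removable y(3) that by blast+
    have "r \<in> set y" "a \<in> set y" using y by auto
    from falls_after_cancel[where A = "addable lam" and g = g and S = "set y", OF _ inj this na(1) y(4) s(4) s(2)[folded y(1)] True na(2)]
    show ?thesis using True unfolding y(2) s(1)[folded y(1)] by simp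
  next
    case False
    then show ?thesis unfolding y(2) s(1) y(1) by auto
  qed
  moreover have "set z \<subseteq> set w" using IH(2) unfolding y by auto
  ultimately show ?case using IH(3) s(3) unfolding y(2) by blast
qed auto

lemma cancel_RA_normal_form: "\<exists>w'. (cancel_RA lam)\<^sup>*\<^sup>* w w' \<and> (\<nexists>w''. cancel_RA lam w' w'')"
proof (induction "length w" arbitrary: w rule: less_induct)
  case less
  show ?case
  proof (cases "\<exists>w''. cancel_RA lam w w''")
    case True
    then obtain w1 where w1: "cancel_RA lam w w1" by blast
    then have "length w1 < length w" by (auto elim: cancel_RA.cases)
    then obtain w' where "(cancel_RA lam)\<^sup>*\<^sup>* w1 w'" "\<nexists>w''. cancel_RA lam w' w''" using less by blast
    then show ?thesis using w1 by (meson converse_rtranclp_into_rtranclp)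
  qed auto
qed

text \<open>In a reduced word no addable node follows a removable one: the first addable node behind
  \<open>g\<close> would have a removable one directly before it. So from \<open>g\<close> on the
  height only goes down.\<close>

lemma irreducible_falls_after:
  assumes "\<nexists>w''. cancel_RA lam w w''" "sorted_wrt (\<lambda>x y. idx x < idx y) w" "g \<in> set w" "removable lam g"
    "\<And>x. x \<in> set w \<Longrightarrow> addable lam x \<or> removable lam x"
  shows "falls_after (addable lam) idx (set w) g"
proof -
  obtain xs ys where w: "w = xs @ g # ys" using assms(3) by (meson split_list)
  have ys: "\<forall>y \<in> set ys. \<not> addable lam y"
  proof (rule ccontr)
    assume "\<not> ?thesis"
    then obtain y1 a y2 where a: "ys = y1 @ a # y2" "addable lam a" "\<forall>y \<in> set y1. \<not> addable lam y"
      using split_list_first_prop[of ys "addable lam"] by auto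
    obtain zs p where zs: "g # y1 = zs @ [p]" by (metis rev_exhaust list.distinct(1))
    have "p \<in> set (g # y1)" unfolding zs by simp
    then consider "p = g" | "p \<in> set y1" by auto
    then have "removable lam p"
    proof cases
      case 2
      then show ?thesis using assms(5)[of p] a(1,3) w by auto
    qed (use assms(4) in simp)
    then have "cancel_RA lam ((xs @ zs) @ [p, a] @ y2) ((xs @ zs) @ y2)" using a(2) by (rule cancel_RA.intros)
    moreover have "w = (xs @ zs) @ [p, a] @ y2" using w a(1) zs by (metis append.assoc append_Cons append_Nil)
    ultimately show False using assms(1) by blast
  qed
  have s: "\<forall>x\<in>set xs. idx x < idx g" "\<forall>y\<in>set ys. idx g < idx y" "distinct w"
  proof -
    show "\<forall>x\<in>set xs. idx x < idx g" "\<forall>y\<in>set ys. idx g < idx y"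
      using assms(2) unfolding w by (auto simp: sorted_wrt_append)
    show "distinct w" using assms(2) by (induction w) auto
  qed
  show ?thesis unfolding falls_after_def
  proof (intro allI impI)
    fix m assume m: "idx g < m"
    let ?v = "\<lambda>x. if addable lam x then 1 else - 1 :: int"
    have 1: "{x \<in> set w. idx x < idx g} = set xs" using s unfolding w by force
    have 2: "{x \<in> set w. idx x < m} = set xs \<union> insert g {y \<in> set ys. idx y < m}"
      using s m unfolding w by force
    have "sum ?v {x \<in> set w. idx x < m} = sum ?v (set xs) + sum ?v (insert g {y \<in> set ys. idx y < m})"
      unfolding 2 by (rule sum.union_disjoint) (use s(3) w in auto)
    also have "sum ?v (insert g {y \<in> set ys. idx y < m}) = ?v g + sum ?v {y \<in> set ys. idx y < m}"
      by (rule sum.insert) (use s(2) in auto)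
    also have "?v g = - 1" using assms(4) addable_removable[of lam g] by (cases "addable lam g") simp_all
    also have "sum ?v {y \<in> set ys. idx y < m} \<le> 0" by (rule sum_nonpos) (use ys in auto)
    finally show "hgt (addable lam) idx (set w) m < hgt (addable lam) idx (set w) (idx g)"
      unfolding hgt_def 1 by simp
  qed
qed

section \<open>Signatures, normal nodes and good nodes\<close>

definition sig_nodes :: "int \<Rightarrow> charge \<Rightarrow> int \<Rightarrow> bipartition \<Rightarrow> node set" where
  "sig_nodes e s i lam = {g. (addable lam g \<or> removable lam g) \<and> node_residue e s g = i}"

lemma sig_node_unique:
  assumes "addable lam g \<or> removable lam g" "addable lam h \<or> removable lam h"
    "node_content s g = node_content s h" "snd (snd g) = snd (snd h)"
  shows "g = h"
proof (cases "addable lam g")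
  case True
  then have "addable lam h" using addable_cbeads[of lam g s] removable_cbeads[of lam h s] assms by auto
  with True obtain mu nu where m: "adds_node lam g mu" "adds_node lam h nu" unfolding addable_def by blast
  have "mu = nu" using adds_node_raises[OF m(1), of s] adds_node_raises[OF m(2), of s] assms raises_unique by metis
  then show ?thesis using m adds_node_unique by blast
next
  case False
  then have g: "removable lam g" using assms by blast
  then have "removable lam h" using addable_cbeads[of lam h s] removable_cbeads[of lam g s] assms by auto
  with g obtain mu nu where m: "adds_node mu g lam" "adds_node nu h lam" unfolding removable_def by blast
  have "mu = nu" using adds_node_raises[OF m(1), of s] adds_node_raises[OF m(2), of s] assms raises_unique' by metis
  then show ?thesis using m adds_node_unique by blast
qed

lemma finite_maya_boundary:
  assumes "maya t S"
  shows "finite {k. (k \<in> S) \<noteq> (k + 1 \<in> S)}"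
proof -
  obtain m where m: "{..m} \<subseteq> S" "finite (S \<inter> {m<..})" using assms unfolding maya_def by blast
  have "{k. (k \<in> S) \<noteq> (k + 1 \<in> S)} \<subseteq> insert m ((S \<inter> {m<..}) \<union> (\<lambda>k. k - 1) ` (S \<inter> {m<..}))"
  proof
    fix k assume k: "k \<in> {k. (k \<in> S) \<noteq> (k + 1 \<in> S)}"
    show "k \<in> insert m ((S \<inter> {m<..}) \<union> (\<lambda>k. k - 1) ` (S \<inter> {m<..}))"
    proof (cases "k \<le> m")
      case True
      then have "k \<in> S" using m(1) by auto
      then have "k + 1 \<notin> S" using k by auto
      then have "\<not> k + 1 \<le> m" using m(1) by auto
      then show ?thesis using True by auto
    next
      case False
      show ?thesis
      proof (cases "k \<in> S")
        case f: False
        then have "k + 1 \<in> S \<inter> {m<..}" using k False by auto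
        then have "k \<in> (\<lambda>k. k - 1) ` (S \<inter> {m<..})" by (intro image_eqI[of _ _ "k + 1"]) auto
        then show ?thesis by blast
      qed (use False in auto)
    qed
  qed
  then show ?thesis by (rule finite_subset) (use m(2) in simp)
qed

lemma finite_sig_nodes: "finite (sig_nodes e s i lam)"
proof (rule finite_imageD[where f = "\<lambda>g. (node_content s g, snd (snd g))"])
  let ?B = "\<lambda>c. {k. (k \<in> cbeads s lam c) \<noteq> (k + 1 \<in> cbeads s lam c)}"
  have "(node_content s g, snd (snd g)) \<in> (?B 0 \<union> ?B (Suc 0)) \<times> {0, Suc 0}" if "g \<in> sig_nodes e s i lam" for g
    using that addable_cbeads[of lam g s] removable_cbeads[of lam g s] unfolding sig_nodes_def by auto
  then have "(\<lambda>g. (node_content s g, snd (snd g))) ` sig_nodes e s i lam \<subseteq> (?B 0 \<union> ?B (Suc 0)) \<times> {0, Suc 0}"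
    by (intro image_subsetI)
  moreover have "finite (?B 0)" "finite (?B (Suc 0))" using maya_cbeads finite_maya_boundary by blast+
  ultimately show "finite ((\<lambda>g. (node_content s g, snd (snd g))) ` sig_nodes e s i lam)"
    by (elim finite_subset) simp
  show "inj_on (\<lambda>g. (node_content s g, snd (snd g))) (sig_nodes e s i lam)"
    unfolding inj_on_def sig_nodes_def using sig_node_unique[of lam _ _ s] by simp
qed

lemma is_signature_iff:
  assumes "\<And>g h. g \<in> sig_nodes e s i lam \<Longrightarrow> h \<in> sig_nodes e s i lam \<Longrightarrow> node_less s g h \<longleftrightarrow> idx g < idx h"
  shows "is_signature e s i lam w \<longleftrightarrow> sorted_wrt (\<lambda>x y. idx x < idx y) w \<and> set w = sig_nodes e s i lam"
proof -
  have "sorted_wrt (node_less s) w \<longleftrightarrow> sorted_wrt (\<lambda>x y. idx x < idx y) w" if "set w = sig_nodes e s i lam"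
  proof
    show "sorted_wrt (\<lambda>x y. idx x < idx y) w" if "sorted_wrt (node_less s) w"
      using that by (rule sorted_wrt_mono_rel[rotated]) (use assms \<open>set w = _\<close> in blast)
    show "sorted_wrt (node_less s) w" if "sorted_wrt (\<lambda>x y. idx x < idx y) w"
      using that by (rule sorted_wrt_mono_rel[rotated]) (use assms \<open>set w = _\<close> in blast)
  qed
  then show ?thesis unfolding is_signature_def sig_nodes_def[symmetric] by auto
qed

lemma signature_ex:
  assumes "finite S" "inj_on idx S"
  shows "\<exists>w. sorted_wrt (\<lambda>x y. idx x < (idx y :: int)) w \<and> set w = S"
proof -
  let ?w = "map (inv_into S idx) (sorted_list_of_set (idx ` S))"
  have "idx (inv_into S idx z) = z" if "z \<in> idx ` S" for z using that by (rule f_inv_into_f)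
  then have "sorted_wrt (\<lambda>x y. idx x < idx y) ?w"
    unfolding sorted_wrt_map using strict_sorted_list_of_set[of "idx ` S"] assms(1)
    by (elim sorted_wrt_mono_rel[rotated]) simp
  moreover have "set ?w = S" using assms by (simp add: inv_into_image_cancel)
  ultimately show ?thesis by blast
qed

lemma normal_nodes_iff:
  assumes "\<And>g h. g \<in> sig_nodes e s i lam \<Longrightarrow> h \<in> sig_nodes e s i lam \<Longrightarrow> node_less s g h \<longleftrightarrow> idx g < idx h"
    "inj_on idx (sig_nodes e s i lam)"
  shows "g \<in> normal_nodes e s i lam \<longleftrightarrow> removable lam g \<and> g \<in> sig_nodes e s i lam \<and>
    falls_after (addable lam) idx (sig_nodes e s i lam) g"
proof
  assume "g \<in> normal_nodes e s i lam"
  then obtain w w' where g: "removable lam g" "is_signature e s i lam w" "(cancel_RA lam)\<^sup>*\<^sup>* w w'"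
    "\<nexists>w''. cancel_RA lam w' w''" "g \<in> set w'" unfolding normal_nodes_def by blast
  then have w: "sorted_wrt (\<lambda>x y. idx x < idx y) w" "set w = sig_nodes e s i lam"
    using is_signature_iff[OF assms(1)] by auto
  note c = cancel_RA_falls_after[OF g(3) w(1)]
  have "addable lam x \<or> removable lam x" if "x \<in> set w'" for x
  proof -
    have "x \<in> sig_nodes e s i lam" using c that w(2) by blast
    then show ?thesis by (simp add: sig_nodes_def)
  qed
  then have "falls_after (addable lam) idx (set w') g"
    using irreducible_falls_after[OF g(4) conjunct1[OF c] g(5) g(1)] by blast
  then have "g \<in> set w \<and> falls_after (addable lam) idx (set w) g" using c g(1,5) by blast
  then show "removable lam g \<and> g \<in> sig_nodes e s i lam \<and> falls_after (addable lam) idx (sig_nodes e s i lam) g"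
    unfolding w(2) using g(1) by blast
next
  assume g: "removable lam g \<and> g \<in> sig_nodes e s i lam \<and> falls_after (addable lam) idx (sig_nodes e s i lam) g"
  obtain w where w: "sorted_wrt (\<lambda>x y. idx x < idx y) w" "set w = sig_nodes e s i lam"
    using signature_ex[OF finite_sig_nodes assms(2)] by blast
  obtain w' where w': "(cancel_RA lam)\<^sup>*\<^sup>* w w'" "\<nexists>w''. cancel_RA lam w' w''"
    using cancel_RA_normal_form[of lam w] by blast
  have "g \<in> set w \<and> falls_after (addable lam) idx (set w) g" unfolding w(2) using g by blast
  then have "g \<in> set w'" using cancel_RA_falls_after[OF w'(1) w(1)] g by blast
  moreover have "is_signature e s i lam w" using w is_signature_iff[OF assms(1)] by auto
  ultimately show "g \<in> normal_nodes e s i lam" unfolding normal_nodes_def using w' g by blast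
qed

text \<open>Were the height larger at some place before \<open>g\<close>, the last place of its
  maximum from there up to \<open>g\<close> would carry a normal node smaller than
  \<open>g\<close>.\<close>

lemma good_node_iff_hgt:
  assumes "\<And>g h. g \<in> sig_nodes e s i lam \<Longrightarrow> h \<in> sig_nodes e s i lam \<Longrightarrow> node_less s g h \<longleftrightarrow> idx g < idx h"
    "inj_on idx (sig_nodes e s i lam)"
  defines "H \<equiv> hgt (addable lam) idx (sig_nodes e s i lam)"
  shows "good_node e s i lam g \<longleftrightarrow> removable lam g \<and> node_residue e s g = i \<and>
    (\<forall>m > idx g. H m < H (idx g)) \<and> (\<forall>m \<le> idx g. H m \<le> H (idx g))"
proof -
  let ?S = "sig_nodes e s i lam"
  have normal: "h \<in> normal_nodes e s i lam \<longleftrightarrow> removable lam h \<and> h \<in> ?S \<and> (\<forall>m > idx h. H m < H (idx h))" for h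
    using normal_nodes_iff[OF assms(1,2)] unfolding falls_after_def H_def by blast
  have step: "H (idx x + 1) = H (idx x) + (if addable lam x then 1 else - 1)" if "x \<in> ?S" for x
    unfolding H_def by (rule hgt_step[OF finite_sig_nodes assms(2) that])
  show ?thesis
  proof
    assume good: "good_node e s i lam g"
    then have g: "removable lam g" "g \<in> ?S" "\<forall>m > idx g. H m < H (idx g)"
      using normal unfolding good_node_def by blast+
    have "H m \<le> H (idx g)" if m: "m \<le> idx g" for m
    proof (rule ccontr)
      assume gt: "\<not> H m \<le> H (idx g)"
      define M where "M = Max (H ` {m..idx g})"
      have M: "M \<in> H ` {m..idx g}" "\<And>x. m \<le> x \<Longrightarrow> x \<le> idx g \<Longrightarrow> H x \<le> M"
        unfolding M_def using m by (auto intro!: Max_in)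
      define Z where "Z = {x \<in> {m..idx g}. H x = M}"
      have Z: "finite Z" "Z \<noteq> {}"
      proof -
        show "finite Z" by (rule finite_subset[of _ "{m..idx g}"]) (auto simp: Z_def)
        show "Z \<noteq> {}" using M(1) unfolding Z_def by blast
      qed
      define m0 where "m0 = Max Z"
      have m0: "m \<le> m0" "m0 \<le> idx g" "H m0 = M" using Max_in[OF Z, folded m0_def] unfolding Z_def by auto
      have Mg: "M > H (idx g)" using gt M(2)[of m] m by linarith
      then have m0g: "m0 < idx g" using m0 by (cases "m0 = idx g") auto
      have after: "H x < H m0" if x: "m0 < x" for x
      proof (cases "x \<le> idx g")
        case True
        have "x \<notin> Z" using Max_ge[OF Z(1), of x] x unfolding m0_def[symmetric] by auto
        then have "H x \<noteq> M" using True x m0 unfolding Z_def by auto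
        then show ?thesis using M(2)[of x] True x m0 by auto
      next
        case False
        then have "H x < H (idx g)" using g(3) by auto
        then show ?thesis using Mg m0(3) by simp
      qed
      \<comment> \<open>A place directly behind which the height drops carries a node, as otherwise
        the height would stay constant there.\<close>
      have "\<exists>x \<in> ?S. idx x = m0"
      proof (rule ccontr)
        assume "\<not> ?thesis"
        then have "H (m0 + 1) = H m0" unfolding H_def by (intro hgt_const) auto
        then show False using after[of "m0 + 1"] by simp
      qed
      then obtain x where x: "x \<in> ?S" "idx x = m0" by blast
      have "\<not> addable lam x" using after[of "m0 + 1"] step[OF x(1)] x(2) by (auto split: if_splits)
      then have "removable lam x" using x(1) by (auto simp: sig_nodes_def)
      then have "x \<in> normal_nodes e s i lam" using normal x after by auto
      moreover have "x \<noteq> g" using x(2) m0g by auto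
      ultimately have "node_less s g x" using good unfolding good_node_def by blast
      then show False using assms(1)[OF g(2) x(1)] x(2) m0g by simp
    qed
    then show "removable lam g \<and> node_residue e s g = i \<and>
      (\<forall>m > idx g. H m < H (idx g)) \<and> (\<forall>m \<le> idx g. H m \<le> H (idx g))"
      using g by (auto simp: sig_nodes_def)
  next
    assume r: "removable lam g \<and> node_residue e s g = i \<and>
      (\<forall>m > idx g. H m < H (idx g)) \<and> (\<forall>m \<le> idx g. H m \<le> H (idx g))"
    then have gS: "g \<in> ?S" by (auto simp: sig_nodes_def)
    have "node_less s g h" if h: "h \<in> normal_nodes e s i lam" "h \<noteq> g" for h
    proof -
      have hS: "h \<in> ?S" "\<forall>m > idx h. H m < H (idx h)" using h(1) normal by auto
      have "idx h \<noteq> idx g" using h(2) hS(1) gS assms(2) by (auto simp: inj_on_def)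
      moreover have "\<not> idx h < idx g" using hS(2) r by (meson not_less order.strict_implies_order)
      ultimately show ?thesis using assms(1)[OF gS hS(1)] by simp
    qed
    then show "good_node e s i lam g" unfolding good_node_def using normal r gS by blast
  qed
qed

text \<open>The restriction to \<open>f z \<noteq> 0\<close> keeps the index set finite for finitely
  supported \<open>f\<close>; over the infinite set of all \<open>z < m\<close> a sum is 0 by
  default.\<close>

definition sum_below :: "(int \<Rightarrow> int) \<Rightarrow> int \<Rightarrow> int" where
  "sum_below f m = sum f {z. f z \<noteq> 0 \<and> z < m}"

lemma sum_below_Suc:
  assumes "finite {z. f z \<noteq> 0}"
  shows "sum_below f (m + 1) = sum_below f m + f m"
proof (cases "f m = 0")
  case True
  have "z < m" if "f z \<noteq> 0" "z < m + 1" for z using that True by (cases "z = m") auto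
  then have "{z. f z \<noteq> 0 \<and> z < m + 1} = {z. f z \<noteq> 0 \<and> z < m}" by fastforce
  then show ?thesis using True by (simp add: sum_below_def)
next
  case False
  then have "{z. f z \<noteq> 0 \<and> z < m + 1} = insert m {z. f z \<noteq> 0 \<and> z < m}"
    by (auto simp: zless_add1_eq)
  moreover have "finite {z. f z \<noteq> 0 \<and> z < m}" using assms by (rule finite_subset[rotated]) auto
  ultimately show ?thesis by (simp add: sum_below_def)
qed

lemma sum_below_start:
  assumes "finite {z. f z \<noteq> 0}"
  obtains N where "\<And>m. m \<le> N \<Longrightarrow> sum_below f m = 0"
proof -
  obtain N where N: "\<And>z. f z \<noteq> 0 \<Longrightarrow> N \<le> z"
  proof (cases "{z. f z \<noteq> 0} = {}")
    case False
    then show ?thesis using that[of "Min {z. f z \<noteq> 0}"] Min_le[OF assms] by blast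
  qed (use that in blast)
  have "sum_below f m = 0" if "m \<le> N" for m
  proof -
    have "{z. f z \<noteq> 0 \<and> z < m} = {}" using N that by force
    then show ?thesis unfolding sum_below_def by (simp only: sum.empty)
  qed
  then show ?thesis using that by blast
qed

text \<open>Both partial sums vanish far to the left, and equal sums over the blocks
  \<open>2 * t\<close>, \<open>2 * t + 1\<close> propagate the equality to all even places.\<close>

lemma sum_below_eqI:
  assumes "finite {z. f z \<noteq> 0}" "finite {z. g z \<noteq> 0}"
    "\<And>t. f (2 * t) + f (2 * t + 1) = g (2 * t) + g (2 * t + 1)"
  shows "sum_below f (2 * t) = sum_below g (2 * t)"
proof -
  obtain M where M: "\<And>m. m \<le> M \<Longrightarrow> sum_below f m = 0" using sum_below_start[OF assms(1)] by blast
  obtain N where N: "\<And>m. m \<le> N \<Longrightarrow> sum_below g m = 0" using sum_below_start[OF assms(2)] by blast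
  define t0 where "t0 = min (min (M div 2) (N div 2)) t"
  have t0: "2 * t0 \<le> M" "2 * t0 \<le> N" "t0 \<le> t" by (auto simp: t0_def)
  from t0(3) show ?thesis
  proof (induction rule: int_ge_induct)
    case base
    show ?case using M[OF t0(1)] N[OF t0(2)] by simp
  next
    case (step u)
    have eq: "2 * (u + 1) = 2 * u + 1 + 1" by simp
    show ?case unfolding eq sum_below_Suc[OF assms(1)] sum_below_Suc[OF assms(2)]
      using step assms(3)[of u] by simp
  qed
qed

lemma sum_below_update:
  assumes "finite {z. f z \<noteq> 0}" "\<And>z. z \<noteq> z0 \<Longrightarrow> f' z = f z"
  shows "sum_below f' m = sum_below f m + (if z0 < m then f' z0 - f z0 else 0)"
proof -
  let ?Z = "{z. f z \<noteq> 0 \<and> z < m} - {z0}"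
  have fin: "finite ?Z" using assms(1) by (rule finite_subset[rotated]) auto
  have below: "sum_below h m = sum h ?Z + (if z0 < m then h z0 else 0)" if h: "\<And>z. z \<noteq> z0 \<Longrightarrow> h z = f z" for h
  proof (cases "z0 < m")
    case True
    have "sum_below h m = sum h (insert z0 ?Z)"
      unfolding sum_below_def using True h fin by (intro sum.mono_neutral_left) auto
    also have "\<dots> = sum h ?Z + h z0" using fin by (subst sum.insert) auto
    finally show ?thesis using True by simp
  next
    case False
    have "{z. h z \<noteq> 0 \<and> z < m} = ?Z" using h False by auto
    then show ?thesis using False by (simp add: sum_below_def)
  qed
  have "sum f' ?Z = sum f ?Z" using assms(2) by (intro sum.cong) auto
  then show ?thesis using below[of f] below[of f'] assms(2) by auto
qed

text \<open>
  In the signature before the addition of the good node, this node is the step leading to the first maximum.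
\<close>

definition cogood :: "(int \<Rightarrow> int) \<Rightarrow> int \<Rightarrow> bool" where
  "cogood F z \<longleftrightarrow> (\<forall>m. F m \<le> F (z + 1)) \<and> (\<forall>m \<le> z. F m < F (z + 1))"

lemma cogood_unique: "cogood F z \<Longrightarrow> cogood F z' \<Longrightarrow> z = z'"
  unfolding cogood_def by (metis add.commute le_less_trans less_le_not_le linorder_not_less zless_imp_add1_zle linorder_neqE)

text \<open>
  \<open>F\<close> and \<open>G\<close> agree at even places and have the same maximum on each block, so their first maxima lie in
  the same block.
\<close>

lemma cogood_transfer:
  fixes F G :: "int \<Rightarrow> int"
  assumes even: "\<And>t. F (2 * t) = G (2 * t)"
    and F1: "\<And>m. \<bar>F (m + 1) - F m\<bar> \<le> 1" and G1: "\<And>m. \<bar>G (m + 1) - G m\<bar> \<le> 1"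
    and peak: "\<And>t. F (2 * t + 1) = F (2 * t) + 1 \<and> F (2 * t + 2) = F (2 * t) \<longleftrightarrow>
      G (2 * t + 1) = G (2 * t) + 1 \<and> G (2 * t + 2) = G (2 * t)"
    and co: "cogood F z" "z div 2 = t"
  shows "cogood G (if G (2 * t + 1) = F (z + 1) then 2 * t else 2 * t + 1)"
proof -
  let ?M = "F (z + 1)"
  have z: "z = 2 * t \<or> z = 2 * t + 1" using co(2) by presburger
  have FM: "F m \<le> ?M" "m \<le> z \<Longrightarrow> F m < ?M" for m using co(1) by (auto simp: cogood_def)
  have Ge: "F (2 * u) = G (2 * u)" "F (2 * u + 2) = G (2 * u + 2)" for u
    using even[of u] even[of "u + 1"] by (auto simp: algebra_simps)
  \<comment> \<open>With steps of size at most 1, an odd place exceeds both ends of its block only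
    at a peak, and \<open>F\<close> and \<open>G\<close> have their peaks in the same blocks and of
    the same height.\<close>
  have G_le: "G (2 * u + 1) \<le> ?M" for u
    using Ge[of u] peak[of u] F1[of "2 * u"] F1[of "2 * u + 1"] G1[of "2 * u"] G1[of "2 * u + 1"]
      FM(1)[of "2 * u"] FM(1)[of "2 * u + 1"] FM(1)[of "2 * u + 2"]
    by (auto simp: algebra_simps)
  have G_lt: "G (2 * u + 1) < ?M" if "u < t" for u
    using Ge[of u] peak[of u] F1[of "2 * u"] F1[of "2 * u + 1"] G1[of "2 * u"] G1[of "2 * u + 1"]
      FM(2)[of "2 * u"] FM(2)[of "2 * u + 1"] FM(2)[of "2 * u + 2"] that z
    by (auto simp: algebra_simps)
  have parity: "\<exists>u. m = 2 * u \<or> m = 2 * u + 1" for m :: int by presburger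
  have le: "G m \<le> ?M" for m using parity[of m] G_le FM(1) Ge by metis
  have lt: "G m < ?M" if "m \<le> 2 * t" for m
  proof -
    obtain u where "m = 2 * u \<or> m = 2 * u + 1" using parity by blast
    then show ?thesis using that G_lt[of u] FM(2)[of "2 * u"] Ge[of u] z by auto
  qed
  show ?thesis
  proof (cases "G (2 * t + 1) = ?M")
    case True
    then show ?thesis using le lt by (simp add: cogood_def)
  next
    case False
    then have lt': "G (2 * t + 1) < ?M" using le[of "2 * t + 1"] by simp
    \<comment> \<open>If the odd place misses the maximum, the block must reach it at its right
      end.\<close>
    have top: "G (2 * t + 2) = ?M"
      using z False Ge[of t] peak[of t] F1[of "2 * t"] F1[of "2 * t + 1"] G1[of "2 * t"] G1[of "2 * t + 1"]
        FM(2)[of "2 * t"] FM(1)[of "2 * t + 2"] lt'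
      by (auto simp: algebra_simps)
    have "G m < ?M" if "m \<le> 2 * t + 1" for m using that lt[of m] lt' by (cases "m = 2 * t + 1") auto
    then show ?thesis using False le top by (simp add: cogood_def algebra_simps)
  qed
qed

section \<open>The signatures of both charges on a common scale\<close>

definition step_at :: "charge \<Rightarrow> bipartition \<Rightarrow> nat \<Rightarrow> int \<Rightarrow> int" where
  "step_at s lam c k = of_bool (k \<in> cbeads s lam c) - of_bool (k + 1 \<in> cbeads s lam c)"

text \<open>
  \<open>p\<close> is the component read second among nodes of equal content: \<open>p = 0\<close> for the charge \<open>s\<close> and \<open>p = 1\<close> for
  \<open>next_charge e s 1 = (s\<^sub>0, s\<^sub>1 + e)\<close>, whose order compares nodes of the second component one period later.
\<close>

definition sig_pos :: "int \<Rightarrow> charge \<Rightarrow> int \<Rightarrow> nat \<Rightarrow> node \<Rightarrow> int" where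
  "sig_pos e s i p g = 2 * ((node_content s g - i) div e) + of_bool (snd (snd g) = p)"

text \<open>Contents are taken for the charge \<open>s\<close> whatever \<open>p\<close> is, so each
  block \<open>2 * t\<close>, \<open>2 * t + 1\<close> holds the two components at the one content
  \<open>i + e * t\<close>, and \<open>p\<close> only decides their order.\<close>

definition sig_step :: "int \<Rightarrow> charge \<Rightarrow> int \<Rightarrow> nat \<Rightarrow> bipartition \<Rightarrow> int \<Rightarrow> int" where
  "sig_step e s i p lam z = step_at s lam (if even z then 1 - p else p) (i + e * (z div 2))"

lemma content_residue:
  assumes "node_residue e s g = i"
  shows "node_content s g = i + e * ((node_content s g - i) div e)"
proof -
  have "e dvd node_content s g - i" using assms unfolding node_residue_def by (auto intro: dvd_minus_mod)
  then show ?thesis by simp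
qed

lemma sig_pos_comp:
  assumes "node_residue e s g = i" "snd (snd g) \<in> {0, 1}" "p \<in> {0, 1}"
  shows "(if even (sig_pos e s i p g) then 1 - p else p) = snd (snd g)"
    "i + e * (sig_pos e s i p g div 2) = node_content s g"
  using assms content_residue[OF assms(1)] by (auto simp: sig_pos_def)

lemma sig_pos_inj: "p \<in> {0, 1} \<Longrightarrow> inj_on (sig_pos e s i p) (sig_nodes e s i lam)"
proof (rule inj_onI)
  fix g h assume *: "p \<in> {0, 1}" "g \<in> sig_nodes e s i lam" "h \<in> sig_nodes e s i lam" "sig_pos e s i p g = sig_pos e s i p h"
  have c: "snd (snd g) \<in> {0, 1}" "snd (snd h) \<in> {0, 1}"
    using *(2,3) addable_cbeads[of lam _ s] removable_cbeads[of lam _ s] unfolding sig_nodes_def by blast+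
  have r: "node_residue e s g = i" "node_residue e s h = i" using * by (auto simp: sig_nodes_def)
  show "g = h"
    using sig_pos_comp[OF r(1) c(1) *(1)] sig_pos_comp[OF r(2) c(2) *(1)] *(2-4) sig_node_unique[of lam g h s]
    by (simp add: sig_nodes_def)
qed

lemma finite_sig_step:
  assumes "e > 0" "p \<in> {0, 1}"
  shows "finite {z. sig_step e s i p lam z \<noteq> 0}"
proof -
  let ?B = "\<lambda>c. {k. (k \<in> cbeads s lam c) \<noteq> (k + 1 \<in> cbeads s lam c)}"
  let ?f = "\<lambda>z. (i + e * (z div 2), z mod 2)"
  have "finite (?B 0)" "finite (?B (Suc 0))" using maya_cbeads finite_maya_boundary by blast+
  then have fin: "finite ((?B 0 \<union> ?B (Suc 0)) \<times> {0, 1 :: int})" by simp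
  have "?f z \<in> (?B 0 \<union> ?B (Suc 0)) \<times> {0, 1}" if "sig_step e s i p lam z \<noteq> 0" for z
    using that assms(2) unfolding sig_step_def step_at_def by (auto split: if_splits)
  then have "?f ` {z. sig_step e s i p lam z \<noteq> 0} \<subseteq> (?B 0 \<union> ?B (Suc 0)) \<times> {0, 1}" by blast
  then have "finite (?f ` {z. sig_step e s i p lam z \<noteq> 0})" using fin by (rule finite_subset)
  moreover have "inj_on ?f {z. sig_step e s i p lam z \<noteq> 0}"
  proof (rule inj_onI)
    fix x y assume "?f x = ?f y"
    then have "x div 2 = y div 2" "x mod 2 = y mod 2" using assms(1) by auto
    then show "x = y" by (metis mult_div_mod_eq)
  qed
  ultimately show ?thesis by (rule finite_imageD)
qed

lemma sig_step_pos:
  assumes "g \<in> sig_nodes e s i lam" "p \<in> {0, 1}"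
  shows "sig_step e s i p lam (sig_pos e s i p g) = (if addable lam g then 1 else - 1)"
proof -
  have r: "node_residue e s g = i" and ar: "addable lam g \<or> removable lam g"
    using assms(1) by (auto simp: sig_nodes_def)
  have c: "snd (snd g) \<in> {0, 1}" using ar addable_cbeads[of lam g s] removable_cbeads[of lam g s] by blast
  show ?thesis
    unfolding sig_step_def step_at_def sig_pos_comp[OF r c assms(2)]
    using addable_cbeads[of lam g s] removable_cbeads[of lam g s] ar by auto
qed

lemma sig_step_node:
  assumes "sig_step e s i p lam z \<noteq> 0" "0 \<le> i" "i < e" "p \<in> {0, 1}"
  shows "\<exists>g \<in> sig_nodes e s i lam. sig_pos e s i p g = z"
proof -
  let ?c = "if even z then 1 - p else p" and ?k = "i + e * (z div 2)"
  have c: "?c \<in> {0, 1}" using assms(4) by auto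
  have res: "?k mod e = i" using assms(2,3) by simp
  have "\<exists>g. (addable lam g \<or> removable lam g) \<and> snd (snd g) = ?c \<and> node_content s g = ?k"
  proof (cases "?k \<in> cbeads s lam ?c")
    case True
    then have "?k + 1 \<notin> cbeads s lam ?c" using assms(1) by (auto simp: sig_step_def step_at_def)
    then obtain mu where "raises s ?k ?c lam mu" using raises_ex[OF c True] by blast
    then obtain g where "adds_node lam g mu" "node_content s g = ?k" "snd (snd g) = ?c"
      by (rule raises_adds_node)
    then show ?thesis unfolding addable_def by blast
  next
    case False
    then have "?k + 1 \<in> cbeads s lam ?c" using assms(1) by (auto simp: sig_step_def step_at_def)
    then obtain mu where "raises s ?k ?c mu lam" using raises_ex'[OF c False] by blast
    then obtain g where "adds_node mu g lam" "node_content s g = ?k" "snd (snd g) = ?c"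
      by (rule raises_adds_node)
    then show ?thesis unfolding removable_def by blast
  qed
  then obtain g where g: "addable lam g \<or> removable lam g" "snd (snd g) = ?c" "node_content s g = ?k" by blast
  have "g \<in> sig_nodes e s i lam" using g(1) res unfolding sig_nodes_def node_residue_def by (simp only: g(3) mem_Collect_eq simp_thms)
  moreover have "sig_pos e s i p g = z"
    using assms(2-4) unfolding sig_pos_def g(2,3) by (cases "even z") auto
  ultimately show ?thesis by blast
qed

lemma hgt_eq_sum_below:
  assumes "0 \<le> i" "i < e" "p \<in> {0, 1}"
  shows "hgt (addable lam) (sig_pos e s i p) (sig_nodes e s i lam) m = sum_below (sig_step e s i p lam) m"
proof -
  let ?S = "{g \<in> sig_nodes e s i lam. sig_pos e s i p g < m}"
  have inj: "inj_on (sig_pos e s i p) ?S" using sig_pos_inj[OF assms(3)] by (rule inj_on_subset) auto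
  have "sig_pos e s i p ` ?S = {z. sig_step e s i p lam z \<noteq> 0 \<and> z < m}"
  proof (intro equalityI subsetI)
    fix z assume "z \<in> sig_pos e s i p ` ?S"
    then obtain g where g: "g \<in> sig_nodes e s i lam" "z = sig_pos e s i p g" "z < m" by blast
    then have "sig_step e s i p lam z = (if addable lam g then 1 else - 1)" using sig_step_pos[OF _ assms(3)] by simp
    then show "z \<in> {z. sig_step e s i p lam z \<noteq> 0 \<and> z < m}" using g(3) by simp
  next
    fix z assume z: "z \<in> {z. sig_step e s i p lam z \<noteq> 0 \<and> z < m}"
    then obtain g where "g \<in> sig_nodes e s i lam" "sig_pos e s i p g = z" using sig_step_node[OF _ assms] by blast
    then show "z \<in> sig_pos e s i p ` ?S" using z by blast
  qed
  then have "sum_below (sig_step e s i p lam) m = (\<Sum>g\<in>?S. sig_step e s i p lam (sig_pos e s i p g))"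
    unfolding sum_below_def using sum.reindex[OF inj, of "sig_step e s i p lam"] by simp
  also have "\<dots> = hgt (addable lam) (sig_pos e s i p) (sig_nodes e s i lam) m"
    unfolding hgt_def using sig_step_pos[OF _ assms(3)] by (intro sum.cong) auto
  finally show ?thesis by simp
qed

lemma node_less_iff: "node_less s g h \<longleftrightarrow> node_content s g < node_content s h \<or>
    node_content s g = node_content s h \<and> snd (snd h) < snd (snd g)"
  by (cases g; cases h) auto

definition next_charge :: "int \<Rightarrow> charge \<Rightarrow> nat \<Rightarrow> charge" where
  "next_charge e s p = (fst s, snd s + e * int p)"

lemma content_next_charge: "node_content (next_charge e s p) g = node_content s g + (if snd (snd g) = 0 then 0 else e * int p)"
  by (cases g) (simp add: next_charge_def)

lemma residue_next_charge: "node_residue e (next_charge e s p) g = node_residue e s g"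
  unfolding node_residue_def content_next_charge by simp

lemma sig_nodes_next_charge: "sig_nodes e (next_charge e s p) i lam = sig_nodes e s i lam"
  by (simp add: sig_nodes_def residue_next_charge)

text \<open>For \<open>p = 1\<close> a node of the second component at content \<open>k\<close> ties
  with one of the first at \<open>k + e\<close> and precedes it, while it now comes after the first
  component at \<open>k\<close>. So only the order inside each block is reversed.\<close>

lemma node_less_pos:
  assumes "e > 0" "p \<in> {0, 1}" "g \<in> sig_nodes e s i lam" "h \<in> sig_nodes e s i lam"
  shows "node_less (next_charge e s p) g h \<longleftrightarrow> sig_pos e s i p g < sig_pos e s i p h"
proof -
  have c: "snd (snd g) \<in> {0, 1}" "snd (snd h) \<in> {0, 1}"
    using assms(3,4) addable_cbeads[of lam _ s] removable_cbeads[of lam _ s] unfolding sig_nodes_def by blast+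
  define t u where "t = (node_content s g - i) div e" and "u = (node_content s h - i) div e"
  have cont: "node_content s g = i + e * t" "node_content s h = i + e * u"
    unfolding t_def u_def using assms(3,4) by (intro content_residue; simp add: sig_nodes_def)+
  define d d' where "d = snd (snd g)" and "d' = snd (snd h)"
  have nc: "node_content (next_charge e s p) g = i + e * (t + (if d = 0 then 0 else int p))"
    "node_content (next_charge e s p) h = i + e * (u + (if d' = 0 then 0 else int p))"
    unfolding content_next_charge cont d_def d'_def by (simp_all add: algebra_simps)
  have less: "i + e * a < i + e * b \<longleftrightarrow> a < b" "i + e * a = i + e * b \<longleftrightarrow> a = b" for a b
    using assms(1) by auto
  have "p = 0 \<or> p = 1" "d = 0 \<or> d = 1" "d' = 0 \<or> d' = 1" using c assms(2) by (auto simp: d_def d'_def)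
  then show ?thesis
    unfolding node_less_iff nc less sig_pos_def t_def[symmetric] u_def[symmetric] d_def[symmetric] d'_def[symmetric]
    by (elim disjE; simp; linarith)
qed

text \<open>Adding \<open>g\<close> turns the step 1 at its position into -1 and lowers all later
  heights by 2. The new heights have their last maximum just before this step iff the old ones have
  their first maximum just after it.\<close>

lemma good_node_iff_cogood:
  assumes "e > 1" "p \<in> {0, 1}" "adds_node lam g mu"
  shows "good_node e (next_charge e s p) i mu g \<longleftrightarrow>
    node_residue e s g = i \<and> cogood (sum_below (sig_step e s i p lam)) (sig_pos e s i p g)"
proof (cases "node_residue e s g = i")
  case False
  then have "\<not> good_node e (next_charge e s p) i mu g"
    using good_node_iff_hgt[of e "next_charge e s p" i mu "sig_pos e s i p" g] assms(1)
      node_less_pos[of e p _ s i mu] sig_pos_inj[OF assms(2), of e s i mu] assms(2)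
    by (simp add: sig_nodes_next_charge residue_next_charge)
  then show ?thesis using False by simp
next
  case True
  have e0: "e > 0" using assms(1) by simp
  have i: "0 \<le> i" "i < e" using True assms(1) by (auto simp: node_residue_def)
  let ?F = "sum_below (sig_step e s i p lam)" and ?F' = "sum_below (sig_step e s i p mu)"
  let ?z = "sig_pos e s i p g"
  have r: "raises s (node_content s g) (snd (snd g)) lam mu" using adds_node_raises[OF assms(3)] .
  have c: "snd (snd g) \<in> {0, 1}" using r by (simp add: raises_def)
  have rem: "removable mu g" using assms(3) unfolding removable_def by blast
  note pc = sig_pos_comp[OF True c assms(2)]
  have z1: "sig_step e s i p lam ?z = 1" "sig_step e s i p mu ?z = - 1"
    unfolding sig_step_def pc step_at_def using r by (auto simp: raises_def move_def)
  have other: "sig_step e s i p mu z = sig_step e s i p lam z" if "z \<noteq> ?z" for z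
  proof (cases "(if even z then 1 - p else p) = snd (snd g)")
    case eq: True
    have "z div 2 \<noteq> ?z div 2"
    proof
      assume d: "z div 2 = ?z div 2"
      have "even z \<longleftrightarrow> even ?z" using eq pc(1) assms(2) by (auto split: if_splits)
      then show False using d that by presburger
    qed
    define k where "k = i + e * (z div 2)"
    have "k - node_content s g = e * (z div 2 - ?z div 2)"
      unfolding k_def using pc(2) by (simp add: algebra_simps)
    \<comment> \<open>Here \<open>e > 1\<close> enters: other positions of the same component have
      contents at distance at least 2, so they do not see the two sites of the moved bead.\<close>
    moreover have "\<bar>e * d\<bar> > 1" if "d \<noteq> 0" for d
    proof -
      have "e * 1 \<le> e * \<bar>d\<bar>" using that assms(1) by (intro mult_left_mono) auto
      moreover have "\<bar>e * d\<bar> = e * \<bar>d\<bar>" using assms(1) by (simp add: abs_mult)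
      ultimately show ?thesis using assms(1) by linarith
    qed
    ultimately have "\<bar>k - node_content s g\<bar> > 1" using \<open>z div 2 \<noteq> ?z div 2\<close> by (metis right_minus_eq)
    then have "k \<noteq> node_content s g" "k + 1 \<noteq> node_content s g" "k \<noteq> node_content s g + 1" by auto
    then show ?thesis unfolding sig_step_def eq k_def[symmetric] step_at_def
      using r by (auto simp: raises_def move_def)
  next
    case False
    have "(if even z then 1 - p else p) = 1 - snd (snd g)" using False c assms(2) by (auto split: if_splits)
    then show ?thesis unfolding sig_step_def step_at_def using r by (simp add: raises_def)
  qed
  have upd: "?F' m = ?F m + (if ?z < m then - 2 else 0)" for m
    using sum_below_update[of "sig_step e s i p lam" ?z "sig_step e s i p mu" m, OF finite_sig_step[OF e0 assms(2)] other] z1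
    by simp
  have Fz: "?F (?z + 1) = ?F ?z + 1"
    using sum_below_Suc[OF finite_sig_step[OF e0 assms(2)], of s i lam ?z] z1 by simp
  have "good_node e (next_charge e s p) i mu g \<longleftrightarrow>
    (\<forall>m > ?z. ?F' m < ?F' ?z) \<and> (\<forall>m \<le> ?z. ?F' m \<le> ?F' ?z)"
    using good_node_iff_hgt[of e "next_charge e s p" i mu "sig_pos e s i p" g]
      node_less_pos[of e p _ s i mu, OF e0 assms(2)] sig_pos_inj[OF assms(2), of e s i mu] rem True
    by (simp add: sig_nodes_next_charge residue_next_charge hgt_eq_sum_below[OF i assms(2)])
  also have "\<dots> \<longleftrightarrow> (\<forall>m > ?z. ?F m \<le> ?F (?z + 1)) \<and> (\<forall>m \<le> ?z. ?F m < ?F (?z + 1))"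
    unfolding upd Fz by auto
  also have "\<dots> \<longleftrightarrow> cogood ?F ?z"
    unfolding cogood_def by (meson not_le less_imp_le)
  finally show ?thesis using True by simp
qed

lemma good_addition_unique:
  assumes "e > 1" "p \<in> {0, 1}" "adds_node lam g mu" "good_node e (next_charge e s p) i mu g"
    "adds_node lam h nu" "good_node e (next_charge e s p) i nu h"
  shows "mu = nu"
proof -
  have g: "node_residue e s g = i" "cogood (sum_below (sig_step e s i p lam)) (sig_pos e s i p g)"
    using good_node_iff_cogood[OF assms(1-3)] assms(4) by auto
  have h: "node_residue e s h = i" "cogood (sum_below (sig_step e s i p lam)) (sig_pos e s i p h)"
    using good_node_iff_cogood[OF assms(1,2,5)] assms(6) by auto
  have z: "sig_pos e s i p g = sig_pos e s i p h" using g(2) h(2) by (rule cogood_unique)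
  have r: "raises s (node_content s g) (snd (snd g)) lam mu" "raises s (node_content s h) (snd (snd h)) lam nu"
    using assms(3,5) adds_node_raises by auto
  then have "snd (snd g) \<in> {0, 1}" "snd (snd h) \<in> {0, 1}" by (auto simp: raises_def)
  then have "snd (snd g) = snd (snd h)" "node_content s g = node_content s h"
    using sig_pos_comp[OF g(1) _ assms(2)] sig_pos_comp[OF h(1) _ assms(2)] z by metis+
  then show ?thesis using r raises_unique by metis
qed

section \<open>The crystal isomorphism\<close>

definition is_flip :: "charge \<Rightarrow> bipartition \<Rightarrow> bipartition \<Rightarrow> bool" where
  "is_flip s lam th \<longleftrightarrow> level s th = level s lam \<and> word s th = flip (word s lam)"

lemma is_flip_ex:
  assumes "lam \<in> standard s"
  obtains th where "is_flip s lam th"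
proof -
  have "count_list (flip (word s lam)) False = count_list (word s lam) False"
    using count_flip[of "word s lam"] assms by (simp add: standard_def)
  then obtain th where "level s th = level s lam" "word s th = flip (word s lam)"
    using realize_word[of "flip (word s lam)" s lam] by (metis length_flip)
  then show ?thesis using that by (simp add: is_flip_def)
qed

lemma is_flip_unique: "is_flip s lam th \<Longrightarrow> is_flip s lam th' \<Longrightarrow> th = th'"
  unfolding is_flip_def using level_word_inj by metis

lemma word_adjacent:
  assumes "level s lam k = 1" "level s lam (k + 1) = 1"
  shows "word s lam = word_on s lam {..<k} @
    (k \<in> cbeads s lam (Suc 0)) # (k + 1 \<in> cbeads s lam (Suc 0)) # word_on s lam {k + 1<..}"
  unfolding word_split[of s lam k] word_on_singleton using assms by simp

text \<open>\<open>u\<close> and \<open>y\<close> are the letters on \<open>k\<close>,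
  \<open>k + 1\<close> before and after flipping. By \<open>flip_cup\<close> a cup on these sites is
  reversed in place, and its presence does not influence the flipping of the other letters.\<close>

lemma is_flip_cup:
  assumes "is_flip s lam th" and wl: "word s lam = word_on s lam {..<k} @ u @ word_on s lam {k + 1<..}"
    and u: "u = [] \<and> u' = [] \<or> u = [True, False] \<and> u' = [False, True]"
    and wt: "word s th = word_on s th {..<k} @ y @ word_on s th {k + 1<..}" "length y = length u"
  shows "y = u'" "flip (word_on s lam {..<k} @ word_on s lam {k + 1<..}) =
      word_on s th {..<k} @ word_on s th {k + 1<..}"
    "flip (word_on s lam {..<k} @ True # False # word_on s lam {k + 1<..}) =
      word_on s th {..<k} @ False # True # word_on s th {k + 1<..}"
proof -
  have len: "length (word_on s th {..<k}) = length (word_on s lam {..<k})"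
    using assms(1) by (intro length_word_on) (simp add: is_flip_def)
  obtain z where z: "length z = length (word_on s lam {..<k})"
    "flip (word_on s lam {..<k} @ word_on s lam {k + 1<..}) = z @ flip (word_on s lam {k + 1<..})"
    "flip (word_on s lam {..<k} @ True # False # word_on s lam {k + 1<..}) =
      z @ False # True # flip (word_on s lam {k + 1<..})"
    using flip_cup by blast
  have "word_on s th {..<k} @ y @ word_on s th {k + 1<..} = z @ u' @ flip (word_on s lam {k + 1<..})"
    using assms(1) wt(1) wl z(2,3) u by (auto simp: is_flip_def)
  then have "word_on s th {..<k} = z" "y = u'" "word_on s th {k + 1<..} = flip (word_on s lam {k + 1<..})"
    using z(1) len wt(2) u by (auto simp: length_Suc_conv)
  then show "y = u'" "flip (word_on s lam {..<k} @ word_on s lam {k + 1<..}) =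
      word_on s th {..<k} @ word_on s th {k + 1<..}"
    "flip (word_on s lam {..<k} @ True # False # word_on s lam {k + 1<..}) =
      word_on s th {..<k} @ False # True # word_on s th {k + 1<..}" using z by auto
qed

text \<open>Both conditions say that a cup joins \<open>k\<close> and \<open>k + 1\<close>,
  unflipped in \<open>lam\<close> and flipped in \<open>th\<close>. In the order belonging to each
  of them it shows as an addable node followed by a removable one.\<close>

lemma flip_peak:
  assumes "is_flip s lam th"
  shows "step_at s lam (Suc 0) k = 1 \<and> step_at s lam 0 k = - 1 \<longleftrightarrow>
    step_at s th 0 k = 1 \<and> step_at s th (Suc 0) k = - 1"
proof -
  have lev: "level s th = level s lam" and w: "word s th = flip (word s lam)"
    using assms by (auto simp: is_flip_def)
  have len: "length (word_on s th {..<k}) = length (word_on s lam {..<k})" using length_word_on[OF lev] .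
  have l: "step_at s lam (Suc 0) k = 1 \<and> step_at s lam 0 k = - 1 \<longleftrightarrow>
      level s lam k = 1 \<and> level s lam (k + 1) = 1 \<and> k \<in> cbeads s lam (Suc 0) \<and> k + 1 \<notin> cbeads s lam (Suc 0)"
    by (auto simp: step_at_def level_simps)
  have t: "step_at s th 0 k = 1 \<and> step_at s th (Suc 0) k = - 1 \<longleftrightarrow>
      level s lam k = 1 \<and> level s lam (k + 1) = 1 \<and> k \<notin> cbeads s th (Suc 0) \<and> k + 1 \<in> cbeads s th (Suc 0)"
    unfolding lev[symmetric] by (auto simp: step_at_def level_simps)
  have "k \<in> cbeads s lam (Suc 0) \<and> k + 1 \<notin> cbeads s lam (Suc 0) \<longleftrightarrow>
    k \<notin> cbeads s th (Suc 0) \<and> k + 1 \<in> cbeads s th (Suc 0)"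
    if lv: "level s lam k = 1" "level s lam (k + 1) = 1"
  proof -
    have wl: "word s lam = word_on s lam {..<k} @
      (k \<in> cbeads s lam (Suc 0)) # (k + 1 \<in> cbeads s lam (Suc 0)) # word_on s lam {k + 1<..}"
      using word_adjacent lv by blast
    have wt: "word s th = word_on s th {..<k} @
      (k \<in> cbeads s th (Suc 0)) # (k + 1 \<in> cbeads s th (Suc 0)) # word_on s th {k + 1<..}"
      using word_adjacent[of s th k] lv unfolding lev by blast
    show ?thesis
    proof
      assume "k \<in> cbeads s lam (Suc 0) \<and> k + 1 \<notin> cbeads s lam (Suc 0)"
      then have "word s lam = word_on s lam {..<k} @ [True, False] @ word_on s lam {k + 1<..}" using wl by simp
      from is_flip_cup(1)[OF assms this, of "[False, True]" "[k \<in> cbeads s th (Suc 0), k + 1 \<in> cbeads s th (Suc 0)]"]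
      show "k \<notin> cbeads s th (Suc 0) \<and> k + 1 \<in> cbeads s th (Suc 0)" using wt by simp
    next
      assume "k \<notin> cbeads s th (Suc 0) \<and> k + 1 \<in> cbeads s th (Suc 0)"
      then have "flip (word_on s lam {..<k} @
        (k \<in> cbeads s lam (Suc 0)) # (k + 1 \<in> cbeads s lam (Suc 0)) # word_on s lam {k + 1<..}) =
        word_on s th {..<k} @ False # True # word_on s th {k + 1<..}" using w wt wl by simp
      from flip_False_True[OF this len] show "k \<in> cbeads s lam (Suc 0) \<and> k + 1 \<notin> cbeads s lam (Suc 0)" by simp
    qed
  qed
  then show ?thesis unfolding l t by blast
qed

text \<open>The sum over both components is a difference of levels, and flipping keeps the
  levels.\<close>

lemma flip_step_sum:
  assumes "is_flip s lam th"
  shows "step_at s lam 0 k + step_at s lam (Suc 0) k = step_at s th 0 k + step_at s th (Suc 0) k"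
proof -
  have "step_at s mu 0 k + step_at s mu (Suc 0) k = int (level s mu k) - int (level s mu (k + 1))" for mu
    by (simp add: step_at_def level_def)
  then show ?thesis using assms by (simp add: is_flip_def)
qed

text \<open>The heights of \<open>lam\<close> and \<open>th\<close>, each for its own order, satisfy
  the assumptions of \<open>cogood_transfer\<close>, so the good additions have the same content. A
  distinction by the levels at the two sites shows that the results are again related by flipping.
  The first conclusion serves \<open>uglov_Phi_infinity_step\<close>.\<close>

lemma crystal_transfer:
  assumes e: "e > 1" and standard: "lam \<in> standard s" and fl: "is_flip s lam th"
    and ad: "adds_node lam g mu" and good: "good_node e s i mu g"
  shows "snd (snd g) = Suc 0 \<Longrightarrow> node_content s g \<in> cbeads s lam 0 \<Longrightarrow> node_content s g + 1 \<in> cbeads s lam 0"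
    "mu \<in> standard s"
    "\<exists>th' h. is_flip s mu th' \<and> adds_node th h th' \<and> good_node e (next_charge e s 1) i th' h"
proof -
  have e0: "e > 0" using e by simp
  have lev: "level s th = level s lam" and w: "word s th = flip (word s lam)"
    using fl by (auto simp: is_flip_def)
  have p: "pend (word s lam) = 0" using standard by (simp add: standard_def)
  define j c where "j = node_content s g" and "c = snd (snd g)"
  have r: "raises s j c lam mu" unfolding j_def c_def using adds_node_raises[OF ad] .
  then have c01: "c = 0 \<or> c = Suc 0" by (auto simp: raises_def)
  have s0: "next_charge e s 0 = s" by (simp add: next_charge_def)
  let ?F = "sum_below (sig_step e s i 0 lam)" and ?G = "sum_below (sig_step e s i 1 th)"
  let ?z = "sig_pos e s i 0 g"
  have res: "node_residue e s g = i" and co: "cogood ?F ?z"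
    using good_node_iff_cogood[OF e, of 0 lam g mu s i] ad good s0 by auto
  have i: "0 \<le> i" "i < e" using res e by (auto simp: node_residue_def)
  define t where "t = ?z div 2"
  have z: "?z = 2 * t + (if c = 0 then 1 else 0)" and jt: "i + e * t = j"
    using sig_pos_comp[OF res, of 0] c01 unfolding t_def j_def c_def by (auto simp: sig_pos_def)
  have F_step: "?F (m + 1) = ?F m + sig_step e s i 0 lam m" for m
    by (rule sum_below_Suc[OF finite_sig_step[OF e0]]) simp
  have G_step: "?G (m + 1) = ?G m + sig_step e s i 1 th m" for m
    by (rule sum_below_Suc[OF finite_sig_step[OF e0]]) simp
  have sF: "sig_step e s i 0 lam (2 * u) = step_at s lam (Suc 0) (i + e * u)"
    "sig_step e s i 0 lam (2 * u + 1) = step_at s lam 0 (i + e * u)" for u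
    by (simp_all add: sig_step_def)
  have sG: "sig_step e s i 1 th (2 * u) = step_at s th 0 (i + e * u)"
    "sig_step e s i 1 th (2 * u + 1) = step_at s th (Suc 0) (i + e * u)" for u
    by (simp_all add: sig_step_def)
  have F2: "?F (2 * u + 1) = ?F (2 * u) + step_at s lam (Suc 0) (i + e * u)"
    "?F (2 * u + 2) = ?F (2 * u) + step_at s lam (Suc 0) (i + e * u) + step_at s lam 0 (i + e * u)" for u
    using F_step[of "2 * u"] F_step[of "2 * u + 1"] sF by (simp_all add: add.assoc)
  have G2: "?G (2 * u + 1) = ?G (2 * u) + step_at s th 0 (i + e * u)"
    "?G (2 * u + 2) = ?G (2 * u) + step_at s th 0 (i + e * u) + step_at s th (Suc 0) (i + e * u)" for u
    using G_step[of "2 * u"] G_step[of "2 * u + 1"] sG by (simp_all add: add.assoc)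
  have even: "?F (2 * u) = ?G (2 * u)" for u
  proof (rule sum_below_eqI)
    show "finite {z. sig_step e s i 0 lam z \<noteq> 0}" "finite {z. sig_step e s i 1 th z \<noteq> 0}"
      by (rule finite_sig_step[OF e0], simp)+
    show "sig_step e s i 0 lam (2 * v) + sig_step e s i 0 lam (2 * v + 1) =
      sig_step e s i 1 th (2 * v) + sig_step e s i 1 th (2 * v + 1)" for v
      unfolding sF sG using flip_step_sum[OF fl, of "i + e * v"] by simp
  qed
  have step_le: "\<bar>step_at s nu d k\<bar> \<le> 1" for nu d k by (simp add: step_at_def)
  have peak: "?F (2 * u + 1) = ?F (2 * u) + 1 \<and> ?F (2 * u + 2) = ?F (2 * u) \<longleftrightarrow>
    ?G (2 * u + 1) = ?G (2 * u) + 1 \<and> ?G (2 * u + 2) = ?G (2 * u)" for u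
    using flip_peak[OF fl, of "i + e * u"] unfolding F2 G2 by auto
  let ?z' = "if ?G (2 * t + 1) = ?F (?z + 1) then 2 * t else 2 * t + 1"
  have "\<bar>?F (m + 1) - ?F m\<bar> \<le> 1" "\<bar>?G (m + 1) - ?G m\<bar> \<le> 1" for m
    unfolding F_step G_step by (simp_all only: add_diff_cancel_left' sig_step_def step_le)
  then have co': "cogood ?G ?z'"
    using cogood_transfer[OF even _ _ peak co t_def[symmetric]] by blast
  have Fz: "?F (?z + 1) = (if c = 0 then ?F (2 * t) + step_at s lam (Suc 0) j + step_at s lam 0 j
    else ?F (2 * t) + step_at s lam (Suc 0) j)"
    unfolding z using F2[of t] jt by (simp add: add.assoc)
  have le: "?F m \<le> ?F (?z + 1)" "m \<le> ?z \<Longrightarrow> ?F m < ?F (?z + 1)" for m using co by (auto simp: cogood_def)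
  \<comment> \<open>A node of the second component is the first step of its block, and maximality
    behind it keeps the other step from rising. A node of the first component is the second step,
    and strictness at the left end of the block keeps the other step from falling.\<close>
  have c1: "step_at s lam (Suc 0) j = 1 \<and> step_at s lam 0 j \<le> 0" if "c = Suc 0"
    using le(1)[of "2 * t + 2"] that r F2(2)[of t] jt unfolding Fz by (auto simp: raises_def step_at_def)
  have c0: "step_at s lam 0 j = 1 \<and> step_at s lam (Suc 0) j \<ge> 0" if "c = 0"
    using le(2)[of "2 * t"] that r z unfolding Fz by (auto simp: raises_def step_at_def)
  show "snd (snd g) = Suc 0 \<Longrightarrow> node_content s g \<in> cbeads s lam 0 \<Longrightarrow> node_content s g + 1 \<in> cbeads s lam 0"
    using c1 unfolding c_def j_def step_at_def by (cases "node_content s g + 1 \<in> cbeads s lam 0") simp_all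
  \<comment> \<open>The good addition to \<open>th\<close> also lies in block \<open>t\<close>,
    hence has content \<open>j\<close>; the parity of its position tells the component.\<close>
  define c' where "c' = (if even ?z' then 0 else Suc 0)"
  have "?G (?z' + 1) > ?G ?z'" using co' by (auto simp: cogood_def)
  then have "sig_step e s i 1 th ?z' > 0" unfolding G_step by simp
  moreover have "sig_step e s i 1 th ?z' = step_at s th c' j"
    unfolding c'_def jt[symmetric] using sG[of t] by (simp only: split: if_split) simp
  ultimately have "j \<in> cbeads s th c'" "j + 1 \<notin> cbeads s th c'" by (auto simp: step_at_def split: if_splits)
  moreover have c'01: "c' \<in> {0, 1}" by (simp add: c'_def)
  ultimately obtain th' where r': "raises s j c' th th'" using raises_ex by blast
  obtain h where h: "adds_node th h th'" "node_content s h = j" "snd (snd h) = c'"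
    using r' by (rule raises_adds_node)
  have res': "node_residue e s h = i" using res h(2) unfolding node_residue_def j_def by simp
  have "sig_pos e s i 1 h = ?z'"
  proof -
    have "(j - i) div e = t" using jt e0 by auto
    then show ?thesis unfolding sig_pos_def h(2,3) c'_def by simp
  qed
  then have good': "good_node e (next_charge e s 1) i th' h"
    using good_node_iff_cogood[OF e, of 1 th h th' s i] h(1) res' co' by simp
  have lev': "level s th' = level s mu"
    using raises_level(1)[OF r'] raises_level(1)[OF r] lev by simp
  have "pend (word s mu) = 0 \<and> word s th' = flip (word s mu)"
  proof -
    consider "level s lam j = 1 \<and> level s lam (j + 1) = 0 \<or> level s lam j = 2 \<and> level s lam (j + 1) = 1"
      | "level s lam j = 2" "level s lam (j + 1) = 0" | "level s lam j = 1" "level s lam (j + 1) = 1"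
      using raises_level(2,3)[OF r] level_le[of s lam j] by linarith
    then show ?thesis
    proof cases
      case 1
      have "word s mu = word s lam" by (rule f_cup_vector_single(2)[OF 1 r])
      moreover have "word s th' = word s th"
        by (rule f_cup_vector_single(2)[OF _ r']) (use 1 lev in simp)
      ultimately show ?thesis using p w by simp
    next
      \<comment> \<open>Both steps of the block rise, so each order adds the node to the component
        that it reads second. This creates a cup, unflipped in \<open>mu\<close> and flipped in
        \<open>th'\<close>.\<close>
      case 2
      then have m: "j \<in> cbeads s lam 0" "j \<in> cbeads s lam (Suc 0)" "j + 1 \<notin> cbeads s lam 0" "j + 1 \<notin> cbeads s lam (Suc 0)"
        by (auto simp: level_simps)
      have "c = 0" using c1 c01 m by (auto simp: step_at_def)
      then have r0: "raises s j 0 lam mu" using r by simp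
      note ws = f_cup_vector_cup(2,3)[OF 2 r0]
      have "?F (?z + 1) = ?F (2 * t) + 2" unfolding Fz using \<open>c = 0\<close> m by (simp add: step_at_def)
      moreover have "?G (2 * t + 1) \<le> ?F (2 * t) + 1" using G2(1)[of t] even[of t] step_le[of th 0 "i + e * t"] by simp
      ultimately have c': "c' = Suc 0" unfolding c'_def by auto
      have lt: "level s th j = 2" "level s th (j + 1) = 0" using 2 lev by auto
      have wt: "word s th = word_on s th {..<j} @ word_on s th {j + 1<..}"
        unfolding word_split[of s th j] using lt by (simp add: word_on_singleton)
      have lt': "level s th' j = 1" "level s th' (j + 1) = 1"
        unfolding raises_level(1)[OF r'] shift_def using lt by auto
      have "j \<notin> cbeads s th' (Suc 0)" "j + 1 \<in> cbeads s th' (Suc 0)"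
        using r' c' by (auto simp: raises_def move_def)
      then have wt': "word s th' = word_on s th {..<j} @ False # True # word_on s th {j + 1<..}"
        using word_adjacent[OF lt'] raises_word_on[OF r'] by simp
      show ?thesis
        using is_flip_cup(3)[OF fl, of j "[]" "[]" "[]"] wt wt' ws p pend_cup by simp
    next
      \<comment> \<open>The node starts a peak, so a cup joins the two sites. Raising the second
        component of \<open>lam\<close> and the first component of \<open>th\<close> removes it from
        both words.\<close>
      case 3
      have "c = Suc 0"
      proof (rule ccontr)
        assume "c \<noteq> Suc 0"
        then have "c = 0" using c01 by simp
        then show False using c0 3 by (auto simp: step_at_def level_simps)
      qed
      then have r1: "raises s j (Suc 0) lam mu" using r by simp
      note ws = f_cup_vector_cap_adjacent(2,3)[OF 3 r1]
      have "step_at s lam (Suc 0) j = 1 \<and> step_at s lam 0 j = - 1"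
        using r1 3 by (auto simp: raises_def step_at_def level_simps)
      then have st: "step_at s th 0 j = 1" "step_at s th (Suc 0) j = - 1"
        using flip_peak[OF fl] by auto
      have "?F (?z + 1) = ?F (2 * t) + 1" unfolding Fz using \<open>c = Suc 0\<close> c1 by simp
      moreover have "?G (2 * t + 1) = ?F (2 * t) + 1" using G2(1)[of t] even[of t] st jt by simp
      ultimately have c': "c' = 0" unfolding c'_def by simp
      have lt: "level s th j = 1" "level s th (j + 1) = 1" using 3 lev by auto
      have wt: "word s th = word_on s th {..<j} @
        (j \<in> cbeads s th (Suc 0)) # (j + 1 \<in> cbeads s th (Suc 0)) # word_on s th {j + 1<..}"
        by (rule word_adjacent[OF lt])
      have "word s th' = word_on s th {..<j} @ word_on s th {j + 1<..}"
        using lookup_f_cap(2)[OF lt raises_level(1)[OF r']] raises_word_on[OF r'] by simp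
      then show ?thesis
        using is_flip_cup(2)[OF fl, of j "[True, False]" "[False, True]"
            "[j \<in> cbeads s th (Suc 0), j + 1 \<in> cbeads s th (Suc 0)]"] wt ws p pend_cup by simp
    qed
  qed
  then show "mu \<in> standard s" "\<exists>th' h. is_flip s mu th' \<and> adds_node th h th' \<and> good_node e (next_charge e s 1) i th' h"
    using h(1) good' lev' unfolding standard_def is_flip_def by blast+
qed

text \<open>A violation arises only in row \<open>k + d\<close> of the second component, when row
  \<open>k\<close> of the first has its bead on the site \<open>j\<close> of the added node. By
  \<open>crystal_transfer\<close> the first component then also has a bead on \<open>j + 1\<close>,
  belonging to an earlier row. But the inequality for row \<open>k - 1\<close> makes that row so
  long that its bead lies further right.\<close>

lemma uglov_Phi_infinity_step:
  assumes s: "fst s \<le> snd s" and e: "e > 1" and standard: "lam \<in> standard s" and Phi: "lam \<in> Phi_infinity s n"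
    and ad: "adds_node lam g mu" and good: "good_node e s i mu g"
  shows "mu \<in> Phi_infinity s (Suc n)"
proof -
  define d where "d = nat (snd s - fst s)"
  have d: "int d = snd s - fst s" using s by (simp add: d_def)
  have rank: "mu \<in> bipartitions (Suc n)"
    using Phi adds_node_rank[OF ad] by (simp add: Phi_infinity_def bipartitions_def)
  have le: "part (snd lam) (k + d) \<le> part (fst lam) k" if "k \<ge> 1" for k
    using Phi that by (simp add: Phi_infinity_def d_def)
  obtain a b c where g: "g = (a, b, c)" by (cases g) auto
  note comp = adds_node_component[OF ad[unfolded g]]
  have c: "c = 0 \<or> c = Suc 0" using comp(1) by simp
  note other = comp(2)
  note pt = pdiag_insert_part[OF comp(3,4)]
  have "part (snd mu) (k + d) \<le> part (fst mu) k" if k: "k \<ge> 1" for k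
    using c
  proof
    assume c: "c = 0"
    have "part (fst lam) k \<le> part (fst mu) k"
      using pt(3,4) pt(5)[OF k] c by (cases "k = a") (auto simp: component_def)
    then show ?thesis using le[OF k] other c by (simp add: component_def)
  next
    assume c: "c = Suc 0"
    have fst_eq: "fst mu = fst lam" using other c by (simp add: component_def)
    have pt': "part (snd mu) a = b" "part (snd lam) a = b - 1" "\<And>a'. 1 \<le> a' \<Longrightarrow> a' \<noteq> a \<Longrightarrow> part (snd mu) a' = part (snd lam) a'"
      using pt(3-5) c by (auto simp: component_def)
    show ?thesis
    proof (cases "k + d = a")
      case False
      then show ?thesis using le[OF k] pt'(3)[of "k + d"] k fst_eq by simp
    next
      case True
      show ?thesis
      proof (rule ccontr)
        assume "\<not> ?thesis"
        then have pk: "part (fst lam) k = b - 1"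
          using le[OF k] pt' True fst_eq by simp
        have cb: "cbeads s lam 0 = (\<lambda>a. int (part (fst lam) a) - int a + fst s + 1) ` {1..}"
          by (simp add: cbeads_def component_def beads_eq)
        have cont: "node_content s g = int b - int a + snd s" by (simp add: g c)
        have "node_content s g = int (part (fst lam) k) - int k + fst s + 1"
          using cont pk pt(2) True d by simp
        then have "node_content s g \<in> cbeads s lam 0" unfolding cb using k by auto
        then have "node_content s g + 1 \<in> cbeads s lam 0"
        proof -
          obtain th where "is_flip s lam th" using is_flip_ex[OF standard] .
          then show ?thesis using crystal_transfer(1)[OF e standard _ ad good] c \<open>node_content s g \<in> cbeads s lam 0\<close> by (simp add: g)
        qed
        then obtain k' where k': "1 \<le> k'" "node_content s g + 1 = int (part (fst lam) k') - int k' + fst s + 1"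
          unfolding cb by auto
        then have eq: "int (part (fst lam) k') - int k' = int (part (fst lam) k) - int k + 1"
          using \<open>node_content s g = int (part (fst lam) k) - int k + fst s + 1\<close> by simp
        have "k' < k" using part_antimono[OF k, of k' "fst lam"] eq by (cases "k \<le> k'") auto
        then have "k - 1 \<ge> 1" "k' \<le> k - 1" using k' by auto
        have "part (fst lam) k' \<ge> part (fst lam) (k - 1)" using part_antimono[OF k'(1) \<open>k' \<le> k - 1\<close>] .
        moreover have "part (fst lam) (k - 1) \<ge> part (snd lam) (k - 1 + d)" by (rule le[OF \<open>k - 1 \<ge> 1\<close>])
        moreover have "part (snd lam) (k - 1 + d) = part (snd mu) (k - 1 + d)"
          using pt'(3)[of "k - 1 + d"] True \<open>k - 1 \<ge> 1\<close> by simp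
        moreover have "part (snd mu) (k - 1 + d) \<ge> part (snd mu) a"
          by (rule part_antimono) (use True \<open>k - 1 \<ge> 1\<close> in auto)
        ultimately have "part (fst lam) k' \<ge> b" using pt'(1) by simp
        moreover have "int k' \<le> int k - 1" using \<open>k' < k\<close> by simp
        ultimately show False using eq pk pt(2) by linarith
      qed
    qed
  qed
  then show ?thesis using rank unfolding Phi_infinity_def d_def by simp
qed

lemma is_flip_empty:
  assumes "fst s \<le> snd s" "is_flip s empty_bipartition th"
  shows "th = empty_bipartition"
proof -
  have "flip (replicate n True) = replicate n True" for n
    by (induction n) (simp_all add: pend_replicate_True)
  then have "word s th = word s empty_bipartition"
    using word_empty[OF assms(1)] assms(2) unfolding is_flip_def by metis
  then show ?thesis using assms(2) level_word_inj unfolding is_flip_def by blast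
qed

lemma empty_Phi_infinity: "empty_bipartition \<in> Phi_infinity s 0"
  by (simp add: Phi_infinity_def bipartitions_def bip_rank_def empty_bipartition_def part_def Abs_partition_inverse)

section \<open>The crystal isomorphism as the flipping of all cups\<close>

lemma uglov_std_Phi:
  assumes "e > 1" "fst s \<le> snd s"
  shows "lam \<in> uglov e s n \<Longrightarrow> lam \<in> standard s \<and> lam \<in> Phi_infinity s n"
proof (induction n arbitrary: lam)
  case 0
  then show ?case using cup_vector_empty(2)[OF assms(2)] empty_Phi_infinity by simp
next
  case (Suc n)
  then obtain i g lam' where g: "good_node e s i lam g" "adds_node lam' g lam" "lam' \<in> uglov e s n" by auto
  then have IH: "lam' \<in> standard s" "lam' \<in> Phi_infinity s n" using Suc by auto
  obtain th where "is_flip s lam' th" using is_flip_ex[OF IH(1)] .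
  then have "lam \<in> standard s" using crystal_transfer(2)[OF assms(1) IH(1) _ g(2,1)] by blast
  then show ?case using uglov_Phi_infinity_step[OF assms(2,1) IH g(2,1)] by blast
qed

lemma crystal_match_flip:
  assumes "e > 1" "fst s \<le> snd s"
  shows "lam \<in> uglov e s n \<Longrightarrow> \<exists>th. is_flip s lam th \<and> crystal_match e s (next_charge e s 1) lam th"
proof (induction n arbitrary: lam)
  case 0
  have "empty_bipartition \<in> standard s" by (rule cup_vector_empty(2)[OF assms(2)])
  then obtain th where "is_flip s empty_bipartition th" using is_flip_ex by blast
  then show ?case using is_flip_empty[OF assms(2)] 0 crystal_match.intros(1) by fastforce
next
  case (Suc n)
  then obtain i g lam' where g: "good_node e s i lam g" "adds_node lam' g lam" "lam' \<in> uglov e s n" by auto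
  obtain th where th: "is_flip s lam' th" "crystal_match e s (next_charge e s 1) lam' th"
    using Suc.IH[OF g(3)] by blast
  have "lam' \<in> standard s" using uglov_std_Phi[OF assms g(3)] by blast
  from crystal_transfer(3)[OF assms(1) this th(1) g(2,1)]
  obtain th' h where "is_flip s lam th'" "adds_node th h th'" "good_node e (next_charge e s 1) i th' h" by blast
  then show ?case using crystal_match.intros(2)[OF Suc.prems g th(2)] by blast
qed

text \<open>Whatever path through the crystal is taken, the partner is the flip, which does not
  depend on the path. This is the uniqueness that the description operator in \<open>Psi\<close>
  requires.\<close>

lemma crystal_match_is_flip:
  assumes "e > 1" "fst s \<le> snd s" "crystal_match e s (next_charge e s 1) lam mu"
  shows "is_flip s lam mu"
  using assms(3)
proof induction
  case 1
  have "empty_bipartition \<in> standard s" by (rule cup_vector_empty(2)[OF assms(2)])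
  then obtain th where "is_flip s empty_bipartition th" using is_flip_ex by blast
  then show ?case using is_flip_empty[OF assms(2)] by metis
next
  case (2 lam n i g lam' mu' h mu)
  have "lam' \<in> standard s" using uglov_std_Phi[OF assms(1,2) "2.hyps"(4)] by blast
  from crystal_transfer(3)[OF assms(1) this "2.IH" "2.hyps"(3,2)]
  obtain th' h' where th': "is_flip s lam th'" "adds_node mu' h' th'" "good_node e (next_charge e s 1) i th' h'" by blast
  have "th' = mu" by (rule good_addition_unique[OF assms(1) _ th'(2,3) "2.hyps"(6,7)]) simp
  then show ?case using th'(1) by simp
qed

theorem theorem5p2:
  fixes e s\<^sub>0 s\<^sub>1 :: int and n :: nat and lam mu :: bipartition
  assumes "e > 1"
    and "s\<^sub>0 \<le> s\<^sub>1"
    and "lam \<in> uglov e (s\<^sub>0, s\<^sub>1) n"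
    and "mu \<in> bipartitions n"
  shows "Psi e (s\<^sub>0, s\<^sub>1) (s\<^sub>0, s\<^sub>1 + e) lam = mu \<longleftrightarrow>
    (\<forall>nu \<in> bipartitions n.
       poly_degree (canonical_coeff (s\<^sub>0, s\<^sub>1) lam nu)
         \<le> poly_degree (canonical_coeff (s\<^sub>0, s\<^sub>1) lam mu))"
proof -
  let ?s = "(s\<^sub>0, s\<^sub>1)"
  have s: "fst ?s \<le> snd ?s" using assms(2) by simp
  have s': "(s\<^sub>0, s\<^sub>1 + e) = next_charge e ?s 1" by (simp add: next_charge_def)
  have standard: "lam \<in> standard ?s" and Phi: "lam \<in> Phi_infinity ?s n"
    using uglov_std_Phi[OF assms(1) s assms(3)] by auto
  then have rank: "bip_rank lam = n" by (simp add: Phi_infinity_def bipartitions_def)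
  obtain th where th: "is_flip ?s lam th" "crystal_match e ?s (next_charge e ?s 1) lam th"
    using crystal_match_flip[OF assms(1) s assms(3)] by blast
  have "Psi e ?s (next_charge e ?s 1) lam = th"
    unfolding Psi_def
    using th crystal_match_is_flip[OF assms(1) s] is_flip_unique by (intro the_equality) blast+
  moreover have can: "canonical ?s lam = cup_vector ?s lam"
    using canonical_eq_cup_vector[OF s standard] Phi rank by simp
  \<comment> \<open>\<open>th\<close> occurs in the cup vector of \<open>lam\<close>, all of whose
    terms have the rank of \<open>lam\<close>.\<close>
  moreover have "th \<in> bipartitions n"
  proof -
    have lev: "level ?s th = level ?s lam" and w: "word ?s th = flip (word ?s lam)"
      using th(1) by (auto simp: is_flip_def)
    have p: "pend (word ?s lam) = 0" using standard by (simp add: standard_def)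
    have "cup_deg [] (word ?s lam) (word ?s th) = Some (count_list (word ?s lam) False)"
      using cup_deg_max[of "word ?s lam" "[]" "word ?s th"] p w by simp
    then have "coeff_of (cup_vector ?s lam) th \<noteq> 0"
      using lev v_param_nonzero by (simp add: lookup_cup_vector cup_coeff_def)
    then have "th \<in> Poly_Mapping.keys (cup_vector ?s lam)" by (simp add: in_keys_iff)
    then show ?thesis using cup_vector_generated[OF s standard] rank by blast
  qed
  ultimately show ?thesis
    using canonical_coeff_max[OF can standard, of th n mu] th(1) unfolding s' is_flip_def by auto
qed

end
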